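(* Let $p>1$, $R>0$, $\gamma-\alpha\ge 0$, and consider the singular problem $$\begin{cases}\psi''+\left(\dfrac{N-1}{r}-\dfrac{\alpha}{R-r}\right)\psi'=a(r)(R-r)^{\gamma-\alpha}\psi^p\quad\text{in }(0,R),\\ \psi'(0)=0,\qquad \lim\limits_{r\to R}\psi(r)=+\infty,\end{cases}\quad (S)$$ where $a\in C([0,R];(0,\infty))$. Then, for each $\varepsilon>0$, the problem $(S)$ possesses a positive solution $\psi_\varepsilon$ such that $$1-\varepsilon\le\liminf_{r\to R}\frac{\psi_\varepsilon(r)}{K(R-r)^{-\beta}}\le\limsup_{r\to R}\frac{\psi_\varepsilon(r)}{K(R-r)^{-\beta}}\le 1+\varepsilon,$$ where $$K:=\left(\frac{\beta(\beta+1-\alpha)}{a(R)}\right)^{1/(p-1)}\qquad\text{and}\qquad \beta=\frac{2+\gamma-\alpha}{p-1}.$$ Therefore, for each $x_0\in\mathbb{R}^N$, the function $u_\varepsilon(x):=\psi_\varepsilon(r)$, $r:=|x-x_0|$, gives a radially symmetric nonnegative solution of $$\begin{cases}-\mathrm{div}(d^\alpha\nabla u)+a(|x-x_0|)\,d^\gamma(x)\,u^p=0\quad\text{in }B_R(x_0),\\ u=\infty\quad\text{on }\partial B_R(x_0),\end{cases}\quad (B)$$ satisfying $$1-\varepsilon\le\liminf_{d(x)\to 0}\frac{u_\varepsilon(x)}{K\,d(x)^{-\beta}}\le\limsup_{d(x)\to 0}\frac{u_\varepsilon(x)}{K\,d(x)^{-\beta}}\le 1+\varepsilon .$$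
   Context: Here $N\ge 1$, $\alpha,\gamma\in\mathbb{R}$, $B_R(x_0)\subset\mathbb{R}^N$ is the ball of radius $R$ centered at $x_0$, and $d(x):=\mathrm{dist}(x,\partial B_R(x_0))=R-|x-x_0|$ for $x\in B_R(x_0)$. The equation in $(S)$ is the equation in $(B)$ written for radially symmetric functions $u(x)=\psi(|x-x_0|)$. Solutions of $(B)$ are local weak large solutions with weight $w=d^\alpha$. For an open set $\Omega'$, $L^2(\Omega';w)$ is the space of measurable $v$ with $\int_{\Omega'}|v|^2w\,dx<\infty$; $W^{1,2}(\Omega';w)$ is the space of $v\in L^1_{\rm loc}(\Omega')$ such that $v$ and its first-order distributional derivatives belong to $L^2(\Omega';w)$, with norm $\|v\|_{L^2(\Omega';w)}+\|\nabla v\|_{L^2(\Omega';w)}$; and $W^{1,2}_0(\Omega';w)$ is the completion of $C_0^\infty(\Omega')$ in this norm. A local weak large solution of $(B)$ is a continuous function $u$ on $B_R(x_0)$ such that $u(x)\to\infty$ as $x\to\partial B_R(x_0)$ and such that, for every open $\Omega'$ whose closure is a compact subset of $B_R(x_0)$, $u\in W^{1,2}(\Omega';w)$, $u^p\in L^2(\Omega';w)$ and $$\int_{\Omega'}\nabla u\cdot\nabla\varphi\; d^\alpha\,dx+\int_{\Omega'}a(|x-x_0|)\,d^\gamma\,u^p\,\varphi\,dx=0$$ for all $\varphi\in W^{1,2}_0(\Omega';w)$ with compact support in $\Omega'$.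
   Formalization: The formal theorem additionally assumes β+1−α>0, so that K is a well-defined positive number; otherwise K is zero, negative or undefined, or the claimed asymptotics fail (e.g. N=1, p=2, α=γ=4, a=1 gives K=−1 while ψ is positive). *)

theory Defs
  imports "HOL-Analysis.Analysis"
begin

primrec Ck :: "nat \<Rightarrow> ('a::euclidean_space \<Rightarrow> real) \<Rightarrow> bool" where
  "Ck 0 f \<longleftrightarrow> continuous_on UNIV f"
| "Ck (Suc k) f \<longleftrightarrow> f differentiable_on UNIV \<and>
     (\<forall>b\<in>Basis. Ck k (\<lambda>x. frechet_derivative f (at x) b))"

definition test_functions :: "'a::euclidean_space set \<Rightarrow> ('a \<Rightarrow> real) set" where
  "test_functions \<Omega> = {\<phi>. (\<forall>k. Ck k \<phi>) \<and>
     compact (closure {x. \<phi> x \<noteq> 0}) \<and> closure {x. \<phi> x \<noteq> 0} \<subseteq> \<Omega>}"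

definition grad :: "('a::euclidean_space \<Rightarrow> real) \<Rightarrow> 'a \<Rightarrow> 'a" where
  "grad \<phi> x = (\<Sum>b\<in>Basis. frechet_derivative \<phi> (at x) b *\<^sub>R b)"

definition L1_loc :: "'a::euclidean_space set \<Rightarrow> ('a \<Rightarrow> 'b::euclidean_space) \<Rightarrow> bool" where
  "L1_loc \<Omega> f \<longleftrightarrow> (\<forall>C. compact C \<and> C \<subseteq> \<Omega> \<longrightarrow> integrable (lebesgue_on C) f)"

definition has_weak_gradient ::
  "'a::euclidean_space set \<Rightarrow> ('a \<Rightarrow> real) \<Rightarrow> ('a \<Rightarrow> 'a) \<Rightarrow> bool" where
  "has_weak_gradient \<Omega> v g \<longleftrightarrow> L1_loc \<Omega> v \<and> L1_loc \<Omega> g \<and>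
     (\<forall>\<phi>\<in>test_functions \<Omega>.
        (LINT x|lebesgue_on \<Omega>. v x *\<^sub>R grad \<phi> x) = - (LINT x|lebesgue_on \<Omega>. \<phi> x *\<^sub>R g x))"

definition L2w :: "'a::euclidean_space set \<Rightarrow> ('a \<Rightarrow> real) \<Rightarrow> ('a \<Rightarrow> 'b::euclidean_space) set" where
  "L2w \<Omega> w = {f \<in> borel_measurable (lebesgue_on \<Omega>).
     integrable (lebesgue_on \<Omega>) (\<lambda>x. (norm (f x))\<^sup>2 * w x)}"

definition L2w_norm :: "'a::euclidean_space set \<Rightarrow> ('a \<Rightarrow> real) \<Rightarrow> ('a \<Rightarrow> 'b::euclidean_space) \<Rightarrow> real" where
  "L2w_norm \<Omega> w f = sqrt (LINT x|lebesgue_on \<Omega>. (norm (f x))\<^sup>2 * w x)"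

text \<open>Elements of the Sobolev spaces are carried together with their gradient, which is
  determined only almost everywhere: the pair \<open>(v, g)\<close> belongs to \<open>W12 \<Omega> w\<close> iff
  \<open>v\<close> is in $W^{1,2}(\Omega;w)$ and \<open>g\<close> is (a representative of) its distributional gradient.\<close>

definition W12 :: "'a::euclidean_space set \<Rightarrow> ('a \<Rightarrow> real) \<Rightarrow> (('a \<Rightarrow> real) \<times> ('a \<Rightarrow> 'a)) set" where
  "W12 \<Omega> w = {(v, g). has_weak_gradient \<Omega> v g \<and> v \<in> L2w \<Omega> w \<and> g \<in> L2w \<Omega> w}"

text \<open>The completion of the test functions, realised as their closure in \<open>W12 \<Omega> w\<close>.
  This is the same as the abstract completion whenever \<open>w\<close> is bounded and bounded away from 0 on
  \<open>\<Omega>\<close>, as it is for a power of the distance to the boundary and \<open>\<Omega>\<close> relatively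
  compact in the ball.\<close>

definition W12_0 :: "'a::euclidean_space set \<Rightarrow> ('a \<Rightarrow> real) \<Rightarrow> (('a \<Rightarrow> real) \<times> ('a \<Rightarrow> 'a)) set" where
  "W12_0 \<Omega> w = {(v, g) \<in> W12 \<Omega> w. \<exists>\<phi>. (\<forall>n::nat. \<phi> n \<in> test_functions \<Omega>) \<and>
     (\<lambda>n. L2w_norm \<Omega> w (\<lambda>x. \<phi> n x - v x) + L2w_norm \<Omega> w (\<lambda>x. grad (\<phi> n) x - g x))
       \<longlonglongrightarrow> 0}"

definition bdist :: "'a::euclidean_space \<Rightarrow> real \<Rightarrow> 'a \<Rightarrow> real" where
  "bdist x\<^sub>0 R x = infdist x (frontier (ball x\<^sub>0 R))"

lemma bdist_eq:
  fixes x :: "'a::euclidean_space"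
  assumes "x \<in> ball x\<^sub>0 R"
  shows "bdist x\<^sub>0 R x = R - norm (x - x\<^sub>0)"
proof -
  have R: "R > 0" using assms by (metis ball_eq_empty empty_iff not_le)
  have fr: "frontier (ball x\<^sub>0 R) = sphere x\<^sub>0 R" using R by simp
  have nx: "norm (x - x\<^sub>0) < R" using assms by (simp add: dist_norm norm_minus_commute)
  obtain e :: 'a where e: "norm e = 1" "x - x\<^sub>0 = norm (x - x\<^sub>0) *\<^sub>R e"
  proof (cases "x = x\<^sub>0")
    case True
    then show thesis using that[of "SOME b. b \<in> Basis"] by (simp add: SOME_Basis)
  next
    case False
    then show thesis using that[of "(x - x\<^sub>0) /\<^sub>R norm (x - x\<^sub>0)"] by simp
  qed
  define y where "y = x\<^sub>0 + R *\<^sub>R e"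
  have y: "y \<in> sphere x\<^sub>0 R" using R e(1) by (simp add: y_def dist_norm)
  have "x - y = (norm (x - x\<^sub>0) - R) *\<^sub>R e"
    using e(2) by (simp add: y_def algebra_simps)
  then have dxy: "dist x y = R - norm (x - x\<^sub>0)" using e(1) nx by (simp add: dist_norm)
  have "R - norm (x - x\<^sub>0) \<le> dist x z" if "z \<in> sphere x\<^sub>0 R" for z
    using that dist_triangle[of x\<^sub>0 z x] by (simp add: dist_norm norm_minus_commute)
  then have "R - norm (x - x\<^sub>0) \<le> infdist x (sphere x\<^sub>0 R)"
    using y by (auto simp: infdist_def intro!: cINF_greatest)
  moreover have "infdist x (sphere x\<^sub>0 R) \<le> R - norm (x - x\<^sub>0)"
    using infdist_le[OF y, of x] dxy by simp
  ultimately show ?thesis by (simp add: bdist_def fr)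
qed

text \<open>The filter describing \<open>x \<rightarrow> \<partial>B\<close>, i.e. \<open>d(x) \<rightarrow> 0\<close> with \<open>x\<close> inside the ball.\<close>

definition to_boundary :: "'a::euclidean_space \<Rightarrow> real \<Rightarrow> 'a filter" where
  "to_boundary x\<^sub>0 R = inf (filtercomap (bdist x\<^sub>0 R) (nhds 0)) (principal (ball x\<^sub>0 R))"

definition local_weak_large_solution ::
  "'a::euclidean_space \<Rightarrow> real \<Rightarrow> real \<Rightarrow> real \<Rightarrow> real \<Rightarrow> (real \<Rightarrow> real) \<Rightarrow> ('a \<Rightarrow> real) \<Rightarrow> bool" where
  "local_weak_large_solution x\<^sub>0 R \<alpha> \<gamma> p a u \<longleftrightarrow>
     continuous_on (ball x\<^sub>0 R) u \<and>
     filterlim u at_top (to_boundary x\<^sub>0 R) \<and>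
     (\<forall>\<Omega>. open \<Omega> \<and> compact (closure \<Omega>) \<and> closure \<Omega> \<subseteq> ball x\<^sub>0 R \<longrightarrow>
       (let d = bdist x\<^sub>0 R; w = (\<lambda>x. d x powr \<alpha>) in
        \<exists>Du. (u, Du) \<in> W12 \<Omega> w \<and> (\<lambda>x. u x powr p) \<in> L2w \<Omega> w \<and>
          (\<forall>\<phi> D\<phi>. (\<phi>, D\<phi>) \<in> W12_0 \<Omega> w \<and>
             (\<exists>C. compact C \<and> C \<subseteq> \<Omega> \<and> (AE x in lebesgue_on \<Omega>. x \<notin> C \<longrightarrow> \<phi> x = 0)) \<longrightarrow>
             (LINT x|lebesgue_on \<Omega>. (Du x \<bullet> D\<phi> x) * d x powr \<alpha>)
             + (LINT x|lebesgue_on \<Omega>. a (norm (x - x\<^sub>0)) * d x powr \<gamma> * u x powr p * \<phi> x) = 0)))"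

text \<open>Classical solutions of the radial problem, in $C^2(0,R)\cap C^1[0,R)$; the derivative at 0
  is one-sided.\<close>

definition radial_large_solution ::
  "nat \<Rightarrow> real \<Rightarrow> real \<Rightarrow> real \<Rightarrow> real \<Rightarrow> (real \<Rightarrow> real) \<Rightarrow> (real \<Rightarrow> real) \<Rightarrow> bool" where
  "radial_large_solution N R \<alpha> \<gamma> p a \<psi> \<longleftrightarrow>
     (\<exists>\<psi>' \<psi>''.
        (\<forall>r\<in>{0..<R}. (\<psi> has_real_derivative \<psi>' r) (at r within {0..<R})) \<and>
        continuous_on {0..<R} \<psi>' \<and>
        (\<forall>r\<in>{0<..<R}. (\<psi>' has_real_derivative \<psi>'' r) (at r)) \<and>
        continuous_on {0<..<R} \<psi>'' \<and>
        (\<forall>r\<in>{0<..<R}. \<psi>'' r + ((real N - 1) / r - \<alpha> / (R - r)) * \<psi>' r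
                        = a r * (R - r) powr (\<gamma> - \<alpha>) * \<psi> r powr p) \<and>
        \<psi>' 0 = 0) \<and>
     filterlim \<psi> at_top (at_left R)"

end

theory Submission
  imports Defs
begin

text \<open>
For a radial function the differential operator is a weighted second derivative: with
\<open>q t = t ^ (N - 1) * (R - t) powr \<alpha>\<close> and \<open>h t = a t * (R - t) powr (\<gamma> - \<alpha>)\<close> the radial equation
says \<open>(q \<psi>')' = q * h * \<psi> powr p\<close>. Together with \<open>\<psi>' 0 = 0\<close> it is equivalent to the integral
equation in which \<open>\<psi>'\<close> is \<open>1 / q\<close> times the integral of \<open>q * h * \<psi> powr p\<close> from 0.

Barriers. The functions \<open>A + B * (R\<^sup>2 - r\<^sup>2) powr (- \<beta>)\<close> blow up at the right rate and are smooth
in \<open>r\<^sup>2\<close>, so their derivative vanishes at the origin and \<open>(N - 1) / r\<close> does no harm there. The value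
of \<open>\<beta>\<close> makes both sides of the equation scale like \<open>(R\<^sup>2 - r\<^sup>2) powr (- \<beta> - 2)\<close>, and the value of
\<open>K\<close> makes the leading coefficients at \<open>r = R\<close> agree for \<open>B = K * (2 * R) powr \<beta>\<close>
(\<open>boundary_balance\<close>). Since \<open>p > 1\<close>, a slightly larger \<open>B\<close> gives a supersolution near \<open>R\<close> and a
slightly smaller one a subsolution near \<open>R\<close>. A large constant \<open>A\<close>, positive for the first and
negative for the second, repairs the inequality away from \<open>R\<close> and does not change the asymptotics
(\<open>large_shift_upper\<close>, \<open>large_shift_lower\<close>, \<open>barrier_asymptotics\<close>).

Shooting. Truncating the nonlinearity at the upper barrier makes it Lipschitz in the unknown on
compact subintervals, so for every initial value \<open>m\<close> the Cauchy problem has a unique solution on all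
of \<open>{0..<R}\<close>, depending continuously on \<open>m\<close>. By a maximum principle (\<open>positivity_persists\<close>) a
solution that has once exceeded the upper barrier stays above it, and one that has once fallen below
the lower barrier stays below it. Hence the set of \<open>m\<close> for which the first happens and the set for
which the second happens are disjoint; both are open and both are nonempty. As an interval is
connected, some \<open>m\<close> lies in neither set (\<open>shooting\<close>). Its solution runs between the barriers, where
the truncation is inactive, and the barriers give the blow-up and the two bounds for the ratio.

Weak formulation. Set \<open>u x = \<psi> (norm (x - x\<^sub>0))\<close>. Both \<open>u\<close> and the components of
\<open>d powr \<alpha> * grad u\<close> are continuous in the ball, differentiable off the centre, and have bounded
derivatives on relatively compact sets. For a compactly supported Lipschitz function the integral of
a directional derivative is the limit of integrals of difference quotients, all of which vanish by
translation invariance (\<open>integral_directional_derivative_eq_0\<close>); a single exceptional point does not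
matter. Applied to products with a test function this yields the weak gradient of \<open>u\<close> and the weak
equation for test functions. On relatively compact sets the coefficients are bounded, so the equation
passes to limits in the weighted norm (\<open>L2w_limit_integral\<close>) and holds for all admissible functions.
\<close>

section \<open>Preliminaries on the real line\<close>

lemma primitive_has_real_derivative:
  fixes g :: "real \<Rightarrow> real"
  assumes "continuous_on {0..<R} g" "r \<in> {0..<R}"
  shows "((\<lambda>x. integral {0..x} g) has_real_derivative g r) (at r within {0..<R})"
proof -
  define b where "b = (r + R) / 2"
  have b: "r < b" "b < R" "r \<in> {0..b}" using assms(2) by (auto simp: b_def)
  have "continuous_on {0..b} g" using assms(1) by (rule continuous_on_subset) (use b in auto)
  then have "((\<lambda>x. integral {0..x} g) has_real_derivative g r) (at r within {0..b})"
    using b(3) by (rule integral_has_real_derivative)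
  moreover have "at r within {0..b} = at r within {0..<R}"
    by (rule at_within_nhd[of _ "{..<b}"]) (use b in auto)
  ultimately show ?thesis by simp
qed

lemma integral_nonneg_of_nonneg:
  fixes g :: "real \<Rightarrow> real"
  assumes "\<And>x. x \<in> S \<Longrightarrow> 0 \<le> g x"
  shows "0 \<le> integral S g"
  using assms Henstock_Kurzweil_Integration.integral_nonneg[of g S]
  by (cases "g integrable_on S") (auto simp: not_integrable_integral)

lemma powr_Lipschitz:
  fixes x y M p :: real
  assumes "0 \<le> x" "x \<le> M" "0 \<le> y" "y \<le> M" "p > 1"
  shows "\<bar>x powr p - y powr p\<bar> \<le> p * M powr (p - 1) * \<bar>x - y\<bar>"
proof -
  have main: "y powr p - x powr p \<le> p * M powr (p - 1) * (y - x)"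
    if xy: "0 \<le> x" "x < y" "y \<le> M" for x y
  proof -
    have "continuous_on {x..y} (\<lambda>t. t powr p)"
      by (intro continuous_on_powr') (use xy \<open>p > 1\<close> in \<open>auto intro!: continuous_intros\<close>)
    moreover have D: "((\<lambda>t. t powr p) has_real_derivative p * t powr (p - 1)) (at t)" if "x < t" for t
      using that xy by (auto intro!: derivative_eq_intros)
    ultimately obtain z where z: "x < z" "z < y"
        "y powr p - x powr p = (y - x) * (p * z powr (p - 1))"
      using MVT[of x y "\<lambda>t. t powr p"] xy(2) DERIV_unique[OF D]
      by (metis real_differentiable_def)
    have "z powr (p - 1) \<le> M powr (p - 1)"
      by (rule powr_mono2) (use z xy \<open>p > 1\<close> in auto)
    then have "p * z powr (p - 1) \<le> p * M powr (p - 1)"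
      using \<open>p > 1\<close> by (intro mult_left_mono) auto
    from mult_left_mono[OF this, of "y - x"]
    have "(y - x) * (p * z powr (p - 1)) \<le> (y - x) * (p * M powr (p - 1))" using xy by simp
    then show ?thesis unfolding z(3) by (simp add: mult.commute)
  qed
  have mono: "x powr p \<le> y powr p" if "0 \<le> x" "x \<le> y" for x y
    using that \<open>p > 1\<close> by (intro powr_mono2) auto
  consider "x < y" | "x = y" | "y < x" by linarith
  then show ?thesis
  proof cases
    case 1
    then show ?thesis using main[of x y] mono[of x y] assms by auto
  next
    case 3
    then show ?thesis using main[of y x] mono[of y x] assms by auto
  qed simp
qed

section \<open>The radial operator in divergence form\<close>

text \<open>The features of \<open>q t = t ^ (N - 1) * (R - t) powr \<alpha>\<close> on which the one-dimensional theory rests.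
Being increasing up to a constant factor on \<open>{0..b}\<close> tames the division by \<open>q\<close>, which may vanish
at 0: the integral of \<open>q * f\<close> over \<open>{0..s}\<close>, divided by \<open>q s\<close>, is at most \<open>C\<close> times the integral
of \<open>\<bar>f\<bar>\<close>.\<close>

locale radial_weight =
  fixes R :: real and q :: "real \<Rightarrow> real"
  assumes R_pos: "R > 0"
    and q_cont: "continuous_on {0..<R} q"
    and q_nonneg: "q 0 \<ge> 0"
    and q_pos: "\<And>t. 0 < t \<Longrightarrow> t < R \<Longrightarrow> q t > 0"
    and almost_increasing:
      "\<And>b. b < R \<Longrightarrow> \<exists>C>0. \<forall>s t. 0 \<le> t \<longrightarrow> t \<le> s \<longrightarrow> s \<le> b \<longrightarrow> q t \<le> C * q s"
begin

text \<open>For the equation \<open>(q y')' = q f\<close> with \<open>y' 0 = 0\<close>, these are the flux \<open>q y'\<close>, the derivative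
\<open>y'\<close> and the increment \<open>y r - y 0\<close>. At 0 the quotient in \<open>slope\<close> is \<open>0 / q 0 = 0\<close>, also
when \<open>q 0 = 0\<close>, which is the correct value.\<close>

definition flux :: "(real \<Rightarrow> real) \<Rightarrow> real \<Rightarrow> real" where
  "flux f s = integral {0..s} (\<lambda>t. q t * f t)"

definition slope :: "(real \<Rightarrow> real) \<Rightarrow> real \<Rightarrow> real" where
  "slope f s = flux f s / q s"

definition potential :: "(real \<Rightarrow> real) \<Rightarrow> real \<Rightarrow> real" where
  "potential f r = integral {0..r} (slope f)"

lemma q_ge0: "0 \<le> t \<Longrightarrow> t < R \<Longrightarrow> 0 \<le> q t"
  using q_nonneg q_pos[of t] by (cases "t = 0") auto

lemma flux_0 [simp]: "flux f 0 = 0" by (simp add: flux_def)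
lemma slope_0 [simp]: "slope f 0 = 0" by (simp add: slope_def)
lemma potential_0 [simp]: "potential f 0 = 0" by (simp add: potential_def)

lemma slope_nonneg:
  assumes "0 \<le> s" "s < R" "\<And>t. 0 \<le> t \<Longrightarrow> t < R \<Longrightarrow> 0 \<le> f t"
  shows "0 \<le> slope f s"
  unfolding slope_def flux_def
  using assms by (intro divide_nonneg_nonneg integral_nonneg_of_nonneg q_ge0 mult_nonneg_nonneg | auto)+

lemma flux_has_derivative:
  assumes "continuous_on {0..<R} f" "s \<in> {0..<R}"
  shows "(flux f has_real_derivative q s * f s) (at s within {0..<R})"
  unfolding flux_def
  using primitive_has_real_derivative[OF _ assms(2), of "\<lambda>t. q t * f t"]
  by (simp add: continuous_on_mult q_cont assms(1))

lemma flux_cont: "continuous_on {0..<R} f \<Longrightarrow> continuous_on {0..<R} (flux f)"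
  by (rule DERIV_continuous_on) (rule flux_has_derivative)

text \<open>On \<open>{0..s}\<close> the weight is at most \<open>C * q s\<close>, so the factor \<open>q s\<close> cancels in the quotient. The
majorant \<open>e\<close> is left general: a constant gives linear growth of \<open>y'\<close> at the origin, an exponential
gives the contraction estimate for the Picard iteration.\<close>

lemma slope_bound:
  assumes f: "continuous_on {0..<R} f"
    and C: "\<forall>s t. 0 \<le> t \<longrightarrow> t \<le> s \<longrightarrow> s \<le> b \<longrightarrow> q t \<le> C * q s" "C > 0"
    and s: "0 \<le> s" "s \<le> b" "b < R"
    and e: "(e has_integral I) {0..s}" "\<And>t. t \<in> {0..s} \<Longrightarrow> \<bar>f t\<bar> \<le> e t"
  shows "\<bar>slope f s\<bar> \<le> C * I"
proof (cases "s = 0")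
  case True
  then have "I = 0" using e(1) by (metis atLeastAtMost_singleton has_integral_refl(2) has_integral_unique)
  then show ?thesis using True by simp
next
  case False
  then have qs: "q s > 0" using q_pos s by auto
  have sub: "{0..s} \<subseteq> {0..<R}" using s by auto
  have "continuous_on {0..s} (\<lambda>t. q t * f t)"
    using continuous_on_mult[OF q_cont f] sub continuous_on_subset by blast
  then have 1: "(\<lambda>t. q t * f t) integrable_on {0..s}" by (rule integrable_continuous_real)
  have 2: "((\<lambda>t. C * q s * e t) has_integral C * q s * I) {0..s}"
    using e(1) by (rule has_integral_mult_right)
  have "norm (integral {0..s} (\<lambda>t. q t * f t)) \<le> integral {0..s} (\<lambda>t. C * q s * e t)"
  proof (rule integral_norm_bound_integral[OF 1])
    show "(\<lambda>t. C * q s * e t) integrable_on {0..s}" using 2 by blast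
    fix t assume t: "t \<in> {0..s}"
    have "q t \<le> C * q s" using C t s by auto
    moreover have "0 \<le> q t" using q_ge0 t s by auto
    ultimately show "norm (q t * f t) \<le> C * q s * e t"
      using e(2)[OF t] by (auto simp: abs_mult intro!: mult_mono)
  qed
  also have "\<dots> = C * q s * I" using 2 by (rule integral_unique)
  finally show ?thesis using qs by (simp add: slope_def flux_def abs_mult divide_le_eq mult_ac)
qed

lemma slope_linear_bound:
  assumes "continuous_on {0..<R} f" "b < R"
  shows "\<exists>C. \<forall>s\<in>{0..b}. \<bar>slope f s\<bar> \<le> C * s"
proof -
  have "compact (f ` {0..b})"
    by (intro compact_continuous_image continuous_on_subset[OF assms(1)]) (use assms in auto)
  then obtain M where M: "\<And>t. t \<in> {0..b} \<Longrightarrow> \<bar>f t\<bar> \<le> M"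
    by (meson bounded_real compact_imp_bounded imageI)
  obtain C where C: "C > 0" "\<forall>s t. 0 \<le> t \<longrightarrow> t \<le> s \<longrightarrow> s \<le> b \<longrightarrow> q t \<le> C * q s"
    using almost_increasing[OF assms(2)] by blast
  have "\<bar>slope f s\<bar> \<le> (C * M) * s" if "s \<in> {0..b}" for s
    using slope_bound[OF assms(1) C(2,1) _ _ assms(2), of s "\<lambda>_. M" "M * s"] that M
      has_integral_const_real[of M 0 s] by (auto simp: mult_ac)
  then show ?thesis by blast
qed

text \<open>Away from 0 the slope is a quotient of continuous functions; at 0 it is continuous because of the
linear bound.\<close>

lemma slope_cont:
  assumes f: "continuous_on {0..<R} f"
  shows "continuous_on {0..<R} (slope f)"
proof -
  have "continuous (at s within {0..<R}) (slope f)" if s: "s \<in> {0..<R}" for s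
  proof (cases "s = 0")
    case False
    then have "q s \<noteq> 0" using q_pos[of s] s by auto
    then show ?thesis unfolding slope_def
      using flux_cont[OF f] q_cont s
      by (auto simp: continuous_on_eq_continuous_within continuous_within intro!: tendsto_divide)
  next
    case True
    obtain C where C: "\<And>s. s \<in> {0..R/2} \<Longrightarrow> \<bar>slope f s\<bar> \<le> C * s"
      using slope_linear_bound[OF f, of "R/2"] R_pos by (metis field_sum_of_halves less_add_same_cancel1 half_gt_zero)
    have "(slope f \<longlongrightarrow> 0) (at 0 within {0..<R})"
    proof (rule Lim_null_comparison)
      have "\<forall>\<^sub>F x in at 0 within {0..<R}. x < R/2"
        by (rule order_tendstoD(2)[OF tendsto_ident_at]) (use R_pos in auto)
      moreover have "\<forall>\<^sub>F x in at 0 within {0..<R}. x \<in> {0..<R}"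
        by (auto simp: eventually_at_filter)
      ultimately show "\<forall>\<^sub>F x in at 0 within {0..<R}. norm (slope f x) \<le> C * x"
        by eventually_elim (use C in auto)
      show "((\<lambda>x. C * x) \<longlongrightarrow> 0) (at 0 within {0..<R})"
        by (rule tendsto_eq_intros refl)+ simp
    qed
    then show ?thesis using True by (simp add: continuous_within)
  qed
  then show ?thesis by (simp add: continuous_on_eq_continuous_within)
qed

lemma potential_has_derivative:
  assumes "continuous_on {0..<R} f" "s \<in> {0..<R}"
  shows "(potential f has_real_derivative slope f s) (at s within {0..<R})"
  unfolding potential_def
  using primitive_has_real_derivative[OF slope_cont[OF assms(1)] assms(2)] .

lemma potential_cont: "continuous_on {0..<R} f \<Longrightarrow> continuous_on {0..<R} (potential f)"
  by (rule DERIV_continuous_on) (rule potential_has_derivative)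

lemma potential_nonneg:
  assumes "0 \<le> r" "r < R" "\<And>t. 0 \<le> t \<Longrightarrow> t < R \<Longrightarrow> 0 \<le> f t"
  shows "0 \<le> potential f r"
  unfolding potential_def
  by (intro integral_nonneg_of_nonneg slope_nonneg | use assms in auto)+

lemma slope_diff:
  assumes "continuous_on {0..<R} f" "continuous_on {0..<R} g" "s \<in> {0..<R}"
  shows "slope f s - slope g s = slope (\<lambda>t. f t - g t) s"
proof -
  have "(\<lambda>t. q t * h t) integrable_on {0..s}" if "continuous_on {0..<R} h" for h
    using continuous_on_mult[OF q_cont that] assms(3)
    by (intro integrable_continuous_real) (auto elim: continuous_on_subset)
  then show ?thesis using assms
    by (simp add: slope_def flux_def right_diff_distrib Henstock_Kurzweil_Integration.integral_diff
        diff_divide_distrib)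
qed

lemma potential_diff:
  assumes "continuous_on {0..<R} f" "continuous_on {0..<R} g" "r \<in> {0..<R}"
  shows "potential f r - potential g r = potential (\<lambda>t. f t - g t) r"
proof -
  have "slope h integrable_on {0..r}" if "continuous_on {0..<R} h" for h
    using slope_cont[OF that] assms(3)
    by (intro integrable_continuous_real) (auto elim: continuous_on_subset)
  then have "potential f r - potential g r = integral {0..r} (\<lambda>s. slope f s - slope g s)"
    using assms by (simp add: potential_def Henstock_Kurzweil_Integration.integral_diff)
  also have "\<dots> = potential (\<lambda>t. f t - g t) r"
    unfolding potential_def
    by (rule Henstock_Kurzweil_Integration.integral_cong) (use slope_diff assms in auto)
  finally show ?thesis .
qed

lemma exp_has_integral:
  assumes "L > 0" "0 \<le> s"
  shows "((\<lambda>t::real. exp (L * t)) has_integral (exp (L * s) - 1) / L) {0..s}"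
proof -
  have "((\<lambda>t. exp (L * t)) has_integral exp (L * s) / L - exp (L * 0) / L) {0..s}"
    using assms
    by (intro fundamental_theorem_of_calculus)
      (auto intro!: derivative_eq_intros simp flip: has_real_derivative_iff_has_vector_derivative)
  then show ?thesis by (simp add: diff_divide_distrib)
qed

text \<open>Each of the two integrations of \<open>exp (L * t)\<close> gains a factor \<open>1 / L\<close>. Measured against
\<open>exp (L * r)\<close>, the solution operator therefore has norm at most \<open>C / L\<^sup>2\<close>, which is small for
large \<open>L\<close>.\<close>

lemma potential_exp_bound:
  assumes f: "continuous_on {0..<R} f"
    and C: "\<forall>s t. 0 \<le> t \<longrightarrow> t \<le> s \<longrightarrow> s \<le> b \<longrightarrow> q t \<le> C * q s" "C > 0"
    and b: "b < R" and L: "L > 0"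
    and E: "\<And>t. t \<in> {0..b} \<Longrightarrow> \<bar>f t\<bar> \<le> E * exp (L * t)" 
    and r: "r \<in> {0..b}"
  shows "\<bar>potential f r\<bar> \<le> C * E / L\<^sup>2 * exp (L * r)"
proof -
  have "0 \<le> \<bar>f 0\<bar>" by simp
  also have "\<dots> \<le> E" using E[of 0] r by auto
  finally have E0: "E \<ge> 0" .
  have 1: "\<bar>slope f s\<bar> \<le> C * E / L * exp (L * s)" if s: "s \<in> {0..b}" for s
  proof -
    have "\<bar>slope f s\<bar> \<le> C * (E * ((exp (L * s) - 1) / L))"
      using s b E L by (intro slope_bound[OF f C, where e = "\<lambda>t. E * exp (L * t)"]
        has_integral_mult_right exp_has_integral) auto
    also have "\<dots> = C * E / L * (exp (L * s) - 1)" by simp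
    also have "\<dots> \<le> C * E / L * exp (L * s)"
      using C E0 L by (intro mult_left_mono) auto
    finally show ?thesis .
  qed
  have 2: "((\<lambda>s. C * E / L * exp (L * s)) has_integral C * E / L * ((exp (L * r) - 1) / L)) {0..r}"
    using L r by (intro has_integral_mult_right exp_has_integral) auto
  have "norm (integral {0..r} (slope f)) \<le> integral {0..r} (\<lambda>s. C * E / L * exp (L * s))"
  proof (rule integral_norm_bound_integral)
    show "slope f integrable_on {0..r}"
      using slope_cont[OF f] r b
      by (intro integrable_continuous_real) (auto elim: continuous_on_subset)
  qed (use 1 2 r in auto)
  also have "\<dots> = C * E / L * ((exp (L * r) - 1) / L)" using 2 by (rule integral_unique)
  also have "\<dots> = C * E / L\<^sup>2 * (exp (L * r) - 1)" by (simp add: power2_eq_square)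
  also have "\<dots> \<le> C * E / L\<^sup>2 * exp (L * r)"
    using C E0 L by (intro mult_left_mono) auto
  finally show ?thesis by (simp add: potential_def)
qed

text \<open>The equation \<open>(q w')' = g\<close> on \<open>{0<..<R}\<close> with vanishing flux at 0. The flux \<open>z = q w'\<close> is
quantified away because comparison arguments only use \<open>w\<close> and \<open>g\<close>.\<close>

definition has_flux_derivative :: "(real \<Rightarrow> real) \<Rightarrow> (real \<Rightarrow> real) \<Rightarrow> bool" where
  "has_flux_derivative w g \<longleftrightarrow> continuous_on {0..<R} w \<and>
     (\<exists>z. continuous_on {0..<R} z \<and> z 0 = 0 \<and>
        (\<forall>s\<in>{0<..<R}. (w has_real_derivative z s / q s) (at s) \<and> (z has_real_derivative g s) (at s)))"

lemma has_flux_derivative_diff: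
  assumes "has_flux_derivative v f" "has_flux_derivative w g"
  shows "has_flux_derivative (\<lambda>s. v s - w s) (\<lambda>s. f s - g s)"
proof -
  obtain y where y: "continuous_on {0..<R} y" "y 0 = 0"
    "\<And>s. s \<in> {0<..<R} \<Longrightarrow> (v has_real_derivative y s / q s) (at s)"
    "\<And>s. s \<in> {0<..<R} \<Longrightarrow> (y has_real_derivative f s) (at s)"
    using assms(1) by (auto simp: has_flux_derivative_def)
  obtain z where z: "continuous_on {0..<R} z" "z 0 = 0"
    "\<And>s. s \<in> {0<..<R} \<Longrightarrow> (w has_real_derivative z s / q s) (at s)"
    "\<And>s. s \<in> {0<..<R} \<Longrightarrow> (z has_real_derivative g s) (at s)"
    using assms(2) by (auto simp: has_flux_derivative_def)
  show ?thesis unfolding has_flux_derivative_def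
  proof (intro conjI exI[of _ "\<lambda>s. y s - z s"] ballI)
    show "((\<lambda>s. v s - w s) has_real_derivative (y s - z s) / q s) (at s)" if "s \<in> {0<..<R}" for s
      using DERIV_diff[OF y(3) z(3), OF that that] by (simp add: diff_divide_distrib)
  qed (use y z assms in \<open>auto simp: has_flux_derivative_def intro!: continuous_intros DERIV_diff\<close>)
qed

text \<open>The maximum principle behind the shooting argument. If \<open>w r1 > 0\<close>, then there is a point
\<open>s \<le> r1\<close> at which the flux is nonnegative and from which \<open>w > 0\<close> up to \<open>r1\<close>: the origin, where
the flux vanishes, if \<open>w > 0\<close> on \<open>{0..r1}\<close>, and otherwise a mean value point after the last point
with \<open>w \<le> 0\<close>. From \<open>s\<close> on the flux cannot decrease while \<open>w > 0\<close>, so \<open>w\<close> cannot come down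
again.\<close>

lemma positivity_persists:
  assumes w: "has_flux_derivative w g"
    and g: "\<And>s. 0 < s \<Longrightarrow> s < R \<Longrightarrow> 0 < w s \<Longrightarrow> 0 \<le> g s"
    and r: "0 \<le> r1" "r1 \<le> r2" "r2 < R" "w r1 > 0"
  shows "w r1 \<le> w r2"
proof -
  obtain z where z: "continuous_on {0..<R} z" "z 0 = 0"
    "\<And>s. s \<in> {0<..<R} \<Longrightarrow> (w has_real_derivative z s / q s) (at s)"
    "\<And>s. s \<in> {0<..<R} \<Longrightarrow> (z has_real_derivative g s) (at s)"
    using w by (auto simp: has_flux_derivative_def)
  have wc: "continuous_on {0..<R} w" using w by (simp add: has_flux_derivative_def)
  have "\<exists>s\<in>{0..r1}. 0 \<le> z s \<and> (\<forall>t\<in>{s..r1}. 0 < w t)"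
  proof (cases "\<forall>t\<in>{0..r1}. 0 < w t")
    case True
    then show ?thesis using z(2) r(1) by (intro bexI[of _ 0]) auto
  next
    case False
    define S where "S = {0..r1} \<inter> w -` {..0}"
    have "S \<noteq> {}" using False by (auto simp: S_def not_less)
    have "closed S"
    proof -
      have "continuous_on {0..r1} w" by (rule continuous_on_subset[OF wc]) (use r in auto)
      then show ?thesis unfolding S_def by (intro continuous_closed_preimage) auto
    qed
    moreover have bdd: "bdd_above S" unfolding S_def by auto
    ultimately have s0: "Sup S \<in> S" using \<open>S \<noteq> {}\<close> by (intro closed_contains_Sup)
    define s0 where "s0 = Sup S"
    have "s0 \<in> S" using s0 by (simp add: s0_def)
    then have s0': "0 \<le> s0" "s0 < r1" "w s0 \<le> 0"
      using r(4) by (auto simp: S_def less_le)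
    have pos: "0 < w t" if "s0 < t" "t \<le> r1" for t
    proof (rule ccontr)
      assume "\<not> 0 < w t"
      then have "t \<in> S" using that s0' by (auto simp: S_def)
      then have "t \<le> s0" unfolding s0_def by (rule cSup_upper[OF _ bdd])
      then show False using that by simp
    qed
    have "\<exists>s>s0. s < r1 \<and> w r1 - w s0 = (r1 - s0) * (z s / q s)"
    proof -
      have "continuous_on {s0..r1} w" by (rule continuous_on_subset[OF wc]) (use r s0' in auto)
      moreover have D: "(w has_real_derivative z s / q s) (at s)" if "s0 < s" "s < r1" for s
        using z(3)[of s] that s0' r by auto
      ultimately obtain l s where "s0 < s" "s < r1" "(w has_real_derivative l) (at s)"
          "w r1 - w s0 = (r1 - s0) * l"
        using MVT[of s0 r1 w] s0' by (auto simp: real_differentiable_def)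
      then show ?thesis using DERIV_unique[OF D] by metis
    qed
    then obtain s where s: "s0 < s" "s < r1" "w r1 - w s0 = (r1 - s0) * (z s / q s)" by auto
    have "0 < (r1 - s0) * (z s / q s)" using s(3) s0' r by auto
    then have "0 < z s / q s" using s0' by (meson diff_gt_0_iff_gt zero_less_mult_pos)
    moreover have "0 < q s" using q_pos[of s] s s0' r by auto
    ultimately have "0 < z s" by (simp add: zero_less_divide_iff)
    then show ?thesis using s pos s0' by (intro bexI[of _ s]) auto
  qed
  then obtain s where s: "0 \<le> s" "s \<le> r1" "0 \<le> z s" "\<And>t. s \<le> t \<Longrightarrow> t \<le> r1 \<Longrightarrow> 0 < w t" by auto
  have grow: "w r1 \<le> w e" if e: "r1 \<le> e" "e < R" "\<And>t. s \<le> t \<Longrightarrow> t < e \<Longrightarrow> 0 < w t" for e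
  proof (rule DERIV_nonneg_imp_increasing_open[where f = w, OF e(1)])
    show "continuous_on {r1..e} w" by (rule continuous_on_subset[OF wc]) (use r e in auto)
    fix x assume x: "r1 < x" "x < e"
    have "z s \<le> z x"
    proof (rule DERIV_nonneg_imp_increasing_open[where f = z])
      show "continuous_on {s..x} z" by (rule continuous_on_subset[OF z(1)]) (use x r s e in auto)
      show "\<exists>y. (z has_real_derivative y) (at t) \<and> 0 \<le> y" if "s < t" "t < x" for t
        using z(4)[of t] g[of t] e(3)[of t] that s x e by auto
    qed (use x s in auto)
    then have "0 \<le> z x / q x" using s q_pos[of x] x e r by (intro divide_nonneg_pos) auto
    then show "\<exists>y. (w has_real_derivative y) (at x) \<and> 0 \<le> y"
      using z(3)[of x] x e r by auto
  qed
  show ?thesis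
  proof (cases "\<forall>t\<in>{r1..r2}. 0 < w t")
    case True
    show ?thesis
    proof (rule grow[OF r(2,3)])
      show "0 < w t" if "s \<le> t" "t < r2" for t
        using True s(4)[of t] that by (cases "t \<le> r1") auto
    qed
  next
    case False
    define S where "S = {r1..r2} \<inter> w -` {..0}"
    have "S \<noteq> {}" using False by (auto simp: S_def not_less)
    have "closed S"
    proof -
      have "continuous_on {r1..r2} w" by (rule continuous_on_subset[OF wc]) (use r in auto)
      then show ?thesis unfolding S_def by (intro continuous_closed_preimage) auto
    qed
    moreover have bdd: "bdd_below S" unfolding S_def by auto
    ultimately have e: "Inf S \<in> S" using \<open>S \<noteq> {}\<close> by (intro closed_contains_Inf)
    have "w r1 \<le> w (Inf S)"
    proof (rule grow)
      show "0 < w t" if "s \<le> t" "t < Inf S" for t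
      proof (cases "t \<le> r1")
        case False
        then have "t \<notin> S" using cInf_lower[OF _ bdd, of t] that by auto
        then show ?thesis using False that e by (auto simp: S_def)
      qed (use s that in auto)
    qed (use e r in \<open>auto simp: S_def\<close>)
    then show ?thesis using e r(4) by (auto simp: S_def)
  qed
qed

end

section \<open>The Cauchy problem at the origin\<close>

locale radial_cauchy = radial_weight +
  fixes H :: "real \<Rightarrow> real \<Rightarrow> real"
  assumes H_cont: "\<And>y. continuous_on {0..<R} y \<Longrightarrow> continuous_on {0..<R} (\<lambda>t. H t (y t))"
    and H_Lip: "\<And>b. b < R \<Longrightarrow> \<exists>\<Lambda>>0. \<forall>t\<in>{0..b}. \<forall>y z. \<bar>H t y - H t z\<bar> \<le> \<Lambda> * \<bar>y - z\<bar>"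
begin

definition picard :: "real \<Rightarrow> (real \<Rightarrow> real) \<Rightarrow> real \<Rightarrow> real" where
  "picard m y r = m + potential (\<lambda>t. H t (y t)) r"

definition solves :: "real \<Rightarrow> (real \<Rightarrow> real) \<Rightarrow> bool" where
  "solves m y \<longleftrightarrow> continuous_on {0..<R} y \<and> (\<forall>r\<in>{0..<R}. y r = picard m y r)"

lemma picard_cont: "continuous_on {0..<R} y \<Longrightarrow> continuous_on {0..<R} (picard m y)"
  unfolding picard_def by (intro continuous_intros potential_cont H_cont)

text \<open>With \<open>L\<^sup>2 = 2 * C * \<Lambda>\<close>, where \<open>\<Lambda>\<close> is a Lipschitz constant on \<open>{0..b}\<close>, the Picard map halves
distances in the norm weighted by \<open>exp (- L * t)\<close>. The initial values \<open>m\<close> and \<open>m'\<close> may differ, so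
that the same estimate gives uniqueness and continuous dependence.\<close>

lemma picard_contraction:
  assumes "b < R"
  obtains L where "L > 0"
    "\<And>y z D m m' r. \<lbrakk>continuous_on {0..<R} y; continuous_on {0..<R} z;
       \<And>t. t \<in> {0..b} \<Longrightarrow> \<bar>y t - z t\<bar> \<le> D * exp (L * t); r \<in> {0..b}\<rbrakk>
      \<Longrightarrow> \<bar>picard m y r - picard m' z r\<bar> \<le> \<bar>m - m'\<bar> + D / 2 * exp (L * r)"
proof -
  obtain C where C: "C > 0" "\<forall>s t. 0 \<le> t \<longrightarrow> t \<le> s \<longrightarrow> s \<le> b \<longrightarrow> q t \<le> C * q s"
    using almost_increasing[OF assms] by blast
  obtain \<Lambda> where \<Lambda>: "\<Lambda> > 0" "\<And>t y z. t \<in> {0..b} \<Longrightarrow> \<bar>H t y - H t z\<bar> \<le> \<Lambda> * \<bar>y - z\<bar>"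
    using H_Lip[OF assms] by blast
  define L where "L = sqrt (2 * C * \<Lambda>)"
  have L: "L > 0" "L\<^sup>2 = 2 * C * \<Lambda>" using C \<Lambda> by (auto simp: L_def)
  show thesis
  proof (rule that[OF L(1)])
    fix y z D m m' r
    assume y: "continuous_on {0..<R} y" and z: "continuous_on {0..<R} z"
      and D: "\<And>t. t \<in> {0..b} \<Longrightarrow> \<bar>y t - z t\<bar> \<le> D * exp (L * t)" and r: "r \<in> {0..b}"
    have "\<bar>potential (\<lambda>t. H t (y t) - H t (z t)) r\<bar> \<le> C * (\<Lambda> * D) / L\<^sup>2 * exp (L * r)"
    proof (rule potential_exp_bound[OF _ C(2,1) assms L(1) _ r])
      show "continuous_on {0..<R} (\<lambda>t. H t (y t) - H t (z t))"
        by (intro continuous_intros H_cont y z)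
      show "\<bar>H t (y t) - H t (z t)\<bar> \<le> \<Lambda> * D * exp (L * t)" if "t \<in> {0..b}" for t
      proof -
        have "\<Lambda> * \<bar>y t - z t\<bar> \<le> \<Lambda> * (D * exp (L * t))"
          using \<Lambda>(1) D[OF that] by simp
        then show ?thesis using \<Lambda>(2)[OF that, of "y t" "z t"] by simp
      qed
    qed
    also have "C * (\<Lambda> * D) / L\<^sup>2 = D / 2" unfolding L(2) using C \<Lambda> by simp
    finally show "\<bar>picard m y r - picard m' z r\<bar> \<le> \<bar>m - m'\<bar> + D / 2 * exp (L * r)"
      using potential_diff[OF H_cont[OF y] H_cont[OF z], of r] r assms
      by (auto simp: picard_def)
  qed
qed

text \<open>The weighted distance \<open>g t0\<close> of two solutions satisfies \<open>g t0 \<le> \<bar>m - m'\<bar> + g t0 / 2\<close>. The case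
\<open>m = m'\<close> is uniqueness.\<close>

lemma stability:
  assumes "b < R"
  shows "\<exists>M. \<forall>y z m m'. solves m y \<longrightarrow> solves m' z \<longrightarrow>
    (\<forall>r\<in>{0..b}. \<bar>y r - z r\<bar> \<le> M * \<bar>m - m'\<bar>)"
proof -
  obtain L where L: "L > 0"
    "\<And>y z D m m' r. \<lbrakk>continuous_on {0..<R} y; continuous_on {0..<R} z;
       \<And>t. t \<in> {0..b} \<Longrightarrow> \<bar>y t - z t\<bar> \<le> D * exp (L * t); r \<in> {0..b}\<rbrakk>
      \<Longrightarrow> \<bar>picard m y r - picard m' z r\<bar> \<le> \<bar>m - m'\<bar> + D / 2 * exp (L * r)"
    using picard_contraction[OF assms] by metis
  show ?thesis
  proof (intro exI allI impI ballI)
    fix y z m m' r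
    assume y: "solves m y" and z: "solves m' z" and r: "r \<in> {0..b}"
    define g where "g t = \<bar>y t - z t\<bar> / exp (L * t)" for t
    have yz: "continuous_on {0..<R} y" "continuous_on {0..<R} z" using y z by (auto simp: solves_def)
    have "continuous_on {0..<R} g" unfolding g_def by (intro continuous_intros yz) auto
    then have "continuous_on {0..b} g" by (rule continuous_on_subset) (use assms in auto)
    then obtain t0 where t0: "t0 \<in> {0..b}" "\<And>t. t \<in> {0..b} \<Longrightarrow> g t \<le> g t0"
      using continuous_attains_sup[of "{0..b}" g] r by auto
    have bnd: "\<bar>y t - z t\<bar> \<le> g t0 * exp (L * t)" if "t \<in> {0..b}" for t
      using t0(2)[OF that] by (simp add: g_def[of t] divide_le_eq)
    have "\<bar>y t0 - z t0\<bar> = \<bar>picard m y t0 - picard m' z t0\<bar>"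
      using y z t0 assms by (auto simp: solves_def)
    also have "\<dots> \<le> \<bar>m - m'\<bar> + g t0 / 2 * exp (L * t0)"
      by (rule L(2)[OF yz bnd t0(1)])
    also have "\<dots> \<le> \<bar>m - m'\<bar> * exp (L * t0) + g t0 / 2 * exp (L * t0)"
      using L(1) t0(1) by (simp add: mult_le_cancel_left1)
    finally have "g t0 * exp (L * t0) \<le> (\<bar>m - m'\<bar> + g t0 / 2) * exp (L * t0)"
      by (simp add: g_def[of t0] distrib_right)
    then have "g t0 \<le> \<bar>m - m'\<bar> + g t0 / 2" by simp
    then have g: "g t0 \<le> 2 * \<bar>m - m'\<bar>" by simp
    have "\<bar>y r - z r\<bar> \<le> g t0 * exp (L * r)" by (rule bnd[OF r])
    also have "\<dots> \<le> (2 * \<bar>m - m'\<bar>) * exp (L * b)"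
      using g r L(1) by (intro mult_mono) auto
    finally show "\<bar>y r - z r\<bar> \<le> (2 * exp (L * b)) * \<bar>m - m'\<bar>" by (simp add: mult_ac)
  qed
qed

text \<open>The Picard iterates converge geometrically, hence uniformly, on every \<open>{0..b}\<close> with \<open>b < R\<close>. The
rate depends on \<open>b\<close> but the iterates do not, so the pointwise limit solves the equation on all of
\<open>{0..<R}\<close>.\<close>

lemma solution_exists: "\<exists>y. solves m y"
proof -
  define it where "it n = (picard m ^^ n) (\<lambda>_. m)" for n
  have it_0: "it 0 t = m" for t by (simp add: it_def)
  have it_Suc: "it (Suc n) = picard m (it n)" for n by (simp add: it_def)
  have it_cont: "continuous_on {0..<R} (it n)" for n
    by (induction n) (auto simp: it_Suc picard_cont, simp add: it_def)
  define y where "y r = lim (\<lambda>n. it n r)" for r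
  have unif: "uniform_limit {0..b} it y sequentially" if b: "b < R" "0 \<le> b" for b
  proof -
    obtain L where L: "L > 0"
      "\<And>y z D m m' r. \<lbrakk>continuous_on {0..<R} y; continuous_on {0..<R} z;
         \<And>t. t \<in> {0..b} \<Longrightarrow> \<bar>y t - z t\<bar> \<le> D * exp (L * t); r \<in> {0..b}\<rbrakk>
        \<Longrightarrow> \<bar>picard m y r - picard m' z r\<bar> \<le> \<bar>m - m'\<bar> + D / 2 * exp (L * r)"
      using picard_contraction[OF b(1)] by metis
    have "continuous_on {0..<R} (\<lambda>t. it 1 t - it 0 t)" by (intro continuous_intros it_cont)
    then have "compact ((\<lambda>t. it 1 t - it 0 t) ` {0..b})"
      by (intro compact_continuous_image) (use b in \<open>auto elim: continuous_on_subset\<close>)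
    then obtain D where D: "\<And>t. t \<in> {0..b} \<Longrightarrow> \<bar>it 1 t - it 0 t\<bar> \<le> D"
      by (meson bounded_real compact_imp_bounded imageI)
    then have D0: "D \<ge> 0" using b(2) by (meson abs_ge_zero atLeastAtMost_iff order_refl order_trans)
    have step: "\<bar>it (Suc n) t - it n t\<bar> \<le> D * (1/2)^n * exp (L * t)" if "t \<in> {0..b}" for n t
      using that
    proof (induction n arbitrary: t)
      case 0
      have "D * 1 \<le> D * exp (L * t)" using D0 L(1) 0 by (intro mult_left_mono) auto
      then show ?case using D[OF 0] by simp
    next
      case (Suc n)
      have "\<bar>picard m (it (Suc n)) t - picard m (it n) t\<bar> \<le> \<bar>m - m\<bar> + D * (1/2)^n / 2 * exp (L * t)"
        by (rule L(2)[OF it_cont it_cont Suc.IH Suc.prems])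
      then show ?case by (simp add: it_Suc)
    qed
    have "uniform_limit {0..b} (\<lambda>n t. \<Sum>i<n. it (Suc i) t - it i t)
        (\<lambda>t. \<Sum>i. it (Suc i) t - it i t) sequentially"
    proof (rule Weierstrass_m_test)
      show "norm (it (Suc n) t - it n t) \<le> D * exp (L * b) * (1/2)^n" if "t \<in> {0..b}" for n t
      proof -
        have "D * (1/2)^n * exp (L * t) \<le> D * (1/2)^n * exp (L * b)"
          using D0 L(1) that by (intro mult_left_mono) auto
        then show ?thesis using step[OF that, of n] by (simp add: mult_ac)
      qed
      show "summable (\<lambda>n. D * exp (L * b) * (1/2)^n)"
        by (intro summable_mult summable_geometric) auto
    qed
    then have "uniform_limit {0..b} (\<lambda>n t. it n t - m) (\<lambda>t. \<Sum>i. it (Suc i) t - it i t) sequentially"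
      using sum_lessThan_telescope[of "\<lambda>i. it i t" for t] by (simp add: it_0)
    then have "uniform_limit {0..b} (\<lambda>n t. m + (it n t - m)) 
        (\<lambda>t. m + (\<Sum>i. it (Suc i) t - it i t)) sequentially"
      by (intro uniform_limit_add uniform_limit_const)
    then have ul: "uniform_limit {0..b} it (\<lambda>t. m + (\<Sum>i. it (Suc i) t - it i t)) sequentially"
      by simp
    have "y t = m + (\<Sum>i. it (Suc i) t - it i t)" if "t \<in> {0..b}" for t
      unfolding y_def using tendsto_uniform_limitI[OF ul that] by (rule limI)
    then show ?thesis using ul by (metis (no_types, lifting) uniform_limit_cong')
  qed
  have ycont: "continuous_on {0..<R} y"
  proof -
    have "continuous (at r within {0..<R}) y" if r: "r \<in> {0..<R}" for r
    proof -
      define b where "b = (r + R) / 2"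
      have b: "r < b" "b < R" "0 \<le> b" "r \<in> {0..b}" using r by (auto simp: b_def)
      have "continuous_on {0..b} y"
        by (rule uniform_limit_theorem[OF _ unif[OF b(2,3)]])
          (auto intro!: always_eventually continuous_on_subset[OF it_cont] simp: b less_le_trans
            dest: le_less_trans[OF _ b(2)])
      then have "continuous (at r within {0..b}) y" using b(4)
        by (simp add: continuous_on_eq_continuous_within)
      moreover have "at r within {0..b} = at r within {0..<R}"
        by (rule at_within_nhd[of _ "{..<b}"]) (use b in auto)
      ultimately show ?thesis by simp
    qed
    then show ?thesis by (simp add: continuous_on_eq_continuous_within)
  qed
  have "y r = picard m y r" if r: "r \<in> {0..<R}" for r
  proof -
    have r': "r < R" "0 \<le> r" "r \<in> {0..r}" using r by auto
    obtain L where L: "L > 0"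
      "\<And>y z D m m' s. \<lbrakk>continuous_on {0..<R} y; continuous_on {0..<R} z;
         \<And>t. t \<in> {0..r} \<Longrightarrow> \<bar>y t - z t\<bar> \<le> D * exp (L * t); s \<in> {0..r}\<rbrakk>
        \<Longrightarrow> \<bar>picard m y s - picard m' z s\<bar> \<le> \<bar>m - m'\<bar> + D / 2 * exp (L * s)"
      using picard_contraction[OF r'(1)] by metis
    have "(\<lambda>n. picard m (it n) r) \<longlonglongrightarrow> picard m y r"
    proof (rule tendstoI)
      fix e :: real assume e: "e > 0"
      define D where "D = e / exp (L * r)"
      have "D > 0" using e by (simp add: D_def)
      have "\<forall>\<^sub>F n in sequentially. \<forall>t\<in>{0..r}. dist (it n t) (y t) < D"
        using unif[OF r'(1,2)] \<open>D > 0\<close> by (rule uniform_limitD)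
      then show "\<forall>\<^sub>F n in sequentially. dist (picard m (it n) r) (picard m y r) < e"
      proof eventually_elim
        case (elim n)
        have "\<bar>it n t - y t\<bar> \<le> D * exp (L * t)" if "t \<in> {0..r}" for t
        proof -
          have "D * 1 \<le> D * exp (L * t)" using \<open>D > 0\<close> L(1) that by (intro mult_left_mono) auto
          then show ?thesis using elim that by (fastforce simp: dist_real_def)
        qed
        from L(2)[OF it_cont ycont this r'(3), of m m]
        show ?case using e by (simp add: dist_real_def D_def)
      qed
    qed
    moreover have "(\<lambda>n. it (Suc n) r) \<longlonglongrightarrow> y r"
      using tendsto_uniform_limitI[OF unif[OF r'(1,2)] r'(3)] by (rule LIMSEQ_Suc)
    ultimately show ?thesis unfolding it_Suc using LIMSEQ_unique by blast
  qed
  then show ?thesis using ycont by (auto simp: solves_def)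
qed

lemma solves_has_derivative:
  assumes "solves m y" "r \<in> {0..<R}"
  shows "(y has_real_derivative slope (\<lambda>t. H t (y t)) r) (at r within {0..<R})"
proof -
  have "((\<lambda>r. m + potential (\<lambda>t. H t (y t)) r) has_real_derivative slope (\<lambda>t. H t (y t)) r) (at r within {0..<R})"
    using potential_has_derivative[OF H_cont assms(2)] assms(1)
    by (auto intro!: derivative_eq_intros simp: solves_def)
  then show ?thesis
    by (rule has_field_derivative_transform_within[OF _ zero_less_one assms(2)])
      (use assms(1) in \<open>auto simp: solves_def picard_def\<close>)
qed


lemma solves_has_flux_derivative:
  assumes "solves m y"
  shows "has_flux_derivative y (\<lambda>t. q t * H t (y t))"
  unfolding has_flux_derivative_def
proof (intro conjI exI[of _ "flux (\<lambda>t. H t (y t))"] ballI)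
  show y: "continuous_on {0..<R} y" using assms by (simp add: solves_def)
  fix s assume s: "s \<in> {0<..<R}"
  have "at s within {0..<R} = at s" by (rule at_within_interior) (use s in auto)
  then show "(y has_real_derivative flux (\<lambda>t. H t (y t)) s / q s) (at s)"
    "(flux (\<lambda>t. H t (y t)) has_real_derivative q s * H s (y s)) (at s)"
    using solves_has_derivative[OF assms, of s] flux_has_derivative[OF H_cont[OF y], of s] s
    by (auto simp: slope_def)
qed (use assms in \<open>auto simp: solves_def intro!: flux_cont H_cont\<close>)

lemma solves_ge_initial:
  assumes "solves m y" "r \<in> {0..<R}" "\<And>t z. 0 \<le> t \<Longrightarrow> t < R \<Longrightarrow> 0 \<le> H t z"
  shows "m \<le> y r"
  using assms potential_nonneg[of r "\<lambda>t. H t (y t)"] by (auto simp: solves_def picard_def)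

text \<open>Existence of a solution between a subsolution \<open>B\<close> and a supersolution \<open>U\<close>. The initial values whose
solution leaves through \<open>U\<close> and those whose solution leaves through \<open>B\<close> form open sets, by
continuous dependence at a fixed radius, and they are disjoint, because after leaving through one
barrier the solution stays on the far side of it. The set \<open>{0..U 0 + 1}\<close> meets both, so it is not
their union. The inequality for \<open>B\<close> is imposed where \<open>B > 0\<close>: a solution with nonnegative initial
value is nonnegative, so it can lie below \<open>B\<close> only there.\<close>

lemma shooting:
  assumes H_nonneg: "\<And>t y. 0 \<le> t \<Longrightarrow> t < R \<Longrightarrow> 0 \<le> H t y"
    and H_mono: "\<And>t y z. 0 \<le> t \<Longrightarrow> t < R \<Longrightarrow> y \<le> z \<Longrightarrow> H t y \<le> H t z"
    and H_0: "\<And>t. 0 \<le> t \<Longrightarrow> t < R \<Longrightarrow> H t 0 = 0"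
    and super: "has_flux_derivative U u" "\<And>t. 0 < t \<Longrightarrow> t < R \<Longrightarrow> u t \<le> q t * H t (U t)"
    and sub: "has_flux_derivative B b" "\<And>t. 0 < t \<Longrightarrow> t < R \<Longrightarrow> 0 < B t \<Longrightarrow> q t * H t (B t) \<le> b t"
    and ordered: "\<And>t. 0 \<le> t \<Longrightarrow> t < R \<Longrightarrow> B t \<le> U t"
    and U0: "0 \<le> U 0" and B_pos: "0 \<le> \<rho>" "\<rho> < R" "0 < B \<rho>"
  shows "\<exists>m y. m > 0 \<and> solves m y \<and> (\<forall>r. 0 \<le> r \<longrightarrow> r < R \<longrightarrow> B r \<le> y r \<and> y r \<le> U r)"
proof -
  define sol where "sol m = (SOME y. solves m y)" for m
  have sol: "solves m (sol m)" for m unfolding sol_def using solution_exists by (rule someI_ex)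
  have sol_ge: "m \<le> sol m r" if "0 \<le> r" "r < R" for m r
    using solves_ge_initial[OF sol] H_nonneg that by auto
  define above where "above = (\<Union>r\<in>{0..<R}. {m. U r < sol m r})"
  define below where "below = (\<Union>r\<in>{0..<R}. {m. sol m r < B r})"
  have cont: "continuous_on UNIV (\<lambda>m. sol m r)" if "r \<in> {0..<R}" for r
  proof -
    have "r < R" "r \<in> {0..r}" using that by auto
    then have "\<exists>M. \<forall>m m'. \<bar>sol m r - sol m' r\<bar> \<le> M * \<bar>m - m'\<bar>"
      using stability[of r] sol by meson
    then obtain M where M: "\<And>m m'. \<bar>sol m r - sol m' r\<bar> \<le> M * \<bar>m - m'\<bar>" by blast
    have "M * \<bar>1 - 0\<bar> \<ge> 0" using M[of 1 0] abs_ge_zero order_trans by blast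
    then have "M-lipschitz_on UNIV (\<lambda>m. sol m r)"
      by (intro lipschitz_onI) (auto simp: dist_real_def M)
    then show ?thesis by (rule lipschitz_on_continuous_on)
  qed
  have opn: "open above" "open below"
    unfolding above_def below_def
    by (intro open_UN ballI open_Collect_less cont continuous_intros; assumption)+
  have stays_above: "U r2 < sol m r2" if "U r1 < sol m r1" "0 \<le> r1" "r1 \<le> r2" "r2 < R" for m r1 r2
  proof -
    have "sol m r1 - U r1 \<le> sol m r2 - U r2"
    proof (rule positivity_persists[OF has_flux_derivative_diff[OF solves_has_flux_derivative[OF sol] super(1)]])
      fix s assume s: "0 < s" "s < R" "0 < sol m s - U s"
      have "q s * H s (U s) \<le> q s * H s (sol m s)"
        using s H_mono[of s "U s" "sol m s"] q_pos[of s] by (intro mult_left_mono) auto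
      then show "0 \<le> q s * H s (sol m s) - u s" using super(2)[of s] s by auto
    qed (use that in auto)
    then show ?thesis using that by auto
  qed
  have stays_below: "sol m r2 < B r2" if "0 \<le> m" "sol m r1 < B r1" "0 \<le> r1" "r1 \<le> r2" "r2 < R" for m r1 r2
  proof -
    have "B r1 - sol m r1 \<le> B r2 - sol m r2"
    proof (rule positivity_persists[OF has_flux_derivative_diff[OF sub(1) solves_has_flux_derivative[OF sol]]])
      fix s assume s: "0 < s" "s < R" "0 < B s - sol m s"
      have "0 < B s" using s sol_ge[of s m] \<open>0 \<le> m\<close> by auto
      moreover have "q s * H s (sol m s) \<le> q s * H s (B s)"
        using s H_mono[of s "sol m s" "B s"] q_pos[of s] by (intro mult_left_mono) auto
      ultimately show "0 \<le> b s - q s * H s (sol m s)" using sub(2)[of s] s by auto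
    qed (use that in auto)
    then show ?thesis using that by auto
  qed
  have disj: "above \<inter> below \<inter> {0..U 0 + 1} = {}"
  proof -
    have False if m: "0 \<le> m" and 1: "0 \<le> r1" "r1 < R" "U r1 < sol m r1"
      and 2: "0 \<le> r2" "r2 < R" "sol m r2 < B r2" for m r1 r2
    proof (cases "r1 \<le> r2")
      case True
      then show False using stays_above[of r1 m r2] ordered[of r2] 1 2 by auto
    next
      case False
      then show False using stays_below[of m r2 r1] ordered[of r1] m 1 2 by auto
    qed
    then show ?thesis unfolding above_def below_def by fastforce
  qed
  \<comment> \<open>The initial value 0 is shot below: its solution is 0, and the lower barrier is positive
  somewhere.\<close>
  have zero: "solves 0 (\<lambda>_. 0)"
  proof -
    have "slope (\<lambda>t. H t 0) s = 0" if "s \<in> {0..<R}" for s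
    proof -
      have "integral {0..s} (\<lambda>t. q t * H t 0) = integral {0..s} (\<lambda>t. 0)"
        by (rule Henstock_Kurzweil_Integration.integral_cong) (use H_0 that in auto)
      then show ?thesis by (simp add: slope_def flux_def)
    qed
    then have "potential (\<lambda>t. H t 0) r = integral {0..r} (\<lambda>t. 0)" if "r \<in> {0..<R}" for r
      unfolding potential_def
      by (intro Henstock_Kurzweil_Integration.integral_cong) (use that in auto)
    then show ?thesis by (simp add: solves_def picard_def)
  qed
  have "0 \<in> below"
  proof -
    obtain M where "\<bar>sol 0 \<rho> - 0\<bar> \<le> M * \<bar>0 - 0\<bar>"
      using stability[OF B_pos(2)] sol[of 0] zero B_pos(1) by (metis (lifting) atLeastAtMost_iff order_refl)
    then show ?thesis using B_pos unfolding below_def by force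
  qed
  moreover have "U 0 + 1 \<in> above"
    using sol_ge[of 0 "U 0 + 1"] R_pos unfolding above_def by force
  moreover have "0 \<in> {0..U 0 + 1}" "U 0 + 1 \<in> {0..U 0 + 1}" using U0 by auto
  ultimately have "\<not> {0..U 0 + 1} \<subseteq> above \<union> below"
    using connectedD[OF connected_Icc opn disj] by (meson disjoint_iff)
  then obtain m where m: "m \<in> {0..U 0 + 1}" "m \<notin> above" "m \<notin> below" by (meson UnCI subsetI)
  have "m > 0" using m \<open>0 \<in> below\<close> by (cases "m = 0") auto
  moreover have "B r \<le> sol m r \<and> sol m r \<le> U r" if "0 \<le> r" "r < R" for r
    using m that by (auto simp: above_def below_def not_less)
  ultimately show ?thesis using sol by blast
qed

end

section \<open>The weight of the ball and the barriers\<close>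

definition ball_weight :: "nat \<Rightarrow> real \<Rightarrow> real \<Rightarrow> real \<Rightarrow> real" where
  "ball_weight N \<alpha> R t = t ^ (N - 1) * (R - t) powr \<alpha>"

lemma ball_weight_pos: "0 < t \<Longrightarrow> t < R \<Longrightarrow> 0 < ball_weight N \<alpha> R t"
  by (simp add: ball_weight_def)

lemma radial_weight_ball_weight:
  assumes "R > 0"
  shows "radial_weight R (ball_weight N \<alpha> R)"
proof
  show "continuous_on {0..<R} (ball_weight N \<alpha> R)"
    unfolding ball_weight_def by (intro continuous_intros) auto
  show "\<exists>C>0. \<forall>s t. 0 \<le> t \<longrightarrow> t \<le> s \<longrightarrow> s \<le> b \<longrightarrow> ball_weight N \<alpha> R t \<le> C * ball_weight N \<alpha> R s"
    if b: "b < R" for b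
  \<comment> \<open>The ratio \<open>(R - t) / (R - s)\<close> lies between 1 and \<open>R / (R - b)\<close>; the exponent \<open>\<bar>\<alpha>\<bar>\<close> covers both signs of \<open>\<alpha>\<close>.\<close>
  proof (intro exI[of _ "(R / (R - b)) powr \<bar>\<alpha>\<bar>"] conjI allI impI)
    show "0 < (R / (R - b)) powr \<bar>\<alpha>\<bar>" using assms b by simp
    fix s t assume st: "0 \<le> t" "t \<le> s" "s \<le> b"
    define x where "x = (R - t) / (R - s)"
    have x: "1 \<le> x" "x \<le> R / (R - b)" "0 < R - s"
      using st b assms by (auto simp: x_def intro!: frac_le)
    have "(R - t) powr \<alpha> = x powr \<alpha> * (R - s) powr \<alpha>"
      using x st by (simp add: x_def powr_mult[symmetric])
    also have "\<dots> \<le> (R / (R - b)) powr \<bar>\<alpha>\<bar> * (R - s) powr \<alpha>"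
    proof (intro mult_right_mono)
      have "x powr \<alpha> \<le> x powr \<bar>\<alpha>\<bar>" using x by (intro powr_mono) auto
      also have "\<dots> \<le> (R / (R - b)) powr \<bar>\<alpha>\<bar>" using x by (intro powr_mono2) auto
      finally show "x powr \<alpha> \<le> (R / (R - b)) powr \<bar>\<alpha>\<bar>" .
    qed auto
    finally have 1: "(R - t) powr \<alpha> \<le> (R / (R - b)) powr \<bar>\<alpha>\<bar> * (R - s) powr \<alpha>" .
    have "t ^ (N - 1) * (R - t) powr \<alpha> \<le> s ^ (N - 1) * ((R / (R - b)) powr \<bar>\<alpha>\<bar> * (R - s) powr \<alpha>)"
      using st 1 by (intro mult_mono power_mono) auto
    then show "ball_weight N \<alpha> R t \<le> (R / (R - b)) powr \<bar>\<alpha>\<bar> * ball_weight N \<alpha> R s"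
      by (simp add: ball_weight_def mult_ac)
  qed
qed (use assms in \<open>auto simp: ball_weight_def\<close>)

lemma ball_weight_has_derivative:
  assumes "0 < t" "t < R" "N \<ge> 1"
  shows "(ball_weight N \<alpha> R has_real_derivative
    ball_weight N \<alpha> R t * ((real N - 1) / t - \<alpha> / (R - t))) (at t)"
proof -
  have 1: "((\<lambda>t. t ^ (N - 1)) has_real_derivative t ^ (N - 1) * ((real N - 1) / t)) (at t)"
  proof -
    have "((\<lambda>t. t ^ (N - 1)) has_real_derivative real (N - 1) * t ^ (N - 1 - 1)) (at t)"
      using DERIV_pow[of "N - 1" t] by simp
    moreover have "real (N - 1) * t ^ (N - 1 - 1) = t ^ (N - 1) * ((real N - 1) / t)"
    proof (cases "N = 1")
      case False
      then have "N - 1 = Suc (N - 1 - 1)" using assms by simp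
      then have "t ^ (N - 1) = t * t ^ (N - 1 - 1)" by (metis power_Suc)
      then show ?thesis using assms by (simp add: of_nat_diff)
    qed simp
    ultimately show ?thesis by simp
  qed
  have 2: "((\<lambda>t. (R - t) powr \<alpha>) has_real_derivative (R - t) powr \<alpha> * (- \<alpha> / (R - t))) (at t)"
    using assms by (auto intro!: derivative_eq_intros simp: powr_diff)
  show ?thesis unfolding ball_weight_def
    using DERIV_mult[OF 1 2] by (rule DERIV_cong) (simp add: algebra_simps)
qed

text \<open>The logarithmic derivative of the weight is \<open>(N - 1) / t - \<alpha> / (R - t)\<close>, which turns the divergence
form into the operator of the radial equation.\<close>

lemma C2_has_flux_derivative:
  assumes "R > 0" "N \<ge> 1" "continuous_on {0..<R} w'" "w' 0 = 0"
    and "continuous_on {0..<R} w"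
    and "\<And>t. 0 < t \<Longrightarrow> t < R \<Longrightarrow> (w has_real_derivative w' t) (at t)"
    and "\<And>t. 0 < t \<Longrightarrow> t < R \<Longrightarrow> (w' has_real_derivative w'' t) (at t)"
  shows "radial_weight.has_flux_derivative R (ball_weight N \<alpha> R) w
    (\<lambda>t. ball_weight N \<alpha> R t * (w'' t + ((real N - 1) / t - \<alpha> / (R - t)) * w' t))"
proof -
  interpret radial_weight R "ball_weight N \<alpha> R" by (rule radial_weight_ball_weight[OF assms(1)])
  show ?thesis unfolding has_flux_derivative_def
  proof (intro conjI exI[of _ "\<lambda>t. ball_weight N \<alpha> R t * w' t"] ballI)
    fix s assume s: "s \<in> {0<..<R}"
    then show "(w has_real_derivative ball_weight N \<alpha> R s * w' s / ball_weight N \<alpha> R s) (at s)"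
      using assms(6)[of s] ball_weight_pos[of s R N \<alpha>] by simp
    show "((\<lambda>t. ball_weight N \<alpha> R t * w' t) has_real_derivative
        ball_weight N \<alpha> R s * (w'' s + ((real N - 1) / s - \<alpha> / (R - s)) * w' s)) (at s)"
    proof (rule DERIV_cong)
      show "((\<lambda>t. ball_weight N \<alpha> R t * w' t) has_real_derivative
          ball_weight N \<alpha> R s * ((real N - 1) / s - \<alpha> / (R - s)) * w' s + w'' s * ball_weight N \<alpha> R s) (at s)"
        by (rule DERIV_mult[OF ball_weight_has_derivative assms(7)]) (use s assms(2) in auto)
    qed (simp add: algebra_simps)
  qed (use assms in \<open>auto intro!: continuous_intros q_cont\<close>)
qed

text \<open>The power of \<open>R\<^sup>2 - r\<^sup>2\<close> rather than of \<open>R - r\<close> makes the barrier smooth at the centre of the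
ball. As \<open>R\<^sup>2 - r\<^sup>2 = (R - r) * (R + r)\<close>, the constant \<open>B\<close> corresponds to
\<open>B * (2 * R) powr (- \<beta>)\<close> in front of \<open>(R - r) powr (- \<beta>)\<close>.\<close>

definition barrier :: "real \<Rightarrow> real \<Rightarrow> real \<Rightarrow> real \<Rightarrow> real \<Rightarrow> real" where
  "barrier R \<beta> A B r = A + B * (R\<^sup>2 - r\<^sup>2) powr (- \<beta>)"

text \<open>What remains of the radial operator applied to the barrier after the common factor
\<open>2 * \<beta> * B * (R\<^sup>2 - r\<^sup>2) powr (- \<beta> - 2)\<close> is removed. The terms
\<open>(N - 1) / r\<close> and \<open>\<alpha> / (R - r)\<close> leave no singularity: the first derivative has a factor \<open>r\<close>,
and \<open>1 / (R - r) = (R + r) / (R\<^sup>2 - r\<^sup>2)\<close>. The value at \<open>r = R\<close> is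
\<open>2 * (\<beta> + 1 - \<alpha>) * R\<^sup>2\<close>, which is positive when \<open>\<beta> + 1 - \<alpha> > 0\<close>.\<close>

definition barrier_factor :: "nat \<Rightarrow> real \<Rightarrow> real \<Rightarrow> real \<Rightarrow> real \<Rightarrow> real" where
  "barrier_factor N R \<alpha> \<beta> r = real N * (R\<^sup>2 - r\<^sup>2) + 2 * (\<beta> + 1) * r\<^sup>2 - \<alpha> * r * (R + r)"

lemma square_diff_pos: "0 \<le> r \<Longrightarrow> r < R \<Longrightarrow> 0 < R\<^sup>2 - r\<^sup>2" for r R :: real
  by (simp add: power_strict_mono)

lemma barrier_has_flux_derivative:
  assumes "R > 0" "N \<ge> 1"
  shows "radial_weight.has_flux_derivative R (ball_weight N \<alpha> R) (barrier R \<beta> A B)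
    (\<lambda>t. ball_weight N \<alpha> R t *
      (2 * \<beta> * B * (R\<^sup>2 - t\<^sup>2) powr (- \<beta> - 2) * barrier_factor N R \<alpha> \<beta> t))"
proof -
  interpret radial_weight R "ball_weight N \<alpha> R" by (rule radial_weight_ball_weight[OF assms(1)])
  define w' where "w' t = 2 * B * \<beta> * t * (R\<^sup>2 - t\<^sup>2) powr (- \<beta> - 1)" for t
  define w'' where "w'' t = 2 * B * \<beta> * (R\<^sup>2 - t\<^sup>2) powr (- \<beta> - 1)
    + 4 * B * \<beta> * (\<beta> + 1) * t\<^sup>2 * (R\<^sup>2 - t\<^sup>2) powr (- \<beta> - 2)" for t
  have pos: "0 < R\<^sup>2 - t\<^sup>2" if "0 \<le> t" "t < R" for t using square_diff_pos that .
  have "has_flux_derivative (barrier R \<beta> A B)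
    (\<lambda>t. ball_weight N \<alpha> R t * (w'' t + ((real N - 1) / t - \<alpha> / (R - t)) * w' t))"
  proof (rule C2_has_flux_derivative[OF assms])
    show "continuous_on {0..<R} w'" unfolding w'_def
      by (intro continuous_intros) (use pos in fastforce)
    show "continuous_on {0..<R} (barrier R \<beta> A B)" unfolding barrier_def
      by (intro continuous_intros) (use pos in fastforce)
    fix t assume t: "0 < t" "t < R"
    have p: "0 < R\<^sup>2 - t\<^sup>2" using pos t by auto
    show "(barrier R \<beta> A B has_real_derivative w' t) (at t)" unfolding barrier_def w'_def
      using p by (auto intro!: derivative_eq_intros)
    show "(w' has_real_derivative w'' t) (at t)" unfolding w'_def w''_def
    proof (rule DERIV_cong)
      have "((\<lambda>t. (R\<^sup>2 - t\<^sup>2) powr (- \<beta> - 1)) has_real_derivative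
          (- \<beta> - 1) * (R\<^sup>2 - t\<^sup>2) powr (- \<beta> - 1 - of_nat 1) * (- 2 * t)) (at t)"
        by (rule DERIV_fun_powr) (use p in \<open>auto intro!: derivative_eq_intros\<close>)
      moreover have "((\<lambda>t. 2 * B * \<beta> * t) has_real_derivative 2 * B * \<beta>) (at t)"
        by (auto intro!: derivative_eq_intros)
      ultimately show "((\<lambda>t. 2 * B * \<beta> * t * (R\<^sup>2 - t\<^sup>2) powr (- \<beta> - 1)) has_real_derivative
          2 * B * \<beta> * (R\<^sup>2 - t\<^sup>2) powr (- \<beta> - 1)
          + (- \<beta> - 1) * (R\<^sup>2 - t\<^sup>2) powr (- \<beta> - 1 - of_nat 1) * (- 2 * t) * (2 * B * \<beta> * t)) (at t)"
        using DERIV_mult by blast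
      have "- \<beta> - 1 - of_nat 1 = - \<beta> - 2" by simp
      then show "2 * B * \<beta> * (R\<^sup>2 - t\<^sup>2) powr (- \<beta> - 1)
          + (- \<beta> - 1) * (R\<^sup>2 - t\<^sup>2) powr (- \<beta> - 1 - of_nat 1) * (- 2 * t) * (2 * B * \<beta> * t)
        = 2 * B * \<beta> * (R\<^sup>2 - t\<^sup>2) powr (- \<beta> - 1)
          + 4 * B * \<beta> * (\<beta> + 1) * t\<^sup>2 * (R\<^sup>2 - t\<^sup>2) powr (- \<beta> - 2)"
        by (simp only:) (simp add: power2_eq_square algebra_simps)
    qed
  qed (simp add: w'_def)
  moreover have "w'' t + ((real N - 1) / t - \<alpha> / (R - t)) * w' t
    = 2 * \<beta> * B * (R\<^sup>2 - t\<^sup>2) powr (- \<beta> - 2) * barrier_factor N R \<alpha> \<beta> t" if t: "0 < t" "t < R" for t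
  proof -
    define P where "P = (R\<^sup>2 - t\<^sup>2) powr (- \<beta> - 2)"
    have p: "0 < R\<^sup>2 - t\<^sup>2" using pos t by auto
    have *: "(R\<^sup>2 - t\<^sup>2) powr (- \<beta> - 1) = (R\<^sup>2 - t\<^sup>2) * P"
      using p powr_mult_base[of "R\<^sup>2 - t\<^sup>2" "- \<beta> - 2"] by (simp add: P_def minus_diff_commute)
    have **: "R\<^sup>2 - t\<^sup>2 = (R - t) * (R + t)" by (simp add: power2_eq_square algebra_simps)
    show ?thesis
      unfolding w'_def w''_def barrier_factor_def * P_def[symmetric]
      using t by (simp add: ** field_simps power2_eq_square)
  qed
  ultimately show ?thesis
    unfolding has_flux_derivative_def by (simp cong: conj_cong)
qed

text \<open>The choice of \<open>\<beta>\<close> means \<open>\<beta> * p = \<beta> + 2 + \<gamma> - \<alpha>\<close>. Hence the right-hand side of the equation has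
the same singular factor as the left-hand side, and comparing them becomes a comparison of functions
that are continuous up to \<open>r = R\<close>.\<close>

lemma barrier_powr:
  assumes "0 \<le> r" "r < R" "p > 1" "\<beta> = (2 + \<gamma> - \<alpha>) / (p - 1)"
    and "0 \<le> A * (R\<^sup>2 - r\<^sup>2) powr \<beta> + B"
  shows "(R - r) powr (\<gamma> - \<alpha>) * barrier R \<beta> A B r powr p
    = (R\<^sup>2 - r\<^sup>2) powr (- \<beta> - 2) * ((R + r) powr (\<alpha> - \<gamma>) * (A * (R\<^sup>2 - r\<^sup>2) powr \<beta> + B) powr p)"
proof -
  have p: "0 < R\<^sup>2 - r\<^sup>2" using square_diff_pos assms by blast
  have "barrier R \<beta> A B r = (R\<^sup>2 - r\<^sup>2) powr (- \<beta>) * (A * (R\<^sup>2 - r\<^sup>2) powr \<beta> + B)"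
    using p by (simp add: barrier_def algebra_simps powr_add[symmetric])
  then have 1: "barrier R \<beta> A B r powr p
      = (R\<^sup>2 - r\<^sup>2) powr (- \<beta> * p) * (A * (R\<^sup>2 - r\<^sup>2) powr \<beta> + B) powr p"
    using assms(5) by (simp add: powr_mult powr_powr)
  have "\<beta> * (p - 1) = 2 + \<gamma> - \<alpha>" using assms by simp
  then have e: "- \<beta> * p = (- \<beta> - 2) + (\<alpha> - \<gamma>)" by (simp add: algebra_simps)
  have "R\<^sup>2 - r\<^sup>2 = (R - r) * (R + r)" by (simp add: power2_eq_square algebra_simps)
  then have "(R\<^sup>2 - r\<^sup>2) powr (\<alpha> - \<gamma>) = (R - r) powr (\<alpha> - \<gamma>) * (R + r) powr (\<alpha> - \<gamma>)"
    using assms by (simp add: powr_mult)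
  then have "(R\<^sup>2 - r\<^sup>2) powr (- \<beta> * p)
      = (R\<^sup>2 - r\<^sup>2) powr (- \<beta> - 2) * ((R - r) powr (\<alpha> - \<gamma>) * (R + r) powr (\<alpha> - \<gamma>))"
    unfolding e powr_add by simp
  moreover have "(R - r) powr (\<gamma> - \<alpha>) * (R - r) powr (\<alpha> - \<gamma>) = 1"
    using assms by (simp add: powr_add[symmetric])
  ultimately show ?thesis unfolding 1 by (simp add: mult_ac)
qed

lemma positive_near_right_end:
  fixes g :: "real \<Rightarrow> real"
  assumes "R > 0" "continuous_on {0..R} g" "0 < g R"
  obtains b where "0 \<le> b" "b < R" "\<And>r. b \<le> r \<Longrightarrow> r \<le> R \<Longrightarrow> 0 < g r"
proof -
  have "(g \<longlongrightarrow> g R) (at R within {0..R})"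
    using assms(1,2) by (auto simp: continuous_on_def)
  then have "\<forall>\<^sub>F r in at R within {0..R}. 0 < g r" using assms(3) by (rule order_tendstoD)
  then obtain d where d: "d > 0" "\<And>r. r \<in> {0..R} \<Longrightarrow> r \<noteq> R \<Longrightarrow> dist r R < d \<Longrightarrow> 0 < g r"
    unfolding eventually_at by auto
  define b where "b = max 0 (R - d / 2)"
  have b: "0 \<le> b" "b < R" using d assms(1) by (auto simp: b_def)
  have "0 < g r" if "b \<le> r" "r \<le> R" for r
    using d(2)[of r] d(1) that assms(3) b by (cases "r = R") (auto simp: b_def dist_real_def)
  then show thesis using that b by blast
qed

text \<open>The inequality holds at \<open>R\<close> for any \<open>A \<ge> 0\<close> by the strict assumption there, hence near \<open>R\<close> by
continuity. On the remaining compact interval \<open>e\<close> is bounded below, so a large \<open>A\<close> suffices.\<close>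

lemma large_shift_upper:
  fixes f c e :: "real \<Rightarrow> real"
  assumes "R > 0" "continuous_on {0..R} f" "continuous_on {0..R} c" "continuous_on {0..R} e"
    and c: "\<And>r. r \<in> {0..R} \<Longrightarrow> 0 < c r" and e: "\<And>r. 0 \<le> r \<Longrightarrow> r < R \<Longrightarrow> 0 < e r" "0 \<le> e R"
    and "B > 0" "p > 0" "f R < c R * B powr p"
  obtains A where "A \<ge> 0" "\<And>r. 0 \<le> r \<Longrightarrow> r \<le> R \<Longrightarrow> f r \<le> c r * (A * e r + B) powr p"
proof -
  have "continuous_on {0..R} (\<lambda>r. c r * B powr p - f r)" by (intro continuous_intros assms)
  then obtain b where b: "0 \<le> b" "b < R"
    and "\<And>r. b \<le> r \<Longrightarrow> r \<le> R \<Longrightarrow> 0 < c r * B powr p - f r"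
    using positive_near_right_end[OF assms(1)] assms(10) by (metis (no_types, lifting) diff_gt_0_iff_gt)
  then have near: "f r \<le> c r * B powr p" if "b \<le> r" "r \<le> R" for r
    using that by (simp add: less_imp_le)
  have cont: "continuous_on {0..b} f" "continuous_on {0..b} c" "continuous_on {0..b} e"
    by (rule continuous_on_subset[OF assms(2)] continuous_on_subset[OF assms(3)]
        continuous_on_subset[OF assms(4)]; use b in auto)+
  obtain tf where tf: "tf \<in> {0..b}" "\<And>t. t \<in> {0..b} \<Longrightarrow> f t \<le> f tf"
    using continuous_attains_sup[of "{0..b}" f] cont b by auto
  obtain tc where tc: "tc \<in> {0..b}" "\<And>t. t \<in> {0..b} \<Longrightarrow> c tc \<le> c t"
    using continuous_attains_inf[of "{0..b}" c] cont b by auto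
  obtain te where te: "te \<in> {0..b}" "\<And>t. t \<in> {0..b} \<Longrightarrow> e te \<le> e t"
    using continuous_attains_inf[of "{0..b}" e] cont b by auto
  have pos: "0 < c tc" "0 < e te" using tc te c e b by auto
  \<comment> \<open>This value makes \<open>c tc * (A * e te) powr p\<close> equal to the maximum of \<open>f\<close> on \<open>{0..b}\<close>, if that is positive.\<close>
  define A where "A = (max (f tf) 0 / c tc) powr (1 / p) / e te"
  show thesis
  proof (rule that)
    show A: "A \<ge> 0" using pos by (simp add: A_def)
    fix r assume r: "0 \<le> r" "r \<le> R"
    have er: "0 \<le> e r" using e r by (cases "r = R") (auto intro: less_imp_le)
    show "f r \<le> c r * (A * e r + B) powr p"
    proof (cases "r \<le> b")
      case True
      have "(A * e te) powr p \<le> (A * e r + B) powr p"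
        using A te(2)[of r] r True pos assms by (intro powr_mono2) (auto intro!: add_increasing2 mult_left_mono)
      moreover have "(A * e te) powr p = max (f tf) 0 / c tc"
        using pos assms(9) by (simp add: A_def powr_powr)
      moreover have "c tc \<le> c r" using tc True r by auto
      ultimately have "c tc * (max (f tf) 0 / c tc) \<le> c r * (A * e r + B) powr p"
        using pos by (intro mult_mono) auto
      moreover have "f r \<le> f tf" using tf(2)[of r] r True by auto
      ultimately show ?thesis using pos by simp
    next
      case False
      have "B powr p \<le> (A * e r + B) powr p"
        using A er assms by (intro powr_mono2) auto
      then have "c r * B powr p \<le> c r * (A * e r + B) powr p"
        using c[of r] r by (intro mult_left_mono) auto
      then show ?thesis using near[of r] False r by auto
    qed
  qed
qed

text \<open>Near \<open>R\<close> the strict inequality at \<open>R\<close> is enough. Away from \<open>R\<close> a large \<open>A\<close> makes \<open>B - A * e r\<close>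
nonpositive, so nothing is claimed there.\<close>

lemma large_shift_lower:
  fixes f c e :: "real \<Rightarrow> real"
  assumes "R > 0" "continuous_on {0..R} f" "continuous_on {0..R} c" "continuous_on {0..R} e"
    and c: "\<And>r. r \<in> {0..R} \<Longrightarrow> 0 < c r" and e: "\<And>r. 0 \<le> r \<Longrightarrow> r < R \<Longrightarrow> 0 < e r" "0 \<le> e R"
    and "B > 0" "p > 0" "c R * B powr p < f R"
  obtains A where "A \<ge> 0"
    "\<And>r. 0 \<le> r \<Longrightarrow> r \<le> R \<Longrightarrow> 0 < B - A * e r \<Longrightarrow> c r * (B - A * e r) powr p \<le> f r"
proof -
  have "continuous_on {0..R} (\<lambda>r. f r - c r * B powr p)" by (intro continuous_intros assms)
  then obtain b where b: "0 \<le> b" "b < R"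
    and "\<And>r. b \<le> r \<Longrightarrow> r \<le> R \<Longrightarrow> 0 < f r - c r * B powr p"
    using positive_near_right_end[OF assms(1)] assms(10) by (metis (no_types, lifting) diff_gt_0_iff_gt)
  then have near: "c r * B powr p \<le> f r" if "b \<le> r" "r \<le> R" for r
    using that by (simp add: less_imp_le)
  have "continuous_on {0..b} e" by (rule continuous_on_subset[OF assms(4)]) (use b in auto)
  then obtain te where te: "te \<in> {0..b}" "\<And>t. t \<in> {0..b} \<Longrightarrow> e te \<le> e t"
    using continuous_attains_inf[of "{0..b}" e] b by auto
  have pos: "0 < e te" using te e b by auto
  show thesis
  proof (rule that)
    show A: "B / e te \<ge> 0" using pos assms by simp
    fix r assume r: "0 \<le> r" "r \<le> R" and B: "0 < B - B / e te * e r"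
    have er: "0 \<le> e r" using e r by (cases "r = R") (auto intro: less_imp_le)
    have "\<not> r \<le> b"
    proof
      assume "r \<le> b"
      then have "B / e te * e te \<le> B / e te * e r" using te(2)[of r] r A by (intro mult_left_mono) auto
      then show False using B pos by simp
    qed
    moreover have "(B - B / e te * e r) powr p \<le> B powr p"
      using B mult_nonneg_nonneg[OF A er] assms(9) by (intro powr_mono2) linarith+
    then have "c r * (B - B / e te * e r) powr p \<le> c r * B powr p"
      using c[of r] r by (intro mult_left_mono) auto
    ultimately show "c r * (B - B / e te * e r) powr p \<le> f r" using near[of r] r by auto
  qed
qed

text \<open>The constant \<open>K\<close> is the one for which the two sides of the equation agree to leading order at the
boundary; the factor \<open>\<kappa>\<close> enters the nonlinear side with one extra power \<open>p - 1\<close>. So the barrier is a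
strict supersolution near \<open>R\<close> for \<open>\<kappa> > 1\<close> and a strict subsolution for \<open>\<kappa> < 1\<close>.\<close>

lemma boundary_balance:
  assumes "p > 1" "R > 0" "aR > 0" "\<beta> > 0" "\<beta> + 1 - \<alpha> > 0" "\<kappa> > 0"
    and "\<beta> = (2 + \<gamma> - \<alpha>) / (p - 1)"
    and "K = (\<beta> * (\<beta> + 1 - \<alpha>) / aR) powr (1 / (p - 1))"
    and "B = \<kappa> * K * (2 * R) powr \<beta>"
  shows "aR * (R + R) powr (\<alpha> - \<gamma>) * B powr p
    = 2 * \<beta> * B * barrier_factor N R \<alpha> \<beta> R * \<kappa> powr (p - 1)"
proof -
  have K: "K > 0" "K powr (p - 1) = \<beta> * (\<beta> + 1 - \<alpha>) / aR"
    unfolding assms(8) using assms(1-5) by (simp_all add: powr_powr)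
  have B: "B > 0" using assms K by simp
  have bp: "\<beta> * (p - 1) = 2 + \<gamma> - \<alpha>" using assms by simp
  have X: "B powr (p - 1) = \<kappa> powr (p - 1) * K powr (p - 1) * (2 * R) powr (2 + \<gamma> - \<alpha>)"
    using assms K bp by (simp add: powr_mult powr_powr)
  have Y: "(2 * R) powr (2 + \<gamma> - \<alpha>) * (2 * R) powr (\<alpha> - \<gamma>) = 4 * R\<^sup>2"
    using assms by (simp add: powr_add[symmetric] power2_eq_square)
  have "aR * (2 * R) powr (\<alpha> - \<gamma>) * B powr (p - 1)
      = aR * (\<kappa> powr (p - 1) * K powr (p - 1) * ((2 * R) powr (2 + \<gamma> - \<alpha>) * (2 * R) powr (\<alpha> - \<gamma>)))"
    unfolding X by (simp only: mult_ac)
  also have "\<dots> = 4 * R\<^sup>2 * \<beta> * (\<beta> + 1 - \<alpha>) * \<kappa> powr (p - 1)"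
    unfolding Y K(2) using assms(3) by simp
  finally have 1: "aR * (2 * R) powr (\<alpha> - \<gamma>) * B powr (p - 1)
    = 4 * R\<^sup>2 * \<beta> * (\<beta> + 1 - \<alpha>) * \<kappa> powr (p - 1)" .
  have "B powr p = B * B powr (p - 1)" using B powr_mult_base[of B "p - 1"] by simp
  then have "aR * (R + R) powr (\<alpha> - \<gamma>) * B powr p = B * (aR * (2 * R) powr (\<alpha> - \<gamma>) * B powr (p - 1))"
    by simp
  then show ?thesis unfolding 1 by (simp add: barrier_factor_def algebra_simps power2_eq_square)
qed

lemma barrier_asymptotics:
  assumes "R > 0" "\<beta> > 0" "K > 0" "B = \<kappa> * K * (2 * R) powr \<beta>"
  shows "((\<lambda>r. barrier R \<beta> A B r / (K * (R - r) powr (- \<beta>))) \<longlongrightarrow> \<kappa>) (at_left R)"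
proof -
  have "((\<lambda>r. A / K * (R - r) powr \<beta> + B / K * (R + r) powr (- \<beta>)) \<longlongrightarrow>
      A / K * 0 + B / K * (R + R) powr (- \<beta>)) (at_left R)"
  proof (intro tendsto_add tendsto_mult tendsto_const)
    have "((\<lambda>r. R - r) \<longlongrightarrow> R - R) (at_left R)" by (intro tendsto_intros)
    then have "((\<lambda>r. R - r) \<longlongrightarrow> 0) (at_left R)" by simp
    moreover have "\<forall>\<^sub>F r in at_left R. 0 \<le> R - r"
      using eventually_at_left_real[OF assms(1)] by eventually_elim auto
    ultimately show "((\<lambda>r. (R - r) powr \<beta>) \<longlongrightarrow> 0) (at_left R)"
      using assms(2) by (intro tendsto_zero_powrI[where b = \<beta>] tendsto_const)
    show "((\<lambda>r. (R + r) powr - \<beta>) \<longlongrightarrow> (R + R) powr - \<beta>) (at_left R)"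
      using assms(1) by (intro tendsto_intros) auto
  qed
  moreover have "A / K * 0 + B / K * (R + R) powr (- \<beta>) = \<kappa>"
    using assms by (simp add: powr_minus)
  moreover have "\<forall>\<^sub>F r in at_left R. A / K * (R - r) powr \<beta> + B / K * (R + r) powr (- \<beta>)
      = barrier R \<beta> A B r / (K * (R - r) powr (- \<beta>))"
    using eventually_at_left_real[OF assms(1)]
  proof eventually_elim
    case (elim r)
    have "R\<^sup>2 - r\<^sup>2 = (R - r) * (R + r)" by (simp add: power2_eq_square algebra_simps)
    then have "(R\<^sup>2 - r\<^sup>2) powr (- \<beta>) = (R - r) powr (- \<beta>) * (R + r) powr (- \<beta>)"
      using elim by (simp add: powr_mult)
    moreover have "(R - r) powr (- \<beta>) > 0" using elim by simp
    moreover have "(R - r) powr \<beta> = 1 / (R - r) powr (- \<beta>)"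
      by (simp add: powr_minus_divide)
    ultimately show ?case using assms(3) by (simp add: barrier_def add_divide_distrib)
  qed
  ultimately show ?thesis using Lim_transform_eventually by force
qed


section \<open>A large solution between the barriers\<close>

text \<open>The shooting lemma is applied to the nonlinearity truncated to \<open>[0, U t]\<close>, which is Lipschitz on every
\<open>{0..b}\<close> with \<open>b < R\<close>, bounded there, and unchanged between the barriers.\<close>

lemma radial_large_solution_between_barriers:
  fixes N :: nat and p R \<alpha> \<gamma> \<beta> K \<kappa>\<^sub>1 \<kappa>\<^sub>2 :: real and a :: "real \<Rightarrow> real"
  assumes "p > 1" "R > 0" "\<gamma> - \<alpha> \<ge> 0" "N \<ge> 1"
    and a: "continuous_on {0..R} a" "\<And>r. r \<in> {0..R} \<Longrightarrow> a r > 0"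
    and \<beta>: "\<beta> = (2 + \<gamma> - \<alpha>) / (p - 1)" "\<beta> + 1 - \<alpha> > 0"
    and K: "K = (\<beta> * (\<beta> + 1 - \<alpha>) / a R) powr (1 / (p - 1))"
    and \<kappa>: "0 < \<kappa>\<^sub>1" "\<kappa>\<^sub>1 < 1" "1 < \<kappa>\<^sub>2"
  obtains \<psi> A\<^sub>1 A\<^sub>2 where "continuous_on {0..<R} \<psi>" "\<And>r. 0 \<le> r \<Longrightarrow> r < R \<Longrightarrow> 0 < \<psi> r"
    "\<And>r. 0 \<le> r \<Longrightarrow> r < R \<Longrightarrow> barrier R \<beta> A\<^sub>1 (\<kappa>\<^sub>1 * K * (2 * R) powr \<beta>) r \<le> \<psi> r"
    "\<And>r. 0 \<le> r \<Longrightarrow> r < R \<Longrightarrow> \<psi> r \<le> barrier R \<beta> A\<^sub>2 (\<kappa>\<^sub>2 * K * (2 * R) powr \<beta>) r"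
    "\<And>r. 0 \<le> r \<Longrightarrow> r < R \<Longrightarrow> (\<psi> has_real_derivative
       radial_weight.slope (ball_weight N \<alpha> R) (\<lambda>t. a t * (R - t) powr (\<gamma> - \<alpha>) * \<psi> t powr p) r)
       (at r within {0..<R})"
proof -
  interpret radial_weight R "ball_weight N \<alpha> R" by (rule radial_weight_ball_weight[OF assms(2)])
  have \<beta>0: "\<beta> > 0" using assms by simp
  have aR: "a R > 0" using a assms(2) by auto
  have K0: "K > 0" using K \<beta>0 \<beta>(2) aR by simp
  define B\<^sub>1 where "B\<^sub>1 = \<kappa>\<^sub>1 * K * (2 * R) powr \<beta>"
  define B\<^sub>2 where "B\<^sub>2 = \<kappa>\<^sub>2 * K * (2 * R) powr \<beta>"
  have B0: "0 < B\<^sub>1" "0 < B\<^sub>2" "B\<^sub>1 \<le> B\<^sub>2"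
    using \<kappa> K0 assms(2) by (auto simp: B\<^sub>1_def B\<^sub>2_def intro!: mult_right_mono)
  define c where "c r = a r * (R + r) powr (\<alpha> - \<gamma>)" for r
  define f where "f B r = 2 * \<beta> * B * barrier_factor N R \<alpha> \<beta> r" for B r
  define e where "e r = (R\<^sup>2 - r\<^sup>2) powr \<beta>" for r
  have c_cont: "continuous_on {0..R} c" unfolding c_def
    using assms(2) by (intro continuous_intros a) auto
  have c_pos: "0 < c r" if "r \<in> {0..R}" for r using a(2)[OF that] that assms(2) by (simp add: c_def)
  have f_cont: "continuous_on {0..R} (f B)" for B unfolding f_def barrier_factor_def
    by (intro continuous_intros)
  have sq: "r\<^sup>2 \<le> R\<^sup>2" if "r \<in> {0..R}" for r using that by (auto intro!: power_mono)
  have e_cont: "continuous_on {0..R} e" unfolding e_def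
    using sq \<beta>0 by (intro continuous_on_powr' continuous_intros) auto
  have e_pos: "0 < e r" if "0 \<le> r" "r < R" for r using square_diff_pos[OF that] by (simp add: e_def)
  have fR: "0 < f B R" if "0 < B" for B
  proof -
    have "f B R = B * (4 * R\<^sup>2 * \<beta> * (\<beta> + 1 - \<alpha>))"
      by (simp add: f_def barrier_factor_def power2_eq_square algebra_simps)
    also have "\<dots> > 0" using that assms(2) \<beta>0 \<beta>(2) by simp
    finally show ?thesis .
  qed
  have "c R * B\<^sub>2 powr p = f B\<^sub>2 R * \<kappa>\<^sub>2 powr (p - 1)"
    unfolding c_def f_def using \<kappa>
    by (intro boundary_balance[OF assms(1,2) aR \<beta>0 \<beta>(2) _ \<beta>(1) K B\<^sub>2_def]) auto
  moreover have "1 < \<kappa>\<^sub>2 powr (p - 1)" using \<kappa> assms(1) by simp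
  ultimately have super: "f B\<^sub>2 R < c R * B\<^sub>2 powr p" using fR[OF B0(2)] by simp
  have "c R * B\<^sub>1 powr p = f B\<^sub>1 R * \<kappa>\<^sub>1 powr (p - 1)"
    unfolding c_def f_def using \<kappa>
    by (intro boundary_balance[OF assms(1,2) aR \<beta>0 \<beta>(2) _ \<beta>(1) K B\<^sub>1_def]) auto
  moreover have "\<kappa>\<^sub>1 powr (p - 1) < 1" using \<kappa> assms(1) powr_less_mono2[of "p - 1" \<kappa>\<^sub>1 1] by simp
  ultimately have sub: "c R * B\<^sub>1 powr p < f B\<^sub>1 R" using fR[OF B0(1)] by simp
  have p0: "p > 0" using assms(1) by simp
  have eR: "0 \<le> e R" by (simp add: e_def)
  obtain A\<^sub>2 where A2: "A\<^sub>2 \<ge> 0" "\<And>r. 0 \<le> r \<Longrightarrow> r \<le> R \<Longrightarrow> f B\<^sub>2 r \<le> c r * (A\<^sub>2 * e r + B\<^sub>2) powr p"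
    using large_shift_upper[OF assms(2) f_cont c_cont e_cont c_pos e_pos eR B0(2) p0 super] by blast
  obtain A\<^sub>1 where A1: "A\<^sub>1 \<ge> 0"
    "\<And>r. 0 \<le> r \<Longrightarrow> r \<le> R \<Longrightarrow> 0 < B\<^sub>1 - A\<^sub>1 * e r \<Longrightarrow> c r * (B\<^sub>1 - A\<^sub>1 * e r) powr p \<le> f B\<^sub>1 r"
    using large_shift_lower[OF assms(2) f_cont c_cont e_cont c_pos e_pos eR B0(1) p0 sub] by blast
  define U where "U = barrier R \<beta> A\<^sub>2 B\<^sub>2"
  define V where "V = barrier R \<beta> (- A\<^sub>1) B\<^sub>1"
  have e_inv: "(R\<^sup>2 - r\<^sup>2) powr (- \<beta>) = 1 / e r" for r by (simp add: e_def powr_minus_divide)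
  have U_pos: "0 < U r" if "0 \<le> r" "r < R" for r
    using A1 A2 B0 e_pos[OF that] by (simp add: U_def barrier_def e_inv add_nonneg_pos)
  have U_cont: "continuous_on {0..<R} U" unfolding U_def barrier_def
    using square_diff_pos by (intro continuous_intros) fastforce
  define h where "h t = a t * (R - t) powr (\<gamma> - \<alpha>)" for t
  define H where "H t y = h t * (min (max y 0) (U t)) powr p" for t y
  have h_pos: "0 < h t" if "0 \<le> t" "t < R" for t using a(2)[of t] that by (simp add: h_def)
  have h_cont: "continuous_on {0..<R} h" unfolding h_def
    by (intro continuous_intros continuous_on_subset[OF a(1)]) auto
  interpret radial_cauchy R "ball_weight N \<alpha> R" H
  proof
    show "continuous_on {0..<R} (\<lambda>t. H t (y t))" if "continuous_on {0..<R} y" for y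
      unfolding H_def using U_pos p0
      by (intro continuous_intros continuous_on_powr' h_cont U_cont that) (auto intro!: less_imp_le)
    fix b assume b: "b < R"
    show "\<exists>\<Lambda>>0. \<forall>t\<in>{0..b}. \<forall>y z. \<bar>H t y - H t z\<bar> \<le> \<Lambda> * \<bar>y - z\<bar>"
    proof (cases "0 \<le> b")
      case True
      have cont: "continuous_on {0..b} h" "continuous_on {0..b} U"
        using b by (auto intro: continuous_on_subset[OF h_cont] continuous_on_subset[OF U_cont])
      obtain th where th: "th \<in> {0..b}" "\<And>t. t \<in> {0..b} \<Longrightarrow> h t \<le> h th"
        using continuous_attains_sup[of "{0..b}" h] cont True by auto
      obtain tu where tu: "tu \<in> {0..b}" "\<And>t. t \<in> {0..b} \<Longrightarrow> U t \<le> U tu"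
        using continuous_attains_sup[of "{0..b}" U] cont True by auto
      show ?thesis
      proof (intro exI[of _ "h th * (p * U tu powr (p - 1))"] conjI ballI allI)
        show "0 < h th * (p * U tu powr (p - 1))"
          using h_pos[of th] U_pos[of tu] th tu b p0 by auto
        fix t y z assume t: "t \<in> {0..b}"
        have hU: "0 < h t" "0 < U t" using h_pos[of t] U_pos[of t] t b by auto
        let ?y = "min (max y 0) (U t)" and ?z = "min (max z 0) (U t)"
        have "\<bar>?y powr p - ?z powr p\<bar> \<le> p * U tu powr (p - 1) * \<bar>?y - ?z\<bar>"
          by (rule powr_Lipschitz) (use hU tu(2)[OF t] assms(1) in auto)
        also have "\<dots> \<le> p * U tu powr (p - 1) * \<bar>y - z\<bar>"
          using p0 by (intro mult_left_mono) auto
        finally have 1: "\<bar>?y powr p - ?z powr p\<bar> \<le> p * U tu powr (p - 1) * \<bar>y - z\<bar>" .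
        have "\<bar>H t y - H t z\<bar> = h t * \<bar>?y powr p - ?z powr p\<bar>"
          using hU by (simp add: H_def right_diff_distrib[symmetric] abs_mult)
        also have "\<dots> \<le> h th * (p * U tu powr (p - 1) * \<bar>y - z\<bar>)"
          using 1 hU th(2)[OF t] by (intro mult_mono) auto
        finally show "\<bar>H t y - H t z\<bar> \<le> h th * (p * U tu powr (p - 1)) * \<bar>y - z\<bar>"
          by (simp add: mult_ac)
      qed
    qed (auto intro!: exI[of _ 1])
  qed
  have balance: "h t * barrier R \<beta> A B t powr p
      = (R\<^sup>2 - t\<^sup>2) powr (- \<beta> - 2) * (c t * (A * e t + B) powr p)"
    if "0 \<le> t" "t < R" "0 \<le> A * e t + B" for t A B
    using barrier_powr[OF that(1,2) assms(1) \<beta>(1), of A B] that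
    by (simp add: h_def c_def e_def mult_ac)
  have V_le_U: "V t \<le> U t" if "0 \<le> t" "t < R" for t
    using A1(1) A2(1) mult_right_mono[OF B0(3), of "(R\<^sup>2 - t\<^sup>2) powr (- \<beta>)"]
    by (simp add: U_def V_def barrier_def)
  have V_pos_iff: "0 < B\<^sub>1 - A\<^sub>1 * e t" if "0 \<le> t" "t < R" "0 < V t" for t
    using that e_pos[OF that(1,2)] by (simp add: V_def barrier_def e_inv field_simps)
  have "\<exists>r\<ge>0. r < R \<and> 0 < V r"
  proof -
    have "((\<lambda>r. V r / (K * (R - r) powr (- \<beta>))) \<longlongrightarrow> \<kappa>\<^sub>1) (at_left R)"
      unfolding V_def by (rule barrier_asymptotics[OF assms(2) \<beta>0 K0 B\<^sub>1_def])
    then have "\<forall>\<^sub>F r in at_left R. 0 < V r / (K * (R - r) powr (- \<beta>))"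
      using \<kappa>(1) by (rule order_tendstoD)
    then have "\<forall>\<^sub>F r in at_left R. 0 < V r \<and> r \<in> {0<..<R}"
      using eventually_at_left_real[OF assms(2)]
    proof eventually_elim
      case (elim r)
      then show ?case using K0 by (simp add: zero_less_divide_iff zero_less_mult_iff mult_less_0_iff)
    qed
    then obtain r where "0 < V r \<and> r \<in> {0<..<R}" using eventually_happens'[OF trivial_limit_at_left_real] by blast
    then show ?thesis by (intro exI[of _ r]) auto
  qed
  then obtain \<rho> where \<rho>: "0 \<le> \<rho>" "\<rho> < R" "0 < V \<rho>" by auto
  have "\<exists>m y. m > 0 \<and> solves m y \<and> (\<forall>r. 0 \<le> r \<longrightarrow> r < R \<longrightarrow> V r \<le> y r \<and> y r \<le> U r)"
  proof (rule shooting[where U = U and B = V and \<rho> = \<rho>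
      and u = "\<lambda>t. ball_weight N \<alpha> R t * (2 * \<beta> * B\<^sub>2 * (R\<^sup>2 - t\<^sup>2) powr (- \<beta> - 2) * barrier_factor N R \<alpha> \<beta> t)"
      and b = "\<lambda>t. ball_weight N \<alpha> R t * (2 * \<beta> * B\<^sub>1 * (R\<^sup>2 - t\<^sup>2) powr (- \<beta> - 2) * barrier_factor N R \<alpha> \<beta> t)"])
    show "0 \<le> \<rho>" "\<rho> < R" "0 < V \<rho>" by (rule \<rho>)+
    show "V t \<le> U t" if "0 \<le> t" "t < R" for t by (rule V_le_U[OF that])
    show H_nonneg: "0 \<le> H t y" if "0 \<le> t" "t < R" for t y using h_pos[OF that] by (simp add: H_def)
    show "H t y \<le> H t z" if "0 \<le> t" "t < R" "y \<le> z" for t y z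
      unfolding H_def using h_pos[OF that(1,2)] U_pos[OF that(1,2)] that p0
      by (intro mult_left_mono powr_mono2) auto
    show "H t 0 = 0" if "0 \<le> t" "t < R" for t using U_pos[OF that] p0 by (simp add: H_def)
    show "has_flux_derivative U (\<lambda>t. ball_weight N \<alpha> R t *
      (2 * \<beta> * B\<^sub>2 * (R\<^sup>2 - t\<^sup>2) powr (- \<beta> - 2) * barrier_factor N R \<alpha> \<beta> t))"
      unfolding U_def by (rule barrier_has_flux_derivative[OF assms(2,4)])
    show "has_flux_derivative V (\<lambda>t. ball_weight N \<alpha> R t *
      (2 * \<beta> * B\<^sub>1 * (R\<^sup>2 - t\<^sup>2) powr (- \<beta> - 2) * barrier_factor N R \<alpha> \<beta> t))"
      unfolding V_def by (rule barrier_has_flux_derivative[OF assms(2,4)])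
    show "0 \<le> U 0" using U_pos[of 0] assms(2) by simp
    fix t assume t: "0 < t" "t < R"
    have q: "0 \<le> ball_weight N \<alpha> R t" using ball_weight_pos[OF t] by (rule less_imp_le)
    have P: "2 * \<beta> * B * (R\<^sup>2 - t\<^sup>2) powr (- \<beta> - 2) * barrier_factor N R \<alpha> \<beta> t
      = (R\<^sup>2 - t\<^sup>2) powr (- \<beta> - 2) * f B t" for B by (simp add: f_def mult_ac)
    have "H t (U t) = h t * U t powr p" using U_pos[of t] t by (simp add: H_def)
    also have "\<dots> = (R\<^sup>2 - t\<^sup>2) powr (- \<beta> - 2) * (c t * (A\<^sub>2 * e t + B\<^sub>2) powr p)"
      unfolding U_def using t A2(1) B0 e_pos[of t] by (intro balance) (auto intro!: add_nonneg_nonneg)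
    also have "\<dots> \<ge> (R\<^sup>2 - t\<^sup>2) powr (- \<beta> - 2) * f B\<^sub>2 t"
      using A2(2)[of t] t by (intro mult_left_mono) auto
    finally show "ball_weight N \<alpha> R t *
        (2 * \<beta> * B\<^sub>2 * (R\<^sup>2 - t\<^sup>2) powr (- \<beta> - 2) * barrier_factor N R \<alpha> \<beta> t)
        \<le> ball_weight N \<alpha> R t * H t (U t)" unfolding P using q by (intro mult_left_mono)
    assume V: "0 < V t"
    have pos: "0 < B\<^sub>1 - A\<^sub>1 * e t" using V_pos_iff[of t] V t by auto
    have "H t (V t) = h t * V t powr p" using V V_le_U[of t] t by (simp add: H_def)
    also have "\<dots> = (R\<^sup>2 - t\<^sup>2) powr (- \<beta> - 2) * (c t * (- A\<^sub>1 * e t + B\<^sub>1) powr p)"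
      unfolding V_def using t pos by (intro balance) auto
    also have "\<dots> \<le> (R\<^sup>2 - t\<^sup>2) powr (- \<beta> - 2) * f B\<^sub>1 t"
      using A1(2)[of t] t pos by (intro mult_left_mono) auto
    finally show "ball_weight N \<alpha> R t * H t (V t) \<le> ball_weight N \<alpha> R t *
        (2 * \<beta> * B\<^sub>1 * (R\<^sup>2 - t\<^sup>2) powr (- \<beta> - 2) * barrier_factor N R \<alpha> \<beta> t)"
      unfolding P using q by (intro mult_left_mono)
  qed
  then obtain m y where y: "m > 0" "solves m y" "\<And>r. 0 \<le> r \<Longrightarrow> r < R \<Longrightarrow> V r \<le> y r \<and> y r \<le> U r"
    by blast
  have y_pos: "0 < y r" if "0 \<le> r" "r < R" for r
    using solves_ge_initial[OF y(2), of r] h_pos y(1) that by (force simp: H_def)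
  have Hy: "H t (y t) = a t * (R - t) powr (\<gamma> - \<alpha>) * y t powr p" if "0 \<le> t" "t < R" for t
    using y_pos[OF that] y(3)[OF that] by (simp add: H_def h_def)
  have slope_eq: "slope (\<lambda>t. H t (y t)) r
      = slope (\<lambda>t. a t * (R - t) powr (\<gamma> - \<alpha>) * y t powr p) r" if "0 \<le> r" "r < R" for r
  proof -
    have "flux (\<lambda>t. H t (y t)) r = flux (\<lambda>t. a t * (R - t) powr (\<gamma> - \<alpha>) * y t powr p) r"
      unfolding flux_def
      by (rule Henstock_Kurzweil_Integration.integral_cong) (use Hy that in auto)
    then show ?thesis by (simp add: slope_def)
  qed
  show thesis
  proof (rule that)
    show "continuous_on {0..<R} y" using y(2) by (simp add: solves_def)
    fix r assume r: "0 \<le> r" "r < R"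
    show "0 < y r" by (rule y_pos[OF r])
    show "barrier R \<beta> (- A\<^sub>1) (\<kappa>\<^sub>1 * K * (2 * R) powr \<beta>) r \<le> y r"
      "y r \<le> barrier R \<beta> A\<^sub>2 (\<kappa>\<^sub>2 * K * (2 * R) powr \<beta>) r"
      using y(3)[OF r] by (simp_all add: U_def V_def B\<^sub>1_def B\<^sub>2_def)
    show "(y has_real_derivative slope (\<lambda>t. a t * (R - t) powr (\<gamma> - \<alpha>) * y t powr p) r)
      (at r within {0..<R})"
      using solves_has_derivative[OF y(2), of r] r slope_eq[OF r] by simp
  qed
qed

section \<open>Integration by parts against test functions\<close>

lemma directional_derivative_of_has_derivative:
  fixes f :: "'a::real_normed_vector \<Rightarrow> real"
  assumes "(f has_derivative f') (at x)"
  shows "((\<lambda>t. f (x + t *\<^sub>R b)) has_real_derivative f' b) (at 0)"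
proof -
  have "((\<lambda>t. x + t *\<^sub>R b) has_derivative (\<lambda>t. t *\<^sub>R b)) (at 0)"
    by (auto intro!: derivative_eq_intros)
  then have "((\<lambda>t. f (x + t *\<^sub>R b)) has_derivative (\<lambda>t. f' (t *\<^sub>R b))) (at 0)"
    using assms by (intro has_derivative_compose[where f = "\<lambda>t. x + t *\<^sub>R b" and g = f]) auto
  moreover have "f' (t *\<^sub>R b) = f' b * t" for t
    using has_derivative_linear[OF assms] by (simp add: linear_cmul)
  ultimately show ?thesis by (simp add: has_field_derivative_def)
qed

text \<open>The line through \<open>x\<close> in direction \<open>b\<close> meets the exceptional point \<open>c\<close> at most once, and the
fundamental theorem of calculus tolerates finitely many exceptions for continuous functions.\<close>

lemma Lipschitz_along_line:
  fixes F :: "'a::real_normed_vector \<Rightarrow> real"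
  assumes F: "continuous_on UNIV F" and b: "b \<noteq> 0" and t: "0 \<le> t" and M: "0 \<le> M"
    and D: "\<And>x. x \<noteq> c \<Longrightarrow> ((\<lambda>t. F (x + t *\<^sub>R b)) has_real_derivative D x) (at 0)"
    and bound: "\<And>x. x \<noteq> c \<Longrightarrow> \<bar>D x\<bar> \<le> M"
  shows "\<bar>F (x + t *\<^sub>R b) - F x\<bar> \<le> M * t"
proof -
  define g where "g s = F (x + s *\<^sub>R b)" for s
  define E where "E = {s. x + s *\<^sub>R b = c}"
  have E: "finite E"
  proof (cases "E = {}")
    case False
    then obtain s where s: "x + s *\<^sub>R b = c" by (auto simp: E_def)
    have "E \<subseteq> {s}" using s b by (auto simp: E_def)
    then show ?thesis by (rule finite_subset) simp
  qed simp
  have "continuous_on {0..t} g" unfolding g_def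
    by (intro continuous_on_compose2[OF F] continuous_intros) auto
  moreover have "(g has_vector_derivative D (x + s *\<^sub>R b)) (at s)" if "s \<notin> E" for s
  proof -
    have "((\<lambda>h. F ((x + s *\<^sub>R b) + h *\<^sub>R b)) has_real_derivative D (x + s *\<^sub>R b)) (at 0)"
      using that by (intro D) (auto simp: E_def)
    then have "((\<lambda>h. g (h + s)) has_real_derivative D (x + s *\<^sub>R b)) (at 0)"
      by (simp add: g_def algebra_simps)
    then show ?thesis
      by (simp add: DERIV_shift[symmetric] flip: has_real_derivative_iff_has_vector_derivative)
  qed
  ultimately have "((\<lambda>s. D (x + s *\<^sub>R b)) has_integral g t - g 0) {0..t}"
    using t E by (intro fundamental_theorem_of_calculus_strong[where S = E])
      (auto intro: has_vector_derivative_at_within)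
  then have "norm (g t - g 0) \<le> M * measure lborel (cbox 0 t)"
    using E M by (intro has_integral_bound_spike_finite[where S = E]) (auto simp: E_def intro!: bound)
  then show ?thesis using t by (simp add: g_def)
qed

text \<open>The difference quotients \<open>(F (x + h *\<^sub>R b) - F x) / h\<close> have integral 0 by translation invariance.
They are bounded by \<open>M\<close>, vanish outside a fixed ball for \<open>h \<le> 1\<close>, and converge to \<open>D\<close> off the null
set \<open>{c}\<close>, so dominated convergence applies.\<close>

lemma integral_directional_derivative_eq_0:
  fixes F :: "'a::euclidean_space \<Rightarrow> real"
  assumes F: "continuous_on UNIV F" and S: "bounded S" "\<And>x. x \<notin> S \<Longrightarrow> F x = 0"
    and b: "b \<noteq> 0"
    and D: "\<And>x. x \<noteq> c \<Longrightarrow> ((\<lambda>t. F (x + t *\<^sub>R b)) has_real_derivative D x) (at 0)"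
    and bound: "\<And>x. x \<noteq> c \<Longrightarrow> \<bar>D x\<bar> \<le> M"
  shows "integrable lebesgue D" "(LINT x|lebesgue. D x) = 0"
proof -
  define h :: "nat \<Rightarrow> real" where "h n = inverse (real (Suc n))" for n
  have h: "h n > 0" "h n \<le> 1" for n by (auto simp: h_def inverse_le_1_iff)
  have h_lim: "(\<lambda>n. h n) \<longlonglongrightarrow> 0" unfolding h_def by (rule LIMSEQ_inverse_real_of_nat)
  define Q where "Q n x = (F (x + h n *\<^sub>R b) - F x) / h n" for n x
  have F_meas [measurable]: "F \<in> borel_measurable borel"
    using F by (rule borel_measurable_continuous_onI)
  have Q_meas [measurable]: "Q n \<in> borel_measurable borel" for n unfolding Q_def by measurable
  have Q_lim: "(\<lambda>n. Q n x) \<longlonglongrightarrow> D x" if "x \<noteq> c" for x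
  proof -
    have "((\<lambda>t. (F (x + t *\<^sub>R b) - F x) / t) \<longlongrightarrow> D x) (at 0)"
      using D[OF that] by (simp add: DERIV_def)
    moreover have "filterlim h (at 0) sequentially"
      using h(1) h_lim by (auto simp: filterlim_at less_imp_neq[THEN not_sym])
    ultimately show ?thesis unfolding Q_def by (rule filterlim_compose)
  qed
  have D_meas: "D \<in> borel_measurable borel"
  proof (rule borel_measurable_LIMSEQ_real)
    show "(\<lambda>n. if x = c then D c else Q n x) \<longlonglongrightarrow> D x" for x
      using Q_lim[of x] by (cases "x = c") auto
    show "(\<lambda>x. if x = c then D c else Q n x) \<in> borel_measurable borel" for n by measurable
  qed
  obtain r where r: "\<And>x. x \<in> S \<Longrightarrow> norm x \<le> r" using S(1) unfolding bounded_iff by blast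
  define T where "T = cball (0::'a) (r + norm b)"
  have T: "F x = 0" "F (x + h n *\<^sub>R b) = 0" if "x \<notin> T" for x n
  proof -
    have nx: "norm x > r + norm b" using that by (simp add: T_def)
    then show "F x = 0" using S(2)[of x] r[of x] norm_ge_zero[of b] by force
    have "norm x \<le> norm (x + h n *\<^sub>R b) + norm (h n *\<^sub>R b)"
      using norm_triangle_ineq4[of "x + h n *\<^sub>R b" "h n *\<^sub>R b"] by simp
    moreover have "norm (h n *\<^sub>R b) \<le> norm b" using h[of n] by (simp add: mult_left_le_one_le)
    ultimately have "norm (x + h n *\<^sub>R b) > r" using nx by simp
    then show "F (x + h n *\<^sub>R b) = 0" using S(2) r by force
  qed
  obtain x0 :: 'a where "x0 \<noteq> c" using b by (metis add_cancel_right_right)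
  then have M: "0 \<le> M" using bound[of x0] by linarith
  have Q_bound: "norm (Q n x) \<le> M * indicator T x" for n x
  proof (cases "x \<in> T")
    case True
    have "\<bar>F (x + h n *\<^sub>R b) - F x\<bar> \<le> M * h n"
      by (rule Lipschitz_along_line[OF F b _ M D bound]) (use h[of n] in auto)
    then show ?thesis using True h[of n] by (simp add: Q_def divide_le_eq)
  qed (use T in \<open>simp add: Q_def\<close>)
  have ind: "integrable lborel (\<lambda>x. M * indicator T x)"
    unfolding T_def by (intro integrable_mult_right integrable_real_indicator)
      (use emeasure_bounded_finite[of "cball (0::'a) (r + norm b)"] in auto)
  have AEc: "AE x in lborel. x \<noteq> c" by (rule AE_lborel_singleton)
  have 1: "D \<in> borel_measurable lborel" "\<And>n. Q n \<in> borel_measurable lborel"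
    using D_meas Q_meas by auto
  have 2: "AE x in lborel. (\<lambda>n. Q n x) \<longlonglongrightarrow> D x" using AEc by eventually_elim (rule Q_lim)
  have 3: "\<And>n. AE x in lborel. norm (Q n x) \<le> M * indicator T x" using Q_bound by simp
  have int: "integrable lborel D" by (rule integrable_dominated_convergence[OF 1 ind 2 3])
  have lim: "(\<lambda>n. LINT x|lborel. Q n x) \<longlonglongrightarrow> (LINT x|lborel. D x)"
    by (rule integral_dominated_convergence[OF 1 ind 2 3])
  have F_int: "integrable lborel F"
  proof -
    have "integrable lborel (\<lambda>x. indicator T x *\<^sub>R F x)"
      unfolding T_def by (rule borel_integrable_compact) (auto intro: continuous_on_subset[OF F])
    moreover have "(\<lambda>x. indicator T x *\<^sub>R F x) = F"
      by (rule ext) (use T(1) in \<open>auto simp: indicator_def\<close>)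
    ultimately show ?thesis by simp
  qed
  have shift: "integrable lborel (\<lambda>x. F (v + x))" "(LINT x|lborel. F (v + x)) = (LINT x|lborel. F x)" for v
  proof -
    have "integrable (distr lborel borel ((+) v)) F" using F_int by (simp add: lborel_distr_plus)
    then show "integrable lborel (\<lambda>x. F (v + x))" by (subst (asm) integrable_distr_eq) auto
    have "(LINT x|distr lborel borel ((+) v). F x) = (LINT x|lborel. F (v + x))"
      by (rule integral_distr) auto
    then show "(LINT x|lborel. F (v + x)) = (LINT x|lborel. F x)" by (simp add: lborel_distr_plus)
  qed
  have "(LINT x|lborel. Q n x) = 0" for n
    unfolding Q_def add.commute[of _ "h n *\<^sub>R b"] by (simp add: shift F_int)
  then have "(\<lambda>n. LINT x|lborel. Q n x) \<longlonglongrightarrow> 0" by simp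
  then have "(LINT x|lborel. D x) = 0" by (rule LIMSEQ_unique[OF lim])
  then show "(LINT x|lebesgue. D x) = 0" using D_meas by (simp add: integral_completion)
  show "integrable lebesgue D" using int D_meas by (simp add: integrable_completion)
qed

lemma continuous_extension_by_zero:
  fixes g :: "'a::topological_space \<Rightarrow> real"
  assumes "open U" "closed C" "C \<subseteq> U" "continuous_on U g" "\<And>x. x \<in> U - C \<Longrightarrow> g x = 0"
  shows "continuous_on UNIV (\<lambda>x. if x \<in> U then g x else 0)"
proof -
  have "continuous_on U (\<lambda>x. if x \<in> U then g x else 0)"
    using assms(4) by (rule continuous_on_eq) auto
  moreover have "continuous_on (- C) (\<lambda>x. if x \<in> U then g x else 0)"
    by (rule continuous_on_eq[of _ "\<lambda>_. 0"]) (use assms(5) in auto)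
  ultimately have "continuous_on (U \<union> - C) (\<lambda>x. if x \<in> U then g x else 0)"
    using assms(1,2) by (intro continuous_on_open_Un) auto
  moreover have "U \<union> - C = UNIV" using assms(3) by auto
  ultimately show ?thesis by simp
qed

lemma compact_support_bounded:
  fixes g :: "'a::topological_space \<Rightarrow> real"
  assumes "continuous_on UNIV g" "compact C" "\<And>x. x \<notin> C \<Longrightarrow> g x = 0"
  obtains M where "\<And>x. \<bar>g x\<bar> \<le> M"
proof -
  have "compact (g ` C)"
    using assms by (intro compact_continuous_image) (auto elim: continuous_on_subset)
  then obtain M where M: "\<And>x. x \<in> C \<Longrightarrow> \<bar>g x\<bar> \<le> M"
    by (meson bounded_real compact_imp_bounded imageI)
  have "\<bar>g x\<bar> \<le> max M 0" for x using M[of x] assms(3)[of x] by (cases "x \<in> C") auto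
  then show thesis by (rule that)
qed

lemma test_function_facts:
  fixes \<phi> :: "'a::euclidean_space \<Rightarrow> real"
  assumes "\<phi> \<in> test_functions U"
  shows "continuous_on UNIV \<phi>" "(\<phi> has_derivative frechet_derivative \<phi> (at x)) (at x)"
    "b \<in> Basis \<Longrightarrow> continuous_on UNIV (\<lambda>x. frechet_derivative \<phi> (at x) b)"
    "compact (closure {x. \<phi> x \<noteq> 0})" "closure {x. \<phi> x \<noteq> 0} \<subseteq> U"
    "x \<notin> closure {x. \<phi> x \<noteq> 0} \<Longrightarrow> \<phi> x = 0"
    "x \<notin> closure {x. \<phi> x \<noteq> 0} \<Longrightarrow> frechet_derivative \<phi> (at x) b = 0"
proof -
  have Ck: "Ck 0 \<phi>" "Ck (Suc 0) \<phi>" and supp: "compact (closure {x. \<phi> x \<noteq> 0})" "closure {x. \<phi> x \<noteq> 0} \<subseteq> U"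
    using assms by (auto simp only: test_functions_def mem_Collect_eq)
  show "continuous_on UNIV \<phi>" using Ck(1) by simp
  show "(\<phi> has_derivative frechet_derivative \<phi> (at x)) (at x)"
    using Ck(2) by (auto simp: differentiable_on_def frechet_derivative_works)
  show "b \<in> Basis \<Longrightarrow> continuous_on UNIV (\<lambda>x. frechet_derivative \<phi> (at x) b)" using Ck(2) by simp
  show "compact (closure {x. \<phi> x \<noteq> 0})" "closure {x. \<phi> x \<noteq> 0} \<subseteq> U" by (rule supp)+
  show "x \<notin> closure {x. \<phi> x \<noteq> 0} \<Longrightarrow> \<phi> x = 0" using closure_subset[of "{x. \<phi> x \<noteq> 0}"] by auto
  assume x: "x \<notin> closure {x. \<phi> x \<noteq> 0}"
  have "(\<phi> has_derivative (\<lambda>_. 0)) (at x)"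
  proof (rule has_derivative_transform_within_open)
    show "((\<lambda>_. 0) has_derivative (\<lambda>_. 0)) (at x)" by simp
    show "open (- closure {x. \<phi> x \<noteq> 0})" by auto
    show "\<And>y. y \<in> - closure {x. \<phi> x \<noteq> 0} \<Longrightarrow> 0 = \<phi> y" using closure_subset[of "{x. \<phi> x \<noteq> 0}"] by auto
  qed (use x in auto)
  then show "frechet_derivative \<phi> (at x) b = 0" by (simp flip: frechet_derivative_at)
qed

lemma integrable_of_bounded:
  fixes f :: "'a::euclidean_space \<Rightarrow> 'b::{banach, second_countable_topology}"
  assumes "S \<in> lmeasurable" "f \<in> borel_measurable (lebesgue_on S)" "\<And>x. x \<in> S \<Longrightarrow> norm (f x) \<le> B"
  shows "integrable (lebesgue_on S) f"
proof -
  interpret finite_measure "lebesgue_on S" using assms(1) by (rule finite_measure_lebesgue_on)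
  show ?thesis by (rule integrable_const_bound[of _ B]) (use assms in \<open>auto intro!: AE_I2\<close>)
qed

text \<open>This is \<open>integral_directional_derivative_eq_0\<close> for the product \<open>v * \<phi>\<close>, extended by 0 outside \<open>U\<close>.
Allowing an exceptional point \<open>c\<close> means that radial functions need not be differentiated at the
centre.\<close>

lemma integration_by_parts_test_function:
  fixes v v' :: "'a::euclidean_space \<Rightarrow> real"
  assumes U: "open U" "U \<in> lmeasurable" and \<phi>: "\<phi> \<in> test_functions U" and b: "b \<in> Basis"
    and v: "continuous_on U v"
    and v': "\<And>x. x \<in> U \<Longrightarrow> x \<noteq> c \<Longrightarrow> ((\<lambda>t. v (x + t *\<^sub>R b)) has_real_derivative v' x) (at 0)"
    and M: "\<And>x. x \<in> U \<Longrightarrow> x \<noteq> c \<Longrightarrow> \<bar>v' x\<bar> \<le> M"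
  shows "integrable (lebesgue_on U) (\<lambda>x. v x * frechet_derivative \<phi> (at x) b)"
    "integrable (lebesgue_on U) (\<lambda>x. \<phi> x * v' x)"
    "(LINT x|lebesgue_on U. v x * frechet_derivative \<phi> (at x) b) = - (LINT x|lebesgue_on U. \<phi> x * v' x)"
proof -
  note \<phi>_facts = test_function_facts[OF \<phi>]
  define C where "C = closure {x. \<phi> x \<noteq> 0}"
  have C: "compact C" "closed C" "C \<subseteq> U" "\<And>x. x \<notin> C \<Longrightarrow> \<phi> x = 0"
    "\<And>x. x \<notin> C \<Longrightarrow> frechet_derivative \<phi> (at x) b = 0"
    unfolding C_def by (rule \<phi>_facts(4) closed_closure \<phi>_facts(5); assumption?)+
      (rule \<phi>_facts(6,7); assumption)+
  define F where "F x = (if x \<in> U then v x * \<phi> x else 0)" for x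
  define G where "G x = (if x \<in> U then v x * frechet_derivative \<phi> (at x) b else 0)" for x
  define D where "D x = (if x \<in> U then v' x * \<phi> x + v x * frechet_derivative \<phi> (at x) b else 0)" for x
  have F: "continuous_on UNIV F" unfolding F_def
    by (rule continuous_extension_by_zero[OF U(1) C(2,3)])
      (use v C(4) continuous_on_subset[OF \<phi>_facts(1)] in \<open>auto intro!: continuous_intros\<close>)
  have G: "continuous_on UNIV G" unfolding G_def
    by (rule continuous_extension_by_zero[OF U(1) C(2,3)])
      (use v C(5) continuous_on_subset[OF \<phi>_facts(3)[OF b]] in \<open>auto intro!: continuous_intros\<close>)
  obtain M\<phi> where M\<phi>: "\<And>x. \<bar>\<phi> x\<bar> \<le> M\<phi>" using compact_support_bounded[OF \<phi>_facts(1) C(1,4)] by blast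
  have "G x = 0" if "x \<notin> C" for x using that C(5) by (simp add: G_def)
  then obtain MG where MG: "\<And>x. \<bar>G x\<bar> \<le> MG" using compact_support_bounded[OF G C(1)] by blast
  have D_deriv: "((\<lambda>t. F (x + t *\<^sub>R b)) has_real_derivative D x) (at 0)" if "x \<noteq> c" for x
  proof (cases "x \<in> U")
    case True
    have cont: "continuous_on UNIV (\<lambda>t::real. x + t *\<^sub>R b)" by (intro continuous_intros)
    have "((\<lambda>t. v (x + t *\<^sub>R b) * \<phi> (x + t *\<^sub>R b)) has_real_derivative
        v' x * \<phi> (x + 0 *\<^sub>R b) + frechet_derivative \<phi> (at x) b * v (x + 0 *\<^sub>R b)) (at 0)"
      by (intro DERIV_mult v' True that directional_derivative_of_has_derivative \<phi>_facts(2))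
    then show ?thesis
    proof (rule DERIV_cong[OF has_field_derivative_transform_within_open])
      show "open ((\<lambda>t::real. x + t *\<^sub>R b) -` U)" using U(1) cont by (rule open_vimage)
      show "0 \<in> (\<lambda>t::real. x + t *\<^sub>R b) -` U" using True by simp
    qed (use True in \<open>auto simp: F_def D_def\<close>)
  next
    case False
    then have "x \<in> - C" using C(3) by auto
    have cont: "continuous_on UNIV (\<lambda>t::real. x + t *\<^sub>R b)" by (intro continuous_intros)
    have "((\<lambda>t::real. 0::real) has_real_derivative 0) (at 0)" by simp
    then have "((\<lambda>t. F (x + t *\<^sub>R b)) has_real_derivative 0) (at 0)"
    proof (rule has_field_derivative_transform_within_open)
      show "open ((\<lambda>t::real. x + t *\<^sub>R b) -` (- C))" using C(2) cont by (intro open_vimage) auto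
      show "0 \<in> (\<lambda>t::real. x + t *\<^sub>R b) -` (- C)" using \<open>x \<in> - C\<close> by simp
    qed (use C(4) in \<open>auto simp: F_def\<close>)
    then show ?thesis using False by (simp add: D_def)
  qed
  have D_bound: "\<bar>D x\<bar> \<le> \<bar>M\<bar> * M\<phi> + MG" if "x \<noteq> c" for x
  proof (cases "x \<in> U")
    case True
    have "\<bar>v' x * \<phi> x\<bar> \<le> \<bar>M\<bar> * M\<phi>"
      using M[OF True that] M\<phi>[of x] unfolding abs_mult by (intro mult_mono) auto
    then show ?thesis using True MG[of x] by (simp add: D_def G_def)
  next
    case False
    have "0 \<le> M\<phi>" "0 \<le> MG" using M\<phi>[of x] MG[of x] by auto
    then show ?thesis using False by (simp add: D_def)
  qed
  have Fsupp: "F x = 0" if "x \<notin> C" for x using that C(4) by (simp add: F_def)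
  have b0: "b \<noteq> 0" using b by auto
  note D_int = integral_directional_derivative_eq_0[OF F compact_imp_bounded[OF C(1)] Fsupp b0 D_deriv D_bound]
  have Um: "U \<inter> space lebesgue \<in> sets lebesgue" using U(2) by (simp add: fmeasurableD)
  have eqD: "indicator U x *\<^sub>R (v' x * \<phi> x + v x * frechet_derivative \<phi> (at x) b) = D x" for x
    by (simp add: D_def indicator_def)
  have D_on: "integrable (lebesgue_on U) (\<lambda>x. v' x * \<phi> x + v x * frechet_derivative \<phi> (at x) b)"
    "(LINT x|lebesgue_on U. v' x * \<phi> x + v x * frechet_derivative \<phi> (at x) b) = 0"
    using D_int by (simp_all add: integrable_restrict_space[OF Um] integral_restrict_space[OF Um] eqD del: real_scaleR_def)
  show G_on: "integrable (lebesgue_on U) (\<lambda>x. v x * frechet_derivative \<phi> (at x) b)"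
  proof (rule integrable_of_bounded[OF U(2)])
    have "G \<in> borel_measurable (lebesgue_on U)"
      by (rule continuous_imp_measurable_on_sets_lebesgue[OF continuous_on_subset[OF G]])
        (use U(2) in \<open>auto simp: fmeasurableD\<close>)
    then show "(\<lambda>x. v x * frechet_derivative \<phi> (at x) b) \<in> borel_measurable (lebesgue_on U)"
      by (rule measurable_cong[THEN iffD1, rotated]) (simp add: G_def)
    show "norm (v x * frechet_derivative \<phi> (at x) b) \<le> MG" if "x \<in> U" for x
      using MG[of x] that by (simp add: G_def)
  qed
  have eq: "\<phi> x * v' x = (v' x * \<phi> x + v x * frechet_derivative \<phi> (at x) b)
      - v x * frechet_derivative \<phi> (at x) b" for x by simp
  show "integrable (lebesgue_on U) (\<lambda>x. \<phi> x * v' x)"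
    unfolding eq by (rule Bochner_Integration.integrable_diff[OF D_on(1) G_on])
  show "(LINT x|lebesgue_on U. v x * frechet_derivative \<phi> (at x) b) = - (LINT x|lebesgue_on U. \<phi> x * v' x)"
    unfolding eq by (subst Bochner_Integration.integral_diff[OF D_on(1) G_on]) (simp add: D_on(2))
qed

section \<open>Passage to the limit in the weighted space\<close>

lemma L2w_of_bounded:
  fixes f :: "'a::euclidean_space \<Rightarrow> 'b::euclidean_space"
  assumes "S \<in> lmeasurable" "f \<in> borel_measurable (lebesgue_on S)" "\<And>x. x \<in> S \<Longrightarrow> norm (f x) \<le> B"
    and "w \<in> borel_measurable (lebesgue_on S)" "\<And>x. x \<in> S \<Longrightarrow> \<bar>w x\<bar> \<le> W"
  shows "f \<in> L2w S w"
proof -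
  have "integrable (lebesgue_on S) (\<lambda>x. (norm (f x))\<^sup>2 * w x)"
  proof (rule integrable_of_bounded[OF assms(1)])
    show "norm ((norm (f x))\<^sup>2 * w x) \<le> B\<^sup>2 * W" if "x \<in> S" for x
      using assms(3,5)[OF that] by (auto simp: abs_mult intro!: mult_mono power_mono)
  qed (use assms in measurable)
  then show ?thesis using assms by (simp add: L2w_def)
qed

text \<open>Since \<open>G\<close> and \<open>w\<close> are bounded, pairing with \<open>G\<close> is continuous on the weighted space. Instead of the
Cauchy-Schwarz inequality for integrals, the pointwise bound
\<open>norm y \<le> (d + (norm y)\<^sup>2 / d) / 2\<close> is integrated with \<open>d\<close> comparable to the norm of the error.\<close>

lemma L2w_limit_integral:
  fixes f G :: "'a::euclidean_space \<Rightarrow> 'b::euclidean_space" and fn :: "nat \<Rightarrow> 'a \<Rightarrow> 'b"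
  assumes S: "S \<in> lmeasurable"
    and w: "w \<in> borel_measurable (lebesgue_on S)" "\<And>x. x \<in> S \<Longrightarrow> 0 \<le> w x" "\<And>x. x \<in> S \<Longrightarrow> w x \<le> W"
    and G: "G \<in> borel_measurable (lebesgue_on S)" "\<And>x. x \<in> S \<Longrightarrow> norm (G x) \<le> M"
    and f: "f \<in> L2w S w" "\<And>n. fn n \<in> L2w S w"
    and lim: "(\<lambda>n. L2w_norm S w (\<lambda>x. fn n x - f x)) \<longlonglongrightarrow> 0"
  shows "(\<lambda>n. LINT x|lebesgue_on S. (G x \<bullet> fn n x) * w x) \<longlonglongrightarrow> (LINT x|lebesgue_on S. (G x \<bullet> f x) * w x)"
proof -
  let ?\<mu> = "lebesgue_on S"
  have w_int: "integrable ?\<mu> w" by (rule integrable_of_bounded[OF S w(1), of W]) (use w in auto)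
  have sq: "\<bar>(G x \<bullet> y) * w x\<bar> \<le> M / 2 * (d * w x + (norm y)\<^sup>2 * w x / d)"
    if "x \<in> S" "d > 0" for x d and y :: 'b
  proof -
    have "0 \<le> (d - norm y)\<^sup>2" by simp
    then have "2 * norm y * d \<le> d * d + (norm y)\<^sup>2" by (simp add: power2_eq_square algebra_simps)
    then have "norm y \<le> (d + (norm y)\<^sup>2 / d) / 2" using that(2) by (simp add: field_simps)
    moreover have "\<bar>G x \<bullet> y\<bar> \<le> M * norm y"
      using Cauchy_Schwarz_ineq2[of "G x" y] mult_right_mono[OF G(2)[OF that(1)], of "norm y"] by simp
    moreover have "0 \<le> M" using G(2)[OF that(1)] norm_ge_zero order_trans by blast
    ultimately have "\<bar>G x \<bullet> y\<bar> \<le> M * ((d + (norm y)\<^sup>2 / d) / 2)"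
      by (meson mult_left_mono order_trans)
    then have "\<bar>G x \<bullet> y\<bar> * w x \<le> M * ((d + (norm y)\<^sup>2 / d) / 2) * w x"
      using w(2)[OF that(1)] by (rule mult_right_mono)
    then show ?thesis using w(2)[OF that(1)] by (simp add: abs_mult algebra_simps add_divide_distrib)
  qed
  have Gf_int: "integrable ?\<mu> (\<lambda>x. (G x \<bullet> g x) * w x)" if g: "g \<in> L2w S w" for g
  proof (rule Bochner_Integration.integrable_bound)
    show "integrable ?\<mu> (\<lambda>x. M / 2 * (1 * w x + (norm (g x))\<^sup>2 * w x / 1))"
      using g w_int by (intro integrable_mult_right Bochner_Integration.integrable_add) (auto simp: L2w_def)
    show "(\<lambda>x. (G x \<bullet> g x) * w x) \<in> borel_measurable ?\<mu>"
      using g G(1) w(1) by (auto simp: L2w_def intro!: borel_measurable_times borel_measurable_inner)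
    show "AE x in ?\<mu>. norm ((G x \<bullet> g x) * w x) \<le> norm (M / 2 * (1 * w x + (norm (g x))\<^sup>2 * w x / 1))"
      using sq[of _ 1] by (intro AE_I2) (force intro: order_trans[OF _ abs_ge_self])
  qed
  have diff_L2: "(\<lambda>x. fn n x - f x) \<in> L2w S w" for n
  proof -
    have m: "fn n \<in> borel_measurable ?\<mu>" "f \<in> borel_measurable ?\<mu>" using f by (auto simp: L2w_def)
    have "integrable ?\<mu> (\<lambda>x. (norm (fn n x - f x))\<^sup>2 * w x)"
    proof (rule Bochner_Integration.integrable_bound)
      show "integrable ?\<mu> (\<lambda>x. 2 * ((norm (fn n x))\<^sup>2 * w x) + 2 * ((norm (f x))\<^sup>2 * w x))"
        using f by (intro integrable_mult_right Bochner_Integration.integrable_add) (auto simp: L2w_def)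
      show "(\<lambda>x. (norm (fn n x - f x))\<^sup>2 * w x) \<in> borel_measurable ?\<mu>" using m w(1) by measurable
      show "AE x in ?\<mu>. norm ((norm (fn n x - f x))\<^sup>2 * w x)
          \<le> norm (2 * ((norm (fn n x))\<^sup>2 * w x) + 2 * ((norm (f x))\<^sup>2 * w x))"
      proof (intro AE_I2)
        fix x assume "x \<in> space ?\<mu>"
        then have w0: "0 \<le> w x" using w(2) by simp
        have "(norm (fn n x - f x))\<^sup>2 \<le> (norm (fn n x) + norm (f x))\<^sup>2"
          by (intro power_mono norm_triangle_ineq4) simp
        also have "\<dots> \<le> 2 * (norm (fn n x))\<^sup>2 + 2 * (norm (f x))\<^sup>2"
          using zero_le_power2[of "norm (fn n x) - norm (f x)"] by (simp add: power2_eq_square algebra_simps)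
        finally have "(norm (fn n x - f x))\<^sup>2 * w x \<le> (2 * (norm (fn n x))\<^sup>2 + 2 * (norm (f x))\<^sup>2) * w x"
          using w0 by (rule mult_right_mono)
        then show "norm ((norm (fn n x - f x))\<^sup>2 * w x)
          \<le> norm (2 * ((norm (fn n x))\<^sup>2 * w x) + 2 * ((norm (f x))\<^sup>2 * w x))"
          using w0 by (simp add: algebra_simps)
      qed
    qed
    then show ?thesis using m by (auto simp: L2w_def)
  qed
  \<comment> \<open>The extra summand keeps \<open>s n\<close> positive, so that one can divide by it.\<close>
  define s where "s n = L2w_norm S w (\<lambda>x. fn n x - f x) + inverse (real (Suc n))" for n
  have J0: "0 \<le> (LINT x|?\<mu>. (norm (fn n x - f x))\<^sup>2 * w x)" for n
    by (rule Bochner_Integration.integral_nonneg_AE) (use w(2) in \<open>auto intro!: AE_I2\<close>)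
  have L0: "0 \<le> L2w_norm S w (\<lambda>x. fn n x - f x)" for n unfolding L2w_norm_def using J0 by simp
  have s: "s n > 0" for n using L0[of n] by (simp add: s_def add_nonneg_pos)
  have J: "(LINT x|?\<mu>. (norm (fn n x - f x))\<^sup>2 * w x) \<le> (s n)\<^sup>2" for n
  proof -
    have "(LINT x|?\<mu>. (norm (fn n x - f x))\<^sup>2 * w x) = (L2w_norm S w (\<lambda>x. fn n x - f x))\<^sup>2"
      using J0 by (simp add: L2w_norm_def)
    also have "\<dots> \<le> (s n)\<^sup>2" using L0[of n] by (intro power_mono) (auto simp: s_def)
    finally show ?thesis .
  qed
  have bnd: "\<bar>(LINT x|?\<mu>. (G x \<bullet> fn n x) * w x) - (LINT x|?\<mu>. (G x \<bullet> f x) * w x)\<bar>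
      \<le> \<bar>M\<bar> / 2 * (s n * ((LINT x|?\<mu>. w x) + 1))" for n
  proof -
    have e: "integrable ?\<mu> (\<lambda>x. (norm (fn n x - f x))\<^sup>2 * w x)" using diff_L2[of n] by (simp add: L2w_def)
    have "(LINT x|?\<mu>. (G x \<bullet> fn n x) * w x) - (LINT x|?\<mu>. (G x \<bullet> f x) * w x)
        = (LINT x|?\<mu>. (G x \<bullet> (fn n x - f x)) * w x)"
      by (subst Bochner_Integration.integral_diff[symmetric])
        (auto intro!: Gf_int f simp: inner_diff_right left_diff_distrib)
    also have "\<bar>\<dots>\<bar> \<le> (LINT x|?\<mu>. \<bar>(G x \<bullet> (fn n x - f x)) * w x\<bar>)" by (rule integral_abs_bound)
    also have "\<dots> \<le> (LINT x|?\<mu>. M / 2 * (s n * w x + (norm (fn n x - f x))\<^sup>2 * w x / s n))"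
    proof (rule integral_mono)
      show "integrable ?\<mu> (\<lambda>x. \<bar>(G x \<bullet> (fn n x - f x)) * w x\<bar>)"
        by (intro integrable_abs Gf_int diff_L2)
      show "integrable ?\<mu> (\<lambda>x. M / 2 * (s n * w x + (norm (fn n x - f x))\<^sup>2 * w x / s n))"
        by (intro integrable_mult_right Bochner_Integration.integrable_add integrable_divide w_int e)
    qed (use sq s in auto)
    also have "\<dots> = M / 2 * (s n * (LINT x|?\<mu>. w x) + (LINT x|?\<mu>. (norm (fn n x - f x))\<^sup>2 * w x) / s n)"
      using w_int e by simp
    also have "\<dots> \<le> \<bar>M\<bar> / 2 * (s n * (LINT x|?\<mu>. w x) + s n)"
    proof (intro mult_mono[where a = "M / 2"] add_left_mono)
      show "(LINT x|?\<mu>. (norm (fn n x - f x))\<^sup>2 * w x) / s n \<le> s n"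
        using J[of n] s[of n] by (simp add: divide_le_eq power2_eq_square)
      have "0 \<le> (LINT x|?\<mu>. w x)"
        by (rule Bochner_Integration.integral_nonneg_AE) (use w(2) in \<open>auto intro!: AE_I2\<close>)
      then show "0 \<le> s n * (LINT x|?\<mu>. w x) + (LINT x|?\<mu>. (norm (fn n x - f x))\<^sup>2 * w x) / s n"
        using J0[of n] s[of n] by (intro add_nonneg_nonneg mult_nonneg_nonneg divide_nonneg_pos) auto
    qed auto
    finally show ?thesis by (simp add: distrib_left)
  qed
  have to_0: "(\<lambda>n. \<bar>M\<bar> / 2 * (s n * ((LINT x|?\<mu>. w x) + 1))) \<longlonglongrightarrow> 0"
  proof -
    have "s \<longlonglongrightarrow> 0 + 0" unfolding s_def by (intro tendsto_add lim LIMSEQ_inverse_real_of_nat)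
    then have "(\<lambda>n. \<bar>M\<bar> / 2 * (s n * ((LINT x|?\<mu>. w x) + 1))) \<longlonglongrightarrow> \<bar>M\<bar> / 2 * ((0 + 0) * ((LINT x|?\<mu>. w x) + 1))"
      by (intro tendsto_intros)
    then show ?thesis by simp
  qed
  have "(\<lambda>n. (LINT x|?\<mu>. (G x \<bullet> fn n x) * w x) - (LINT x|?\<mu>. (G x \<bullet> f x) * w x)) \<longlonglongrightarrow> 0"
  proof (rule Lim_null_comparison[OF always_eventually to_0], intro allI)
    show "norm ((LINT x|?\<mu>. (G x \<bullet> fn n x) * w x) - (LINT x|?\<mu>. (G x \<bullet> f x) * w x))
      \<le> \<bar>M\<bar> / 2 * (s n * ((LINT x|?\<mu>. w x) + 1))" for n
      unfolding real_norm_def by (rule bnd)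
  qed
  then show ?thesis by (rule LIM_zero_cancel)
qed

section \<open>Radial functions and fields\<close>

lemma filterlim_norm_to_boundary:
  "filterlim (\<lambda>x. norm (x - x\<^sub>0)) (at_left R) (to_boundary x\<^sub>0 R)"
proof -
  have ball: "\<forall>\<^sub>F x in to_boundary x\<^sub>0 R. x \<in> ball x\<^sub>0 R"
    unfolding to_boundary_def by (rule filter_leD[OF inf_le2]) (simp add: eventually_principal)
  have "filterlim (bdist x\<^sub>0 R) (nhds 0) (to_boundary x\<^sub>0 R)"
    unfolding to_boundary_def by (rule filterlim_mono[OF filterlim_filtercomap order_refl inf_le1])
  then have "((\<lambda>x. R - bdist x\<^sub>0 R x) \<longlongrightarrow> R - 0) (to_boundary x\<^sub>0 R)" by (intro tendsto_intros)
  moreover have "\<forall>\<^sub>F x in to_boundary x\<^sub>0 R. R - bdist x\<^sub>0 R x = norm (x - x\<^sub>0)"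
    using ball by eventually_elim (simp add: bdist_eq)
  ultimately have "((\<lambda>x. norm (x - x\<^sub>0)) \<longlongrightarrow> R - 0) (to_boundary x\<^sub>0 R)"
    by (rule Lim_transform_eventually)
  then have "((\<lambda>x. norm (x - x\<^sub>0)) \<longlongrightarrow> R) (to_boundary x\<^sub>0 R)" by simp
  moreover have "\<forall>\<^sub>F x in to_boundary x\<^sub>0 R. norm (x - x\<^sub>0) \<in> {..<R} \<and> norm (x - x\<^sub>0) \<noteq> R"
    using ball by eventually_elim (auto simp: dist_norm norm_minus_commute)
  ultimately show ?thesis by (simp add: filterlim_at)
qed

lemma to_boundary_neq_bot:
  fixes x\<^sub>0 :: "'a::euclidean_space"
  assumes "R > 0"
  shows "to_boundary x\<^sub>0 R \<noteq> bot"
proof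
  assume "to_boundary x\<^sub>0 R = bot"
  then have "eventually (\<lambda>_. False) (inf (filtercomap (bdist x\<^sub>0 R) (nhds 0)) (principal (ball x\<^sub>0 R)))"
    by (simp add: to_boundary_def)
  then obtain Q where Q: "eventually Q (nhds 0)" "\<And>x. Q (bdist x\<^sub>0 R x) \<Longrightarrow> x \<notin> ball x\<^sub>0 R"
    unfolding eventually_inf_principal eventually_filtercomap by auto
  obtain d where d: "d > 0" "\<And>y. dist y 0 < d \<Longrightarrow> Q y" using Q(1) unfolding eventually_nhds_metric by auto
  obtain e :: 'a where e: "norm e = 1" using nonempty_Basis norm_Basis by blast
  define s where "s = R - min d R / 2"
  have s: "0 \<le> s" "s < R" "R - s < d" using assms d(1) by (auto simp: s_def min_def)
  define x where "x = x\<^sub>0 + s *\<^sub>R e"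
  have "norm (x - x\<^sub>0) = s" using s e by (simp add: x_def)
  then have x: "x \<in> ball x\<^sub>0 R" using s by (simp add: dist_norm norm_minus_commute)
  have "bdist x\<^sub>0 R x = R - s" using bdist_eq[OF x] \<open>norm (x - x\<^sub>0) = s\<close> by simp
  then have "Q (bdist x\<^sub>0 R x)" using s by (intro d(2)) (simp add: dist_norm)
  then show False using Q(2) x by blast
qed

lemma radial_directional_derivative:
  fixes x\<^sub>0 :: "'a::euclidean_space"
  assumes "x \<noteq> x\<^sub>0" "(f has_real_derivative f') (at (norm (x - x\<^sub>0)))"
  shows "((\<lambda>t. f (norm (x + t *\<^sub>R b - x\<^sub>0))) has_real_derivative
    f' * (((x - x\<^sub>0) \<bullet> b) / norm (x - x\<^sub>0))) (at 0)"
proof -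
  have "((\<lambda>y. norm (y - x\<^sub>0)) has_derivative (\<lambda>h. h \<bullet> sgn (x - x\<^sub>0))) (at x)"
  proof -
    have 1: "((\<lambda>y. y - x\<^sub>0) has_derivative (\<lambda>h. h)) (at x)" by (auto intro!: derivative_eq_intros)
    have 2: "(norm has_derivative (\<lambda>h. h \<bullet> sgn (x - x\<^sub>0))) (at (x - x\<^sub>0))"
      by (rule has_derivative_norm) (use assms(1) in simp)
    show ?thesis using has_derivative_compose[OF 1 2] by simp
  qed
  then have "((\<lambda>t. norm (x + t *\<^sub>R b - x\<^sub>0)) has_real_derivative b \<bullet> sgn (x - x\<^sub>0)) (at 0)"
    by (rule directional_derivative_of_has_derivative)
  then have "((\<lambda>t. f (norm (x + t *\<^sub>R b - x\<^sub>0))) has_real_derivative f' * (b \<bullet> sgn (x - x\<^sub>0))) (at 0)"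
    using assms(2) by (intro DERIV_chain2) auto
  then show ?thesis by (simp add: sgn_div_norm inner_commute divide_inverse mult_ac)
qed

lemma continuous_on_radial:
  fixes x\<^sub>0 :: "'a::euclidean_space"
  assumes "continuous_on {0..<R} g"
  shows "continuous_on (ball x\<^sub>0 R) (\<lambda>x. g (norm (x - x\<^sub>0)))"
  by (rule continuous_on_compose2[OF assms])
    (auto intro!: continuous_intros simp: dist_norm norm_minus_commute)

text \<open>The radial field with signed length \<open>g r\<close>. At the centre it is 0, whatever \<open>g 0\<close> is.\<close>

definition radial_field :: "'a::euclidean_space \<Rightarrow> (real \<Rightarrow> real) \<Rightarrow> 'a \<Rightarrow> 'a" where
  "radial_field x\<^sub>0 g x = (g (norm (x - x\<^sub>0)) / norm (x - x\<^sub>0)) *\<^sub>R (x - x\<^sub>0)"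

lemma norm_radial_field: "norm (radial_field x\<^sub>0 g x) \<le> \<bar>g (norm (x - x\<^sub>0))\<bar>"
  by (simp add: radial_field_def)

lemma continuous_on_radial_field:
  fixes x\<^sub>0 :: "'a::euclidean_space"
  assumes g: "continuous_on {0..<R} g" "g 0 = 0"
  shows "continuous_on (ball x\<^sub>0 R) (radial_field x\<^sub>0 g)"
  unfolding continuous_on_def
proof
  fix x assume x: "x \<in> ball x\<^sub>0 R"
  have lim: "((\<lambda>y. g (norm (y - x\<^sub>0))) \<longlongrightarrow> g (norm (x - x\<^sub>0))) (at x within ball x\<^sub>0 R)"
    using continuous_on_radial[OF g(1), of x\<^sub>0] x by (simp add: continuous_on_def)
  show "(radial_field x\<^sub>0 g \<longlongrightarrow> radial_field x\<^sub>0 g x) (at x within ball x\<^sub>0 R)"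
  proof (cases "x = x\<^sub>0")
    case False
    then show ?thesis unfolding radial_field_def by (intro tendsto_intros lim) auto
  next
    case True
    have "((\<lambda>y. \<bar>g (norm (y - x\<^sub>0))\<bar>) \<longlongrightarrow> 0) (at x within ball x\<^sub>0 R)"
      using tendsto_rabs[OF lim] True g(2) by simp
    then have "(radial_field x\<^sub>0 g \<longlongrightarrow> 0) (at x within ball x\<^sub>0 R)"
      by (rule Lim_null_comparison[rotated]) (simp add: norm_radial_field)
    then show ?thesis using True by (simp add: radial_field_def)
  qed
qed

lemma bounded_below_radius:
  fixes g :: "real \<Rightarrow> real"
  assumes "continuous_on {0..<R} g" "b < R"
  obtains B where "\<And>r. 0 \<le> r \<Longrightarrow> r \<le> b \<Longrightarrow> \<bar>g r\<bar> \<le> B"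
proof -
  have "compact (g ` {0..b})"
    by (intro compact_continuous_image continuous_on_subset[OF assms(1)]) (use assms in auto)
  then obtain B where "\<And>t. t \<in> {0..b} \<Longrightarrow> \<bar>g t\<bar> \<le> B"
    by (meson bounded_real compact_imp_bounded imageI)
  then show thesis by (intro that[of B]) auto
qed

lemma relatively_compact_in_ball:
  fixes x\<^sub>0 :: "'a::euclidean_space"
  assumes "compact (closure S)" "closure S \<subseteq> ball x\<^sub>0 R" "R > 0"
  obtains b where "0 \<le> b" "b < R" "\<And>x. x \<in> S \<Longrightarrow> norm (x - x\<^sub>0) \<le> b"
proof (cases "S = {}")
  case True
  then show ?thesis using that[of 0] assms(3) by auto
next
  case False
  have "continuous_on (closure S) (\<lambda>x. norm (x - x\<^sub>0))" by (intro continuous_intros)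
  then obtain y where y: "y \<in> closure S" "\<And>x. x \<in> closure S \<Longrightarrow> norm (x - x\<^sub>0) \<le> norm (y - x\<^sub>0)"
    using continuous_attains_sup[OF assms(1), of "\<lambda>x. norm (x - x\<^sub>0)"] False by auto
  have "norm (y - x\<^sub>0) < R" using y(1) assms(2) by (auto simp: dist_norm norm_minus_commute subset_iff)
  then show ?thesis using that[of "norm (y - x\<^sub>0)"] y(2) closure_subset by fastforce
qed

lemma grad_inner_Basis: "b \<in> Basis \<Longrightarrow> grad \<phi> x \<bullet> b = frechet_derivative \<phi> (at x) b"
  by (simp add: grad_def inner_sum_left_Basis)

lemma grad_facts:
  fixes \<phi> :: "'a::euclidean_space \<Rightarrow> real"
  assumes "\<phi> \<in> test_functions U"
  shows "continuous_on UNIV (grad \<phi>)" "\<exists>M. \<forall>x. norm (grad \<phi> x) \<le> M" "\<exists>M. \<forall>x. \<bar>\<phi> x\<bar> \<le> M"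
proof -
  note facts = test_function_facts[OF assms]
  show c: "continuous_on UNIV (grad \<phi>)" unfolding grad_def by (intro continuous_intros facts(3))
  have "continuous_on UNIV (\<lambda>x. norm (grad \<phi> x))" using c by (intro continuous_intros)
  moreover have "norm (grad \<phi> x) = 0" if "x \<notin> closure {x. \<phi> x \<noteq> 0}" for x
    using facts(7)[OF that] by (simp add: grad_def)
  ultimately obtain M where "\<And>x. \<bar>norm (grad \<phi> x)\<bar> \<le> M"
    using compact_support_bounded[OF _ facts(4)] by blast
  then show "\<exists>M. \<forall>x. norm (grad \<phi> x) \<le> M" by auto
  show "\<exists>M. \<forall>x. \<bar>\<phi> x\<bar> \<le> M"
    using compact_support_bounded[OF facts(1,4) facts(6)] by blast
qed

text \<open>Off the centre this is the chain rule, and the centre is the exceptional point in the integration by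
parts. The condition \<open>\<psi>' 0 = 0\<close> makes the field continuous, hence locally integrable.\<close>

lemma radial_weak_gradient:
  fixes x\<^sub>0 :: "'a::euclidean_space"
  assumes S: "open S" "S \<in> lmeasurable" "S \<subseteq> ball x\<^sub>0 R" and b: "b < R" "\<And>x. x \<in> S \<Longrightarrow> norm (x - x\<^sub>0) \<le> b"
    and \<psi>: "continuous_on {0..<R} \<psi>" "\<And>r. r \<in> {0<..<R} \<Longrightarrow> (\<psi> has_real_derivative \<psi>' r) (at r)"
    and \<psi>': "continuous_on {0..<R} \<psi>'" "\<psi>' 0 = 0"
  shows "has_weak_gradient S (\<lambda>x. \<psi> (norm (x - x\<^sub>0))) (radial_field x\<^sub>0 \<psi>')"
proof -
  define u where "u x = \<psi> (norm (x - x\<^sub>0))" for x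
  have u: "continuous_on S u" unfolding u_def by (rule continuous_on_subset[OF continuous_on_radial[OF \<psi>(1)] S(3)])
  have Du: "continuous_on S (radial_field x\<^sub>0 \<psi>')"
    by (rule continuous_on_subset[OF continuous_on_radial_field[OF \<psi>'] S(3)])
  have L1: "L1_loc S f" if "continuous_on S f" for f :: "'a \<Rightarrow> 'b::euclidean_space"
    unfolding L1_loc_def
  proof (intro allI impI)
    fix C assume C: "compact C \<and> C \<subseteq> S"
    then have fC: "continuous_on C f" using that continuous_on_subset by blast
    then have "bounded (f ` C)" using C compact_continuous_image compact_imp_bounded by blast
    then obtain B where B: "\<And>x. x \<in> C \<Longrightarrow> norm (f x) \<le> B" unfolding bounded_iff by blast
    have CL: "C \<in> lmeasurable" using C by (simp add: lmeasurable_compact)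
    show "integrable (lebesgue_on C) f"
      by (rule integrable_of_bounded[OF CL _ B])
        (auto intro: continuous_imp_measurable_on_sets_lebesgue[OF fC] simp: fmeasurableD[OF CL])
  qed
  obtain B where B: "\<And>r. 0 \<le> r \<Longrightarrow> r \<le> b \<Longrightarrow> \<bar>\<psi>' r\<bar> \<le> B" using bounded_below_radius[OF \<psi>'(1) b(1)] by blast
  have "(LINT x|lebesgue_on S. u x *\<^sub>R grad \<phi> x) = - (LINT x|lebesgue_on S. \<phi> x *\<^sub>R radial_field x\<^sub>0 \<psi>' x)"
    if \<phi>: "\<phi> \<in> test_functions S" for \<phi>
  proof -
    have ibp: "integrable (lebesgue_on S) (\<lambda>x. u x * frechet_derivative \<phi> (at x) i)"
      "integrable (lebesgue_on S) (\<lambda>x. \<phi> x * (radial_field x\<^sub>0 \<psi>' x \<bullet> i))"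
      "(LINT x|lebesgue_on S. u x * frechet_derivative \<phi> (at x) i)
        = - (LINT x|lebesgue_on S. \<phi> x * (radial_field x\<^sub>0 \<psi>' x \<bullet> i))" if i: "i \<in> Basis" for i
    proof -
      have 1: "((\<lambda>t. u (x + t *\<^sub>R i)) has_real_derivative radial_field x\<^sub>0 \<psi>' x \<bullet> i) (at 0)"
        if x: "x \<in> S" "x \<noteq> x\<^sub>0" for x
      proof -
        have "norm (x - x\<^sub>0) \<in> {0<..<R}" using x b by fastforce
        from radial_directional_derivative[OF x(2) \<psi>(2)[OF this], of i]
        show ?thesis by (simp add: u_def radial_field_def)
      qed
      have 2: "\<bar>radial_field x\<^sub>0 \<psi>' x \<bullet> i\<bar> \<le> B" if "x \<in> S" for x
        using Basis_le_norm[OF i, of "radial_field x\<^sub>0 \<psi>' x"] norm_radial_field[of x\<^sub>0 \<psi>' x]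
          B[OF norm_ge_zero b(2)[OF that]] by simp
      show "integrable (lebesgue_on S) (\<lambda>x. u x * frechet_derivative \<phi> (at x) i)"
        "integrable (lebesgue_on S) (\<lambda>x. \<phi> x * (radial_field x\<^sub>0 \<psi>' x \<bullet> i))"
        "(LINT x|lebesgue_on S. u x * frechet_derivative \<phi> (at x) i)
          = - (LINT x|lebesgue_on S. \<phi> x * (radial_field x\<^sub>0 \<psi>' x \<bullet> i))"
        using integration_by_parts_test_function[OF S(1,2) \<phi> i u, of x\<^sub>0 "\<lambda>x. radial_field x\<^sub>0 \<psi>' x \<bullet> i" B] 1 2
        by blast+
    qed
    have ints: "integrable (lebesgue_on S) (\<lambda>x. u x *\<^sub>R grad \<phi> x)"
      "integrable (lebesgue_on S) (\<lambda>x. \<phi> x *\<^sub>R radial_field x\<^sub>0 \<psi>' x)"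
    proof -
      have "integrable (lebesgue_on S) (\<lambda>x. \<Sum>i\<in>Basis. (u x * frechet_derivative \<phi> (at x) i) *\<^sub>R i)"
        by (intro Bochner_Integration.integrable_sum integrable_scaleR_left ibp)
      then show "integrable (lebesgue_on S) (\<lambda>x. u x *\<^sub>R grad \<phi> x)"
        by (simp add: grad_def scaleR_sum_right)
      have "integrable (lebesgue_on S) (\<lambda>x. \<Sum>i\<in>Basis. (\<phi> x * (radial_field x\<^sub>0 \<psi>' x \<bullet> i)) *\<^sub>R i)"
        by (intro Bochner_Integration.integrable_sum integrable_scaleR_left ibp)
      moreover have "(\<Sum>i\<in>Basis. (\<phi> x * (radial_field x\<^sub>0 \<psi>' x \<bullet> i)) *\<^sub>R i) = \<phi> x *\<^sub>R radial_field x\<^sub>0 \<psi>' x" for x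
        by (simp add: scaleR_scaleR[symmetric] scaleR_sum_right[symmetric] euclidean_representation del: scaleR_scaleR)
      ultimately show "integrable (lebesgue_on S) (\<lambda>x. \<phi> x *\<^sub>R radial_field x\<^sub>0 \<psi>' x)" by simp
    qed
    show ?thesis
    proof (rule euclidean_eqI)
      fix i :: 'a assume i: "i \<in> Basis"
      have "(LINT x|lebesgue_on S. u x *\<^sub>R grad \<phi> x) \<bullet> i = (LINT x|lebesgue_on S. (u x *\<^sub>R grad \<phi> x) \<bullet> i)"
        using ints(1) by (intro integral_inner_left[symmetric])
      also have "\<dots> = - (LINT x|lebesgue_on S. (\<phi> x *\<^sub>R radial_field x\<^sub>0 \<psi>' x) \<bullet> i)"
        using ibp(3)[OF i] by (simp add: grad_inner_Basis[OF i])
      also have "(LINT x|lebesgue_on S. (\<phi> x *\<^sub>R radial_field x\<^sub>0 \<psi>' x) \<bullet> i)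
          = (LINT x|lebesgue_on S. \<phi> x *\<^sub>R radial_field x\<^sub>0 \<psi>' x) \<bullet> i"
        using ints(2) by (intro integral_inner_left)
      finally show "(LINT x|lebesgue_on S. u x *\<^sub>R grad \<phi> x) \<bullet> i
          = (- (LINT x|lebesgue_on S. \<phi> x *\<^sub>R radial_field x\<^sub>0 \<psi>' x)) \<bullet> i" by simp
    qed
  qed
  then show ?thesis using L1[OF u] L1[OF Du] unfolding has_weak_gradient_def u_def by blast
qed

text \<open>The divergence of the radial field with length \<open>Q\<close> is \<open>Q' + (N - 1) / r * Q\<close>, which is \<open>s\<close> by
assumption. For integration by parts each partial derivative has to be bounded on its own; the
tangential part is \<open>Q / r\<close>, hence the linear bound on \<open>Q\<close>.\<close>

lemma radial_divergence_test:
  fixes x\<^sub>0 :: "'a::euclidean_space"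
  assumes S: "open S" "S \<in> lmeasurable" "S \<subseteq> ball x\<^sub>0 R" and b: "b < R" "\<And>x. x \<in> S \<Longrightarrow> norm (x - x\<^sub>0) \<le> b"
    and Q: "continuous_on {0..<R} Q" "Q 0 = 0"
    and Q': "\<And>r. r \<in> {0<..<R} \<Longrightarrow> (Q has_real_derivative s r - (real DIM('a) - 1) / r * Q r) (at r)"
    and linear: "\<And>r. 0 < r \<Longrightarrow> r \<le> b \<Longrightarrow> \<bar>Q r\<bar> \<le> C * r"
    and s: "continuous_on {0..<R} s"
    and \<phi>: "\<phi> \<in> test_functions S"
  shows "(LINT x|lebesgue_on S. radial_field x\<^sub>0 Q x \<bullet> grad \<phi> x)
    = - (LINT x|lebesgue_on S. \<phi> x * s (norm (x - x\<^sub>0)))"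
proof -
  define N where "N = real DIM('a)"
  have N: "N \<ge> 1" unfolding N_def by (simp add: DIM_positive Suc_leI)
  define m where "m r = Q r / r" for r
  define V where "V i x = radial_field x\<^sub>0 Q x \<bullet> i" for i x
  \<comment> \<open>The value at \<open>x\<^sub>0\<close> is chosen so that the sum over all coordinates equals \<open>s\<close> everywhere.\<close>
  define V' where "V' i x = (if x = x\<^sub>0 then s 0 / N else
      (s (norm (x - x\<^sub>0)) - N * m (norm (x - x\<^sub>0))) * ((x - x\<^sub>0) \<bullet> i)\<^sup>2 / (norm (x - x\<^sub>0))\<^sup>2
      + m (norm (x - x\<^sub>0)))" for i x
  obtain B where B: "\<And>r. 0 \<le> r \<Longrightarrow> r \<le> b \<Longrightarrow> \<bar>s r\<bar> \<le> B" using bounded_below_radius[OF s b(1)] by blast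
  have V: "continuous_on S (V i)" for i unfolding V_def
    by (intro continuous_intros continuous_on_subset[OF continuous_on_radial_field[OF Q] S(3)])
  have V_deriv: "((\<lambda>t. V i (x + t *\<^sub>R i)) has_real_derivative V' i x) (at 0)"
    if i: "i \<in> Basis" and x: "x \<in> S" "x \<noteq> x\<^sub>0" for i x
  proof -
    define r where "r = norm (x - x\<^sub>0)"
    have r: "r \<in> {0<..<R}" using x b by (fastforce simp: r_def)
    have "(m has_real_derivative (s r - N * m r) / r) (at r)"
      unfolding m_def using r
      by (auto intro!: derivative_eq_intros Q' simp: N_def field_simps power2_eq_square)
    from radial_directional_derivative[OF x(2) this[unfolded r_def], of i]
    have "((\<lambda>t. m (norm (x + t *\<^sub>R i - x\<^sub>0))) has_real_derivative
        (s r - N * m r) / r * (((x - x\<^sub>0) \<bullet> i) / r)) (at 0)" by (simp add: r_def)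
    moreover have "((\<lambda>t. (x + t *\<^sub>R i - x\<^sub>0) \<bullet> i) has_real_derivative 1) (at 0)"
      using i by (auto intro!: derivative_eq_intros simp: inner_diff_left inner_add_left)
    ultimately have "((\<lambda>t. m (norm (x + t *\<^sub>R i - x\<^sub>0)) * ((x + t *\<^sub>R i - x\<^sub>0) \<bullet> i)) has_real_derivative
        (s r - N * m r) / r * (((x - x\<^sub>0) \<bullet> i) / r) * ((x + 0 *\<^sub>R i - x\<^sub>0) \<bullet> i)
        + 1 * m (norm (x + 0 *\<^sub>R i - x\<^sub>0))) (at 0)" by (rule DERIV_mult)
    then show ?thesis using x(2)
      by (simp add: V_def V'_def radial_field_def m_def r_def power2_eq_square mult_ac)
  qed
  have V'_bound: "\<bar>V' i x\<bar> \<le> B + N * C + C" if i: "i \<in> Basis" and x: "x \<in> S" "x \<noteq> x\<^sub>0" for i x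
  proof -
    define r where "r = norm (x - x\<^sub>0)"
    have r: "0 < r" "r \<le> b" using x b(2) by (auto simp: r_def)
    have m: "\<bar>m r\<bar> \<le> C" using linear[OF r] r by (simp add: m_def divide_le_eq)
    define y where "y = ((x - x\<^sub>0) \<bullet> i)\<^sup>2 / r\<^sup>2"
    have "\<bar>(x - x\<^sub>0) \<bullet> i\<bar>\<^sup>2 \<le> r\<^sup>2" unfolding r_def by (intro power_mono Basis_le_norm i) simp
    then have y: "0 \<le> y" "y \<le> 1" using r by (auto simp: y_def divide_le_eq)
    have "\<bar>(s r - N * m r) * y\<bar> \<le> (B + N * C) * 1"
      unfolding abs_mult
    proof (intro mult_mono)
      have "\<bar>N * m r\<bar> \<le> N * C" using N m by (simp add: abs_mult mult_left_mono)
      then show "\<bar>s r - N * m r\<bar> \<le> B + N * C" using B[of r] r by linarith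
      then show "0 \<le> B + N * C" by linarith
    qed (use y in auto)
    moreover have "V' i x = (s r - N * m r) * y + m r"
      using x(2) by (simp add: V'_def r_def y_def)
    moreover have "\<bar>(s r - N * m r) * y + m r\<bar> \<le> \<bar>(s r - N * m r) * y\<bar> + \<bar>m r\<bar>"
      by (rule abs_triangle_ineq)
    ultimately show ?thesis using m by simp
  qed
  note ibp = integration_by_parts_test_function[OF S(1,2) \<phi> _ V V_deriv V'_bound]
  have div: "(\<Sum>i\<in>Basis. V' i x) = s (norm (x - x\<^sub>0))" for x :: 'a
  proof (cases "x = x\<^sub>0")
    case True
    then show ?thesis using N by (simp add: V'_def N_def)
  next
    case False
    have "(\<Sum>i\<in>Basis. ((x - x\<^sub>0) \<bullet> i)\<^sup>2) = (norm (x - x\<^sub>0))\<^sup>2"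
      unfolding power2_norm_eq_inner using euclidean_inner[of "x - x\<^sub>0" "x - x\<^sub>0"]
      by (simp only: power2_eq_square)
    then have "(\<Sum>i\<in>Basis. (s (norm (x - x\<^sub>0)) - N * m (norm (x - x\<^sub>0))) * ((x - x\<^sub>0) \<bullet> i)\<^sup>2 / (norm (x - x\<^sub>0))\<^sup>2)
        = s (norm (x - x\<^sub>0)) - N * m (norm (x - x\<^sub>0))"
      using False by (simp add: sum_divide_distrib[symmetric] sum_distrib_left[symmetric])
    then show ?thesis using False by (simp add: V'_def sum.distrib N_def)
  qed
  have "radial_field x\<^sub>0 Q x \<bullet> grad \<phi> x = (\<Sum>i\<in>Basis. V i x * frechet_derivative \<phi> (at x) i)" for x
    using euclidean_inner[of "radial_field x\<^sub>0 Q x" "grad \<phi> x"] by (simp add: V_def grad_inner_Basis)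
  then have "(LINT x|lebesgue_on S. radial_field x\<^sub>0 Q x \<bullet> grad \<phi> x)
      = (\<Sum>i\<in>Basis. LINT x|lebesgue_on S. V i x * frechet_derivative \<phi> (at x) i)"
    by (simp add: Bochner_Integration.integral_sum ibp(1))
  also have "\<dots> = - (\<Sum>i\<in>Basis. LINT x|lebesgue_on S. \<phi> x * V' i x)"
    by (simp add: ibp(3) sum_negf)
  also have "(\<Sum>i\<in>Basis. LINT x|lebesgue_on S. \<phi> x * V' i x) = (LINT x|lebesgue_on S. (\<Sum>i\<in>Basis. \<phi> x * V' i x))"
    by (rule Bochner_Integration.integral_sum[symmetric]) (rule ibp(2))
  also have "\<dots> = (LINT x|lebesgue_on S. \<phi> x * s (norm (x - x\<^sub>0)))"
    by (simp add: sum_distrib_left[symmetric] div)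
  finally show ?thesis .
qed

section \<open>From the radial equation to the weak equation\<close>

text \<open>Multiplying the radial equation by the weight \<open>(R - r) powr \<alpha>\<close> gives the divergence form for
\<open>Q = (R - r) powr \<alpha> * \<psi>'\<close>. Testing it against smooth functions and passing to the limit gives the
equation for every element of \<open>W12_0\<close>, because on a relatively compact set all coefficients are
bounded.\<close>

lemma radial_solution_is_weak_solution:
  fixes x\<^sub>0 :: "'a::euclidean_space" and \<psi> \<psi>' \<psi>'' a :: "real \<Rightarrow> real"
  assumes R: "R > 0" and a: "continuous_on {0..R} a"
    and \<psi>: "continuous_on {0..<R} \<psi>" "\<And>r. r \<in> {0<..<R} \<Longrightarrow> (\<psi> has_real_derivative \<psi>' r) (at r)"
      "\<And>r. r \<in> {0..<R} \<Longrightarrow> \<psi> r > 0" "filterlim \<psi> at_top (at_left R)"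
    and \<psi>': "continuous_on {0..<R} \<psi>'" "\<psi>' 0 = 0"
      "\<And>r. r \<in> {0<..<R} \<Longrightarrow> (\<psi>' has_real_derivative \<psi>'' r) (at r)"
    and linear: "\<And>b. b < R \<Longrightarrow> \<exists>C. \<forall>s\<in>{0..b}. \<bar>\<psi>' s\<bar> \<le> C * s"
    and eq: "\<And>r. r \<in> {0<..<R} \<Longrightarrow> \<psi>'' r + ((real DIM('a) - 1) / r - \<alpha> / (R - r)) * \<psi>' r
      = a r * (R - r) powr (\<gamma> - \<alpha>) * \<psi> r powr p"
  shows "local_weak_large_solution x\<^sub>0 R \<alpha> \<gamma> p a (\<lambda>x. \<psi> (norm (x - x\<^sub>0)))"
proof -
  define u where "u x = \<psi> (norm (x - x\<^sub>0))" for x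
  define Du where "Du = radial_field x\<^sub>0 \<psi>'"
  define w where "w x = bdist x\<^sub>0 R x powr \<alpha>" for x
  define Q where "Q r = (R - r) powr \<alpha> * \<psi>' r" for r
  define s where "s r = a r * (R - r) powr \<gamma> * \<psi> r powr p" for r
  define h where "h r = a r * (R - r) powr (\<gamma> - \<alpha>) * \<psi> r powr p" for r
  have a': "continuous_on {0..<R} a" by (rule continuous_on_subset[OF a]) auto
  have up: "continuous_on {0..<R} (\<lambda>r. \<psi> r powr p)"
    using \<psi>(3) by (intro continuous_intros \<psi>(1)) fastforce
  have pw: "continuous_on {0..<R} (\<lambda>r. (R - r) powr e)" for e by (intro continuous_intros) auto
  have Qc: "continuous_on {0..<R} Q" unfolding Q_def by (intro continuous_on_mult pw \<psi>'(1))
  have Q0: "Q 0 = 0" by (simp add: Q_def \<psi>'(2))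
  have sc: "continuous_on {0..<R} s" unfolding s_def by (intro continuous_on_mult pw a' up)
  have hc: "continuous_on {0..<R} h" unfolding h_def by (intro continuous_on_mult pw a' up)
  have split: "(R - r) powr \<alpha> * (R - r) powr (\<gamma> - \<alpha>) = (R - r) powr \<gamma>" for r
    by (simp add: powr_add[symmetric])
  have Q': "(Q has_real_derivative s r - (real DIM('a) - 1) / r * Q r) (at r)" if r: "r \<in> {0<..<R}" for r
  proof -
    have "((\<lambda>r. (R - r) powr \<alpha>) has_real_derivative (R - r) powr \<alpha> * (- \<alpha> / (R - r))) (at r)"
      using r by (auto intro!: derivative_eq_intros simp: powr_diff)
    from DERIV_mult[OF this \<psi>'(3)[OF r]]
    have "(Q has_real_derivative (R - r) powr \<alpha> * (- \<alpha> / (R - r)) * \<psi>' r + \<psi>'' r * (R - r) powr \<alpha>) (at r)"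
      unfolding Q_def .
    moreover have "\<psi>'' r = h r - ((real DIM('a) - 1) / r - \<alpha> / (R - r)) * \<psi>' r"
      using eq[OF r] by (simp add: h_def)
    moreover have "s r = (R - r) powr \<alpha> * h r" by (simp add: s_def h_def split[symmetric] mult_ac)
    ultimately show ?thesis by (simp add: Q_def algebra_simps)
  qed
  have main: "(u, Du) \<in> W12 S w \<and> (\<lambda>x. u x powr p) \<in> L2w S w \<and>
      (\<forall>\<phi> D\<phi>. (\<phi>, D\<phi>) \<in> W12_0 S w \<longrightarrow>
         (LINT x|lebesgue_on S. (Du x \<bullet> D\<phi> x) * bdist x\<^sub>0 R x powr \<alpha>)
         + (LINT x|lebesgue_on S. a (norm (x - x\<^sub>0)) * bdist x\<^sub>0 R x powr \<gamma> * u x powr p * \<phi> x) = 0)"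
    if S: "open S" "compact (closure S)" "closure S \<subseteq> ball x\<^sub>0 R" for S
  proof -
    have SR: "S \<subseteq> ball x\<^sub>0 R" using S(3) closure_subset by blast
    have SL: "S \<in> lmeasurable"
      by (rule lmeasurable_open[OF bounded_subset[OF bounded_ball SR] S(1)])
    have Sset: "S \<in> sets lebesgue" using SL by (rule fmeasurableD)
    obtain b where b: "0 \<le> b" "b < R" "\<And>x. x \<in> S \<Longrightarrow> norm (x - x\<^sub>0) \<le> b"
      using relatively_compact_in_ball[OF S(2,3) R] by blast
    have meas: "f \<in> borel_measurable (lebesgue_on S)" if "continuous_on S f" for f :: "'a \<Rightarrow> 'b::euclidean_space"
      by (rule continuous_imp_measurable_on_sets_lebesgue[OF that Sset])
    have rad: "continuous_on S (\<lambda>x. g (norm (x - x\<^sub>0)))" if "continuous_on {0..<R} g" for g :: "real \<Rightarrow> real"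
      by (rule continuous_on_subset[OF continuous_on_radial[OF that] SR])
    have radB: "\<exists>B. \<forall>x\<in>S. \<bar>g (norm (x - x\<^sub>0))\<bar> \<le> B" if "continuous_on {0..<R} g" for g :: "real \<Rightarrow> real"
      using bounded_below_radius[OF that b(2)] b(3) by (metis norm_ge_zero)
    have d: "bdist x\<^sub>0 R x = R - norm (x - x\<^sub>0)" if "x \<in> S" for x using bdist_eq SR that by blast
    have w_eq: "w x = (R - norm (x - x\<^sub>0)) powr \<alpha>" if "x \<in> S" for x using d[OF that] by (simp add: w_def)
    have w_meas: "w \<in> borel_measurable (lebesgue_on S)"
      by (rule meas, rule continuous_on_eq[OF rad[OF pw[of \<alpha>]]]) (simp add: w_eq)
    obtain W where W: "\<And>x. x \<in> S \<Longrightarrow> \<bar>w x\<bar> \<le> W" using radB[OF pw[of \<alpha>]] w_eq by metis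
    have w0: "0 \<le> w x" for x by (simp add: w_def)
    have W': "w x \<le> W" if "x \<in> S" for x using W[OF that] by simp
    have L2: "f \<in> L2w S w" if "continuous_on S f" "\<And>x. x \<in> S \<Longrightarrow> norm (f x) \<le> B"
      for f :: "'a \<Rightarrow> 'b::euclidean_space" and B
      by (rule L2w_of_bounded[OF SL meas[OF that(1)] that(2) w_meas W])
    have u: "continuous_on S u" unfolding u_def by (rule rad[OF \<psi>(1)])
    have Du: "continuous_on S Du" unfolding Du_def
      by (rule continuous_on_subset[OF continuous_on_radial_field[OF \<psi>'(1,2)] SR])
    obtain Bu where Bu: "\<And>x. x \<in> S \<Longrightarrow> norm (u x) \<le> Bu" using radB[OF \<psi>(1)] by (auto simp: u_def)
    obtain Bp where Bp: "\<And>x. x \<in> S \<Longrightarrow> norm (u x powr p) \<le> Bp" using radB[OF up] by (auto simp: u_def)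
    obtain BD where BD: "\<And>x. x \<in> S \<Longrightarrow> norm (Du x) \<le> BD"
      using radB[OF \<psi>'(1)] norm_radial_field[of x\<^sub>0 \<psi>'] unfolding Du_def by (meson order_trans)
    obtain Bh where Bh: "\<And>x. x \<in> S \<Longrightarrow> norm (h (norm (x - x\<^sub>0))) \<le> Bh" using radB[OF hc] by auto
    have grad: "has_weak_gradient S u Du" unfolding u_def Du_def
      by (rule radial_weak_gradient[OF S(1) SL SR b(2,3) \<psi>(1,2) \<psi>'(1,2)])
    have W12: "(u, Du) \<in> W12 S w"
      using grad L2[OF u Bu] L2[OF Du BD] by (simp add: W12_def)
    have Lp: "(\<lambda>x. u x powr p) \<in> L2w S w"
      by (rule L2[OF _ Bp]) (simp add: u_def rad[OF up])
    have test: "(LINT x|lebesgue_on S. (Du x \<bullet> grad \<phi> x) * w x)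
        + (LINT x|lebesgue_on S. (h (norm (x - x\<^sub>0)) \<bullet> \<phi> x) * w x) = 0" if \<phi>: "\<phi> \<in> test_functions S" for \<phi>
    proof -
      obtain C where C: "\<And>r. r \<in> {0..b} \<Longrightarrow> \<bar>\<psi>' r\<bar> \<le> C * r" using linear[OF b(2)] by blast
      obtain P where P: "\<And>r. 0 \<le> r \<Longrightarrow> r \<le> b \<Longrightarrow> \<bar>(R - r) powr \<alpha>\<bar> \<le> P"
        using bounded_below_radius[OF pw[of \<alpha>] b(2)] by blast
      have lin: "\<bar>Q r\<bar> \<le> P * C * r" if "0 < r" "r \<le> b" for r
      proof -
        have "0 \<le> P" using P[of 0] b(1) by linarith
        then have "\<bar>(R - r) powr \<alpha>\<bar> * \<bar>\<psi>' r\<bar> \<le> P * (C * r)"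
          using P[of r] C[of r] that by (intro mult_mono) auto
        then show ?thesis by (simp add: Q_def abs_mult mult_ac)
      qed
      have "(LINT x|lebesgue_on S. (Du x \<bullet> grad \<phi> x) * w x) = (LINT x|lebesgue_on S. radial_field x\<^sub>0 Q x \<bullet> grad \<phi> x)"
        by (rule Bochner_Integration.integral_cong)
          (auto simp: w_eq Du_def radial_field_def Q_def)
      also have "\<dots> = - (LINT x|lebesgue_on S. \<phi> x * s (norm (x - x\<^sub>0)))"
        by (rule radial_divergence_test[OF S(1) SL SR b(2,3) Qc Q0 Q' lin sc \<phi>])
      also have "(LINT x|lebesgue_on S. \<phi> x * s (norm (x - x\<^sub>0)))
          = (LINT x|lebesgue_on S. (h (norm (x - x\<^sub>0)) \<bullet> \<phi> x) * w x)"
        by (rule Bochner_Integration.integral_cong)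
          (auto simp: w_eq s_def h_def split[symmetric] mult_ac)
      finally show ?thesis by simp
    qed
    have "(LINT x|lebesgue_on S. (Du x \<bullet> D\<phi> x) * bdist x\<^sub>0 R x powr \<alpha>)
         + (LINT x|lebesgue_on S. a (norm (x - x\<^sub>0)) * bdist x\<^sub>0 R x powr \<gamma> * u x powr p * \<phi> x) = 0"
      if \<phi>: "(\<phi>, D\<phi>) \<in> W12_0 S w" for \<phi> D\<phi>
    proof -
      obtain f where f: "\<And>n::nat. f n \<in> test_functions S"
        and lim: "(\<lambda>n. L2w_norm S w (\<lambda>x. f n x - \<phi> x) + L2w_norm S w (\<lambda>x. grad (f n) x - D\<phi> x)) \<longlonglongrightarrow> 0"
        and mem: "(\<phi>, D\<phi>) \<in> W12 S w"
        using \<phi> unfolding W12_0_def by blast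
      have norm0: "0 \<le> L2w_norm S w g" for g :: "'a \<Rightarrow> 'b::euclidean_space"
        unfolding L2w_norm_def using w0 by (intro real_sqrt_ge_zero Bochner_Integration.integral_nonneg) auto
      have lim1: "(\<lambda>n. L2w_norm S w (\<lambda>x. f n x - \<phi> x)) \<longlonglongrightarrow> 0"
        by (rule tendsto_sandwich[OF _ _ tendsto_const lim]) (auto intro!: always_eventually norm0 simp: norm0)
      have lim2: "(\<lambda>n. L2w_norm S w (\<lambda>x. grad (f n) x - D\<phi> x)) \<longlonglongrightarrow> 0"
        by (rule tendsto_sandwich[OF _ _ tendsto_const lim]) (auto intro!: always_eventually norm0 simp: norm0)
      have fL: "f n \<in> L2w S w" for n
      proof -
        obtain B where "\<And>x. \<bar>f n x\<bar> \<le> B" using grad_facts(3)[OF f] by blast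
        then show ?thesis
          by (intro L2[of _ B] continuous_on_subset[OF test_function_facts(1)[OF f]]) auto
      qed
      have gL: "grad (f n) \<in> L2w S w" for n
      proof -
        obtain B where "\<And>x. norm (grad (f n) x) \<le> B" using grad_facts(2)[OF f] by blast
        then show ?thesis
          by (intro L2[of _ B] continuous_on_subset[OF grad_facts(1)[OF f]]) auto
      qed
      have mem': "\<phi> \<in> L2w S w" "D\<phi> \<in> L2w S w" using mem by (auto simp: W12_def)
      have "(\<lambda>n. LINT x|lebesgue_on S. (Du x \<bullet> grad (f n) x) * w x)
          \<longlonglongrightarrow> (LINT x|lebesgue_on S. (Du x \<bullet> D\<phi> x) * w x)"
        by (rule L2w_limit_integral[OF SL w_meas w0 W' meas[OF Du] BD mem'(2) gL lim2])
      moreover have "(\<lambda>n. LINT x|lebesgue_on S. (h (norm (x - x\<^sub>0)) \<bullet> f n x) * w x)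
          \<longlonglongrightarrow> (LINT x|lebesgue_on S. (h (norm (x - x\<^sub>0)) \<bullet> \<phi> x) * w x)"
        by (rule L2w_limit_integral[OF SL w_meas w0 W' meas[OF rad[OF hc]] Bh mem'(1) fL lim1])
      ultimately have "(\<lambda>n. (LINT x|lebesgue_on S. (Du x \<bullet> grad (f n) x) * w x)
            + (LINT x|lebesgue_on S. (h (norm (x - x\<^sub>0)) \<bullet> f n x) * w x))
          \<longlonglongrightarrow> (LINT x|lebesgue_on S. (Du x \<bullet> D\<phi> x) * w x)
            + (LINT x|lebesgue_on S. (h (norm (x - x\<^sub>0)) \<bullet> \<phi> x) * w x)"
        by (rule tendsto_add)
      then have "(\<lambda>n::nat. 0) \<longlonglongrightarrow> (LINT x|lebesgue_on S. (Du x \<bullet> D\<phi> x) * w x)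
            + (LINT x|lebesgue_on S. (h (norm (x - x\<^sub>0)) \<bullet> \<phi> x) * w x)"
        unfolding test[OF f] .
      then have "0 = (LINT x|lebesgue_on S. (Du x \<bullet> D\<phi> x) * w x)
            + (LINT x|lebesgue_on S. (h (norm (x - x\<^sub>0)) \<bullet> \<phi> x) * w x)"
        by (rule LIMSEQ_unique[OF tendsto_const])
      moreover have "(LINT x|lebesgue_on S. (h (norm (x - x\<^sub>0)) \<bullet> \<phi> x) * w x)
          = (LINT x|lebesgue_on S. a (norm (x - x\<^sub>0)) * bdist x\<^sub>0 R x powr \<gamma> * u x powr p * \<phi> x)"
        by (rule Bochner_Integration.integral_cong)
          (auto simp: w_eq d h_def u_def split[symmetric] mult_ac)
      ultimately show ?thesis by (simp add: w_def)
    qed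
    then show ?thesis using W12 Lp by blast
  qed
  have "continuous_on (ball x\<^sub>0 R) u" unfolding u_def by (rule continuous_on_radial[OF \<psi>(1)])
  moreover have "filterlim u at_top (to_boundary x\<^sub>0 R)"
    unfolding u_def by (rule filterlim_compose[OF \<psi>(4) filterlim_norm_to_boundary])
  ultimately have "local_weak_large_solution x\<^sub>0 R \<alpha> \<gamma> p a u"
    unfolding local_weak_large_solution_def Let_def using main unfolding w_def by blast
  then show ?thesis by (simp add: u_def[abs_def])
qed

section \<open>Existence of large solutions with prescribed boundary behaviour\<close>

lemma ball_weight_slope_has_derivative:
  assumes "R > 0" "N \<ge> 1" "continuous_on {0..<R} f" "0 < r" "r < R"
  shows "(radial_weight.slope (ball_weight N \<alpha> R) f has_real_derivative
    f r - ((real N - 1) / r - \<alpha> / (R - r)) * radial_weight.slope (ball_weight N \<alpha> R) f r) (at r)"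
proof -
  interpret radial_weight R "ball_weight N \<alpha> R" by (rule radial_weight_ball_weight[OF assms(1)])
  define q where "q = ball_weight N \<alpha> R"
  have q: "q r > 0" unfolding q_def using assms by (intro ball_weight_pos)
  have "at r within {0..<R} = at r" by (rule at_within_interior) (use assms in auto)
  then have "(flux f has_real_derivative q r * f r) (at r)"
    using flux_has_derivative[OF assms(3), of r] assms by (simp add: q_def)
  moreover have "(q has_real_derivative q r * ((real N - 1) / r - \<alpha> / (R - r))) (at r)"
    unfolding q_def by (rule ball_weight_has_derivative[OF assms(4,5,2)])
  ultimately have "((\<lambda>s. flux f s / q s) has_real_derivative
      (q r * f r * q r - flux f r * (q r * ((real N - 1) / r - \<alpha> / (R - r)))) / (q r * q r)) (at r)"
    using q by (intro DERIV_divide) auto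
  moreover have "(q r * f r * q r - flux f r * (q r * ((real N - 1) / r - \<alpha> / (R - r)))) / (q r * q r)
      = f r - ((real N - 1) / r - \<alpha> / (R - r)) * (flux f r / q r)"
    using q by (simp add: diff_divide_distrib)
  ultimately show ?thesis unfolding slope_def[abs_def] q_def by simp
qed

theorem theorem4p2:
  fixes p R \<alpha> \<gamma> \<beta> K \<epsilon> :: real and a :: "real \<Rightarrow> real"
  assumes "p > 1" and "R > 0" and "\<gamma> - \<alpha> \<ge> 0"
    and "continuous_on {0..R} a" and "\<forall>r\<in>{0..R}. a r > 0"
    and "\<beta> = (2 + \<gamma> - \<alpha>) / (p - 1)"
    and "\<beta> + 1 - \<alpha> > 0"
    and "K = (\<beta> * (\<beta> + 1 - \<alpha>) / a R) powr (1 / (p - 1))"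
    and "\<epsilon> > 0"
  shows "\<exists>\<psi>. radial_large_solution CARD('n) R \<alpha> \<gamma> p a \<psi> \<and> (\<forall>r\<in>{0..<R}. \<psi> r > 0) \<and>
    ereal (1 - \<epsilon>) \<le> Liminf (at_left R) (\<lambda>r. ereal (\<psi> r / (K * (R - r) powr (- \<beta>)))) \<and>
    Liminf (at_left R) (\<lambda>r. ereal (\<psi> r / (K * (R - r) powr (- \<beta>))))
      \<le> Limsup (at_left R) (\<lambda>r. ereal (\<psi> r / (K * (R - r) powr (- \<beta>)))) \<and>
    Limsup (at_left R) (\<lambda>r. ereal (\<psi> r / (K * (R - r) powr (- \<beta>)))) \<le> ereal (1 + \<epsilon>) \<and>
    (\<forall>x\<^sub>0 :: real ^ 'n. \<forall>u. u = (\<lambda>x. \<psi> (norm (x - x\<^sub>0))) \<longrightarrow>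
       local_weak_large_solution x\<^sub>0 R \<alpha> \<gamma> p a u \<and> (\<forall>x\<in>ball x\<^sub>0 R. u x \<ge> 0) \<and>
       ereal (1 - \<epsilon>) \<le> Liminf (to_boundary x\<^sub>0 R) (\<lambda>x. ereal (u x / (K * bdist x\<^sub>0 R x powr (- \<beta>)))) \<and>
       Liminf (to_boundary x\<^sub>0 R) (\<lambda>x. ereal (u x / (K * bdist x\<^sub>0 R x powr (- \<beta>))))
         \<le> Limsup (to_boundary x\<^sub>0 R) (\<lambda>x. ereal (u x / (K * bdist x\<^sub>0 R x powr (- \<beta>)))) \<and>
       Limsup (to_boundary x\<^sub>0 R) (\<lambda>x. ereal (u x / (K * bdist x\<^sub>0 R x powr (- \<beta>)))) \<le> ereal (1 + \<epsilon>))"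
proof -
  define N where "N = CARD('n)"
  have N: "N \<ge> 1" unfolding N_def by (simp add: Suc_leI)
  have a_pos: "a r > 0" if "r \<in> {0..R}" for r using assms(5) that by blast
  have \<beta>0: "\<beta> > 0" unfolding assms(6) using assms(1,3) by simp
  have aR: "a R > 0" using a_pos assms(2) by simp
  have K: "K > 0" unfolding assms(8) using \<beta>0 assms(7) aR by simp
  \<comment> \<open>A margin smaller than \<open>\<epsilon>\<close> turns the limits of the barrier ratios into bounds near the
  boundary; \<open>\<delta> < 1\<close> keeps the lower barrier constant positive.\<close>
  define \<delta> where "\<delta> = min (\<epsilon> / 2) (1 / 2)"
  have \<delta>: "0 < \<delta>" "\<delta> < \<epsilon>" "\<delta> < 1" using assms(9) by (auto simp: \<delta>_def min_def)
  have \<kappa>: "0 < 1 - \<delta>" "1 - \<delta> < 1" "1 < 1 + \<delta>" using \<delta> by auto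
  interpret radial_weight R "ball_weight N \<alpha> R" by (rule radial_weight_ball_weight[OF assms(2)])
  obtain \<psi> A\<^sub>1 A\<^sub>2 where \<psi>: "continuous_on {0..<R} \<psi>" "\<And>r. 0 \<le> r \<Longrightarrow> r < R \<Longrightarrow> 0 < \<psi> r"
    "\<And>r. 0 \<le> r \<Longrightarrow> r < R \<Longrightarrow> barrier R \<beta> A\<^sub>1 ((1 - \<delta>) * K * (2 * R) powr \<beta>) r \<le> \<psi> r"
    "\<And>r. 0 \<le> r \<Longrightarrow> r < R \<Longrightarrow> \<psi> r \<le> barrier R \<beta> A\<^sub>2 ((1 + \<delta>) * K * (2 * R) powr \<beta>) r"
    "\<And>r. 0 \<le> r \<Longrightarrow> r < R \<Longrightarrow>
       (\<psi> has_real_derivative slope (\<lambda>t. a t * (R - t) powr (\<gamma> - \<alpha>) * \<psi> t powr p) r) (at r within {0..<R})"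
    using radial_large_solution_between_barriers[OF assms(1-3) N assms(4) a_pos assms(6-8) \<kappa>] by blast
  define f where "f t = a t * (R - t) powr (\<gamma> - \<alpha>) * \<psi> t powr p" for t
  define \<psi>'' where "\<psi>'' r = f r - ((real N - 1) / r - \<alpha> / (R - r)) * slope f r" for r
  have f: "continuous_on {0..<R} f" unfolding f_def using \<psi>(2)
    by (intro continuous_intros continuous_on_subset[OF assms(4)] \<psi>(1)) (auto simp: less_imp_neq[THEN not_sym])
  have d\<psi>: "(\<psi> has_real_derivative slope f r) (at r within {0..<R})" if "r \<in> {0..<R}" for r
    using \<psi>(5)[of r] that by (simp add: f_def[abs_def])
  have d\<psi>_at: "(\<psi> has_real_derivative slope f r) (at r)" if "r \<in> {0<..<R}" for r
    using d\<psi>[of r] that at_within_interior[of r "{0..<R}"] by simp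
  have d\<psi>': "(slope f has_real_derivative \<psi>'' r) (at r)" if "r \<in> {0<..<R}" for r
    unfolding \<psi>''_def using that by (intro ball_weight_slope_has_derivative[OF assms(2) N f]) auto
  have ode: "\<psi>'' r + ((real N - 1) / r - \<alpha> / (R - r)) * slope f r
      = a r * (R - r) powr (\<gamma> - \<alpha>) * \<psi> r powr p" for r by (simp add: \<psi>''_def f_def)
  have ratio: "\<forall>\<^sub>F r in at_left R. 1 - \<epsilon> \<le> \<psi> r / (K * (R - r) powr (- \<beta>)) \<and>
      \<psi> r / (K * (R - r) powr (- \<beta>)) \<le> 1 + \<epsilon>"
  proof -
    have "\<forall>\<^sub>F r in at_left R. 1 - \<epsilon> < barrier R \<beta> A\<^sub>1 ((1 - \<delta>) * K * (2 * R) powr \<beta>) r / (K * (R - r) powr (- \<beta>))"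
      by (rule order_tendstoD(1)[OF barrier_asymptotics[OF assms(2) \<beta>0 K refl]]) (use \<delta> in simp)
    moreover have "\<forall>\<^sub>F r in at_left R. barrier R \<beta> A\<^sub>2 ((1 + \<delta>) * K * (2 * R) powr \<beta>) r / (K * (R - r) powr (- \<beta>)) < 1 + \<epsilon>"
      by (rule order_tendstoD(2)[OF barrier_asymptotics[OF assms(2) \<beta>0 K refl]]) (use \<delta> in simp)
    ultimately show ?thesis using eventually_at_left_real[OF assms(2)]
    proof eventually_elim
      case (elim r)
      have pos: "0 < K * (R - r) powr (- \<beta>)" using K elim by simp
      show ?case
        using elim divide_right_mono[OF \<psi>(3)[of r], of "K * (R - r) powr (- \<beta>)"]
          divide_right_mono[OF \<psi>(4)[of r], of "K * (R - r) powr (- \<beta>)"] pos by auto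
    qed
  qed
  have blow_up: "filterlim \<psi> at_top (at_left R)"
  proof (rule filterlim_at_top_mono)
    let ?B = "barrier R \<beta> A\<^sub>1 ((1 - \<delta>) * K * (2 * R) powr \<beta>)" and ?w = "\<lambda>r. K * (R - r) powr (- \<beta>)"
    have "filterlim (\<lambda>r. R - r) (at_right 0) (at_left R)"
      unfolding filterlim_at using eventually_at_left_real[OF assms(2)]
      by (auto intro!: tendsto_eq_intros elim: eventually_mono)
    then have "filterlim (\<lambda>r. (R - r) powr (- \<beta>)) at_top (at_left R)"
      unfolding powr_minus using \<beta>0
      by (intro filterlim_compose[OF filterlim_inverse_at_top_right])
        (auto simp: filterlim_at intro!: tendsto_zero_powrI[where b = \<beta>] elim: eventually_mono)
    then have "filterlim ?w at_top (at_left R)"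
      by (rule filterlim_tendsto_pos_mult_at_top[OF tendsto_const K])
    then have "filterlim (\<lambda>r. ?B r / ?w r * ?w r) at_top (at_left R)"
      by (rule filterlim_tendsto_pos_mult_at_top[OF barrier_asymptotics[OF assms(2) \<beta>0 K refl] \<kappa>(1)])
    moreover have "\<forall>\<^sub>F r in at_left R. ?B r / ?w r * ?w r = ?B r"
      using eventually_at_left_real[OF assms(2)] by eventually_elim (use K in auto)
    ultimately show "filterlim ?B at_top (at_left R)" by (rule filterlim_mono_eventually[OF _ order_refl order_refl])
    show "\<forall>\<^sub>F r in at_left R. ?B r \<le> \<psi> r"
      using eventually_at_left_real[OF assms(2)] by eventually_elim (use \<psi>(3) in auto)
  qed
  have solution: "radial_large_solution CARD('n) R \<alpha> \<gamma> p a \<psi>"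
    unfolding radial_large_solution_def N_def[symmetric]
  proof (rule conjI[OF exI[of _ "slope f", OF exI[of _ \<psi>'']] blow_up], intro conjI ballI)
    show "continuous_on {0<..<R} \<psi>''" unfolding \<psi>''_def
      by (intro continuous_intros continuous_on_subset[OF f] continuous_on_subset[OF slope_cont[OF f]]) auto
  qed (use d\<psi> d\<psi>' slope_cont[OF f] ode in auto)
  have ball_part: "local_weak_large_solution x\<^sub>0 R \<alpha> \<gamma> p a (\<lambda>x. \<psi> (norm (x - x\<^sub>0)))" for x\<^sub>0 :: "real ^ 'n"
  proof (rule radial_solution_is_weak_solution[OF assms(2,4) \<psi>(1) d\<psi>_at _ blow_up slope_cont[OF f] slope_0 d\<psi>'])
    show "\<exists>C. \<forall>s\<in>{0..b}. \<bar>slope f s\<bar> \<le> C * s" if "b < R" for b by (rule slope_linear_bound[OF f that])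
    show "\<psi>'' r + ((real DIM(real ^ 'n) - 1) / r - \<alpha> / (R - r)) * slope f r
        = a r * (R - r) powr (\<gamma> - \<alpha>) * \<psi> r powr p" for r
      using ode[of r] by (simp add: N_def)
  qed (use \<psi>(2) in auto)
  have limits: "ereal (1 - \<epsilon>) \<le> Liminf F g \<and> Liminf F g \<le> Limsup F g \<and> Limsup F g \<le> ereal (1 + \<epsilon>)"
    if "F \<noteq> bot" "\<forall>\<^sub>F x in F. ereal (1 - \<epsilon>) \<le> g x \<and> g x \<le> ereal (1 + \<epsilon>)" for F and g :: "'c \<Rightarrow> ereal"
    using that by (intro conjI Liminf_bounded Limsup_bounded Liminf_le_Limsup) (auto elim: eventually_mono)
  have at_R: "\<forall>\<^sub>F r in at_left R. ereal (1 - \<epsilon>) \<le> ereal (\<psi> r / (K * (R - r) powr (- \<beta>))) \<and>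
      ereal (\<psi> r / (K * (R - r) powr (- \<beta>))) \<le> ereal (1 + \<epsilon>)"
    using ratio by simp
  have at_boundary: "\<forall>\<^sub>F x in to_boundary x\<^sub>0 R.
      ereal (1 - \<epsilon>) \<le> ereal (\<psi> (norm (x - x\<^sub>0)) / (K * bdist x\<^sub>0 R x powr (- \<beta>))) \<and>
      ereal (\<psi> (norm (x - x\<^sub>0)) / (K * bdist x\<^sub>0 R x powr (- \<beta>))) \<le> ereal (1 + \<epsilon>)" for x\<^sub>0 :: "real ^ 'n"
  proof -
    have "\<forall>\<^sub>F x in to_boundary x\<^sub>0 R. x \<in> ball x\<^sub>0 R"
      unfolding to_boundary_def by (rule filter_leD[OF inf_le2]) (simp add: eventually_principal)
    moreover have "\<forall>\<^sub>F x in to_boundary x\<^sub>0 R.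
        1 - \<epsilon> \<le> \<psi> (norm (x - x\<^sub>0)) / (K * (R - norm (x - x\<^sub>0)) powr (- \<beta>)) \<and>
        \<psi> (norm (x - x\<^sub>0)) / (K * (R - norm (x - x\<^sub>0)) powr (- \<beta>)) \<le> 1 + \<epsilon>"
      by (rule eventually_compose_filterlim[OF ratio filterlim_norm_to_boundary])
    ultimately show ?thesis by eventually_elim (simp add: bdist_eq)
  qed
  show ?thesis
  proof (intro exI[of _ \<psi>] conjI allI impI)
    show "radial_large_solution CARD('n) R \<alpha> \<gamma> p a \<psi>" by (rule solution)
    show "\<forall>r\<in>{0..<R}. \<psi> r > 0" using \<psi>(2) by auto
    note limits[OF trivial_limit_at_left_real at_R]
    then show "ereal (1 - \<epsilon>) \<le> Liminf (at_left R) (\<lambda>r. ereal (\<psi> r / (K * (R - r) powr (- \<beta>))))"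
      "Liminf (at_left R) (\<lambda>r. ereal (\<psi> r / (K * (R - r) powr (- \<beta>))))
        \<le> Limsup (at_left R) (\<lambda>r. ereal (\<psi> r / (K * (R - r) powr (- \<beta>))))"
      "Limsup (at_left R) (\<lambda>r. ereal (\<psi> r / (K * (R - r) powr (- \<beta>)))) \<le> ereal (1 + \<epsilon>)" by blast+
    fix x\<^sub>0 :: "real ^ 'n" and u assume u: "u = (\<lambda>x. \<psi> (norm (x - x\<^sub>0)))"
    show "local_weak_large_solution x\<^sub>0 R \<alpha> \<gamma> p a u" unfolding u by (rule ball_part)
    show "\<forall>x\<in>ball x\<^sub>0 R. u x \<ge> 0"
      unfolding u using \<psi>(2) by (auto simp: dist_norm norm_minus_commute intro!: less_imp_le)
    note limits[OF to_boundary_neq_bot[OF assms(2)] at_boundary[of x\<^sub>0]]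
    then show "ereal (1 - \<epsilon>) \<le> Liminf (to_boundary x\<^sub>0 R) (\<lambda>x. ereal (u x / (K * bdist x\<^sub>0 R x powr (- \<beta>))))"
      "Liminf (to_boundary x\<^sub>0 R) (\<lambda>x. ereal (u x / (K * bdist x\<^sub>0 R x powr (- \<beta>))))
         \<le> Limsup (to_boundary x\<^sub>0 R) (\<lambda>x. ereal (u x / (K * bdist x\<^sub>0 R x powr (- \<beta>))))"
      "Limsup (to_boundary x\<^sub>0 R) (\<lambda>x. ereal (u x / (K * bdist x\<^sub>0 R x powr (- \<beta>)))) \<le> ereal (1 + \<epsilon>)"
      unfolding u by blast+
  qed
qed

end
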